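(* Let $a>1$ be a fixed integer with $a\notin\{2,8\}$. Then there is an effectively computable bound $C=C(a)$, depending only on $a$, such that whenever $b,c$ are distinct integers larger than $1$ with $b\neq a$, $c\neq a$, and $(a,b,c)$, $(a+1,b+1,c+1)$ and $(a+2,b+2,c+2)$ are each multiplicatively dependent, we have $\max\{a,b,c\}<C$.
   Context: An $n$-tuple $(z_1,\ldots,z_n)\in\mathbb{C}^n$ is called multiplicatively dependent if there exists a non-zero integer vector $(k_1,\ldots,k_n)\in\mathbb{Z}^n$ such that $z_1^{k_1}\cdots z_n^{k_n}=1$; otherwise it is called multiplicatively independent. *)

theory Defs
  imports Complex_Main
begin

text \<open>
  If some \<open>z\<^sub>i = 0\<close> has a negative exponent, then \<open>powi\<close> yields \<open>0\<close> and the product is not \<open>1\<close>,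
  so undefined powers never witness a dependence.
\<close>

definition multiplicatively_dependent :: "complex list \<Rightarrow> bool" where
  "multiplicatively_dependent zs \<longleftrightarrow>
     (\<exists>ks :: int list. length ks = length zs \<and> (\<exists>k\<in>set ks. k \<noteq> 0) \<and>
        (\<Prod>i<length zs. (zs ! i) powi (ks ! i)) = 1)"

text \<open>
  Kleene's general recursive functions. The proposition \<open>general_recursive n f\<close> says that \<open>f\<close> is
  a total recursive function of \<open>n\<close> arguments; the arguments are passed as a list of length \<open>n\<close>,
  and the values of \<open>f\<close> on lists of any other length carry no meaning. Minimization is restricted
  to regular functions, that is, those for which the search ends for all arguments, so that
  only total functions occur; by Kleene's normal form theorem, these are exactly the total
  computable functions.
\<close>

inductive general_recursive :: "nat \<Rightarrow> (nat list \<Rightarrow> nat) \<Rightarrow> bool" where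
  zero: "general_recursive n (\<lambda>_. 0)"
| succ: "general_recursive 1 (\<lambda>xs. Suc (xs ! 0))"
| proj: "i < n \<Longrightarrow> general_recursive n (\<lambda>xs. xs ! i)"
| comp: "general_recursive (length gs) f \<Longrightarrow> (\<forall>g\<in>set gs. general_recursive n g) \<Longrightarrow>
    general_recursive n (\<lambda>xs. f (map (\<lambda>g. g xs) gs))"
| prim_rec: "general_recursive n f \<Longrightarrow> general_recursive (n + 2) g \<Longrightarrow>
    general_recursive (n + 1)
      (\<lambda>xs. rec_nat (f (tl xs)) (\<lambda>m r. g (m # r # tl xs)) (hd xs))"
| minimize: "general_recursive (n + 1) f \<Longrightarrow>
    (\<forall>xs. length xs = n \<longrightarrow> (\<exists>m. f (m # xs) = 0)) \<Longrightarrow>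
    general_recursive n (\<lambda>xs. LEAST m. f (m # xs) = 0)"

definition effectively_computable :: "(nat \<Rightarrow> nat) \<Rightarrow> bool" where
  "effectively_computable F \<longleftrightarrow> (\<exists>f. general_recursive 1 f \<and> (\<forall>n. F n = f [n]))"

end

theory Submission
  imports Defs "HOL-Complex_Analysis.Complex_Analysis"
begin

text \<open>
  A dependence of \<open>(a + i, b + i, c + i)\<close> is an integer relation between logarithms, whose coefficients may
  be taken of size polynomial in \<open>ln c\<close>; let \<open>b < c\<close>. Since \<open>ln (b + i)\<close> and \<open>ln b\<close> differ by \<open>O(1/b)\<close>, eliminating
  \<open>ln b\<close> and \<open>ln c\<close> from the three relations leaves a linear form in \<open>ln a\<close>, \<open>ln (a + 1)\<close>, \<open>ln (a + 2)\<close> of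
  size about \<open>1/b\<close>, and Baker's theorem bounds \<open>ln b\<close> polynomially in \<open>ln ln c\<close>. Eliminating \<open>ln c\<close> from two
  of the relations then leaves a linear form in four logarithms of size about \<open>1/c\<close>, and Baker's theorem
  bounds \<open>c\<close>. The forms vanish only if \<open>(u, v)\<close> and \<open>(u + d, v + d)\<close> are both dependent for some \<open>u < v\<close> and
  \<open>d \<in> {1, 2}\<close>. For \<open>d = 1\<close> this forces \<open>(u, v) = (2, 8)\<close>, as LeVeque showed; for \<open>d = 2\<close> it reduces to
  \<open>(u + 2) ^ e - u ^ f = 2\<close> with odd exponents, which is impossible because the Pell equation
  \<open>(u + 2) * x\<^sup>2 - u * y\<^sup>2 = 2\<close> has no further solution in which \<open>x\<close> and \<open>y\<close> have no prime factors besides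
  those of \<open>u + 2\<close> and \<open>u\<close>.

  Baker's theorem is needed only for integer logarithms and up to the constants. A small linear form
  makes the function \<open>\<Sum>v. p v * c v ^ m * exp (w v * z)\<close> behave at integers as if its derivatives were combinations
  of its variants with larger \<open>m\<close>. Siegel's lemma supplies coefficients \<open>p\<close> for which these vanish at a few
  integers; interpolation makes the values at more integers, which are themselves integers, smaller
  than \<open>1\<close> and so zero. Repeating this yields a singular Vandermonde system, a contradiction.
\<close>

section \<open>Interpolation of entire functions at small values\<close>

text \<open>The excluded values are genuine exceptions: \<open>(2, 8)\<close> and
  \<open>(3, 9)\<close> are dependent pairs, so for \<open>{a, b} = {2, 8}\<close> every
  \<open>c = 4 ^ k - 2\<close> with \<open>k \<ge> 2\<close> satisfies all three conditions. Weak
  forms of Baker's theorem suffice: the size \<open>X\<close> of the coefficients' logarithms is of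
  order \<open>ln ln c\<close>, and two nested polynomials in \<open>ln ln c\<close> still stay
  below \<open>ln c\<close>. Hence a lower bound \<open>exp (- (C * X) ^ C)\<close> with any
  \<open>C\<close> will do and no exponent is optimized; only a bound exponential in
  \<open>X\<close> would be useless. As the numbers are integers, "a nonzero integer is at least 1"
  replaces all height estimates. The obstacle is that the four logarithms of the second form can be
  dependent or even coincide, whereas the Vandermonde argument needs independent ones. The lower
  bound is therefore extended to nonzero forms in dependent logarithms, by eliminating along
  relations with small coefficients. The bound on such relations also provides the small exponents
  in the three given dependences.\<close>

lemma entire_divided_difference:
  fixes F :: "complex \<Rightarrow> complex"
  assumes "F holomorphic_on UNIV"
  obtains G where "G holomorphic_on UNIV" "\<And>z. F z = F a + (z - a) * G z"
proof
  let ?G = "\<lambda>z. if z = a then deriv F a else (F z - F a) / (z - a)"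
  show "?G holomorphic_on UNIV"
    using assms by (intro pole_lemma) auto
  show "F z = F a + (z - a) * ?G z" for z
    by auto
qed

lemma higher_deriv_divided_difference:
  fixes F G :: "complex \<Rightarrow> complex"
  assumes G: "G holomorphic_on UNIV" and FG: "\<And>z. F z = F a + (z - a) * G z"
  shows "(deriv ^^ Suc j) F z = (z - a) * (deriv ^^ Suc j) G z + of_nat (Suc j) * (deriv ^^ j) G z"
proof (induction j arbitrary: z)
  case 0
  have "F = (\<lambda>z. F a + (z - a) * G z)"
    using FG by blast
  moreover have "((\<lambda>z. F a + (z - a) * G z) has_field_derivative (z - a) * deriv G z + G z) (at z)"
    using G by (auto intro!: derivative_eq_intros holomorphic_derivI[of G UNIV])
  ultimately have "deriv F z = (z - a) * deriv G z + G z"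
    by (metis DERIV_imp_deriv)
  then show ?case by simp
next
  case (Suc j)
  have hol: "(deriv ^^ k) G holomorphic_on UNIV" for k
    using G by (intro holomorphic_higher_deriv) auto
  have "(deriv ^^ Suc j) F = (\<lambda>z. (z - a) * (deriv ^^ Suc j) G z + of_nat (Suc j) * (deriv ^^ j) G z)"
    using Suc by blast
  moreover have "((\<lambda>z. (z - a) * (deriv ^^ Suc j) G z + of_nat (Suc j) * (deriv ^^ j) G z) has_field_derivative
     (z - a) * deriv ((deriv ^^ Suc j) G) z + (deriv ^^ Suc j) G z
       + of_nat (Suc j) * deriv ((deriv ^^ j) G) z) (at z)"
    using holomorphic_derivI[OF hol[of "Suc j"] open_UNIV UNIV_I] holomorphic_derivI[OF hol[of j] open_UNIV UNIV_I]
    by (auto intro!: derivative_eq_intros)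
  ultimately have "deriv ((deriv ^^ Suc j) F) z = (z - a) * deriv ((deriv ^^ Suc j) G) z + (deriv ^^ Suc j) G z
       + of_nat (Suc j) * deriv ((deriv ^^ j) G) z"
    by (metis DERIV_imp_deriv)
  then show ?case by (simp add: algebra_simps)
qed

text \<open>Newton interpolation: each node \<open>a\<close>, listed as often as its multiplicity,
  is split off by passing to the divided difference \<open>G\<close>. On the circle this divides the
  maximum by \<open>\<rho>\<close>, and multiplying back costs \<open>s\<close>, whence the gain
  \<open>s / \<rho>\<close> per node; the prescribed data worsen by at most
  \<open>2 * (N + 1) ^ N\<close>. The bound \<open>N\<close> on the length stays fixed in the
  induction, so that this factor does not change.\<close>

lemma entire_interpolation_bound:
  fixes F :: "complex \<Rightarrow> complex" and xs :: "nat list"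
  assumes "F holomorphic_on UNIV"
    and "\<And>z. norm z = R \<Longrightarrow> norm (F z) \<le> M"
    and "\<And>a j. j < count_list xs a \<Longrightarrow> norm ((deriv ^^ j) F (of_nat a)) \<le> \<delta>"
    and "length xs \<le> N" and "\<And>a. a \<in> set xs \<Longrightarrow> real a \<le> h"
    and "0 \<le> \<delta>" "0 \<le> h" "h + \<rho> \<le> R" "1 \<le> \<rho>" "r + h \<le> s" "1 \<le> s" "s \<le> \<rho>" "norm z \<le> r"
  shows "norm (F z) \<le> M * (s / \<rho>) ^ length xs + \<delta> * (2 + 2 * s * real (N + 1) ^ N) ^ length xs"
  using assms
proof (induction xs arbitrary: F M \<delta>)
  case Nil
  have "norm (F z) \<le> M"
  proof (rule maximum_modulus_frontier[of F "cball 0 R"])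
    show "F holomorphic_on interior (cball 0 R)" "continuous_on (closure (cball 0 R)) F"
      using Nil.prems(1) by (auto intro: holomorphic_on_subset holomorphic_on_imp_continuous_on)
    show "z \<in> cball 0 R"
      using Nil.prems by auto
    have "R > 0" using Nil.prems by linarith
    then show "\<And>z. z \<in> frontier (cball 0 R) \<Longrightarrow> norm (F z) \<le> M"
      using Nil.prems(2) by (auto simp: sphere_def)
  qed auto
  then show ?case using Nil.prems by simp
next
  case (Cons a xs)
  define D where "D = 2 * real (N + 1) ^ N"
  have N1: "real (N + 1) ^ N \<ge> 1" by (intro one_le_power) auto
  have ah: "real a \<le> h" using Cons.prems(5) by simp
  have Fa: "norm (F (of_nat a)) \<le> \<delta>"
    using Cons.prems(3)[of 0 a] by simp
  obtain G where G: "G holomorphic_on UNIV" "\<And>z. F z = F (of_nat a) + (z - of_nat a) * G z"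
    using entire_divided_difference[OF Cons.prems(1), of "of_nat a"] by blast
  note hd = higher_deriv_divided_difference[OF G]
  \<comment> \<open>At \<open>a\<close> itself one order is lost, which matches the removed
    occurrence of \<open>a\<close>. At other nodes one divides by \<open>l - a\<close>, of modulus
    at least 1 because the nodes are integers.\<close>
  have small: "norm ((deriv ^^ j) G (of_nat l)) \<le> D * \<delta>" if j: "j < count_list xs l" for l j
  proof (cases "l = a")
    case True
    have "real (Suc j) * norm ((deriv ^^ j) G (of_nat a)) = norm ((deriv ^^ Suc j) F (of_nat a))"
      by (subst hd) (simp add: norm_mult del: of_nat_Suc)
    also have "\<dots> \<le> \<delta>"
      using Cons.prems(3)[of "Suc j" a] j True by simp
    finally have "real (Suc j) * norm ((deriv ^^ j) G (of_nat a)) \<le> \<delta>" .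
    moreover have "1 * norm ((deriv ^^ j) G (of_nat a)) \<le> real (Suc j) * norm ((deriv ^^ j) G (of_nat a))"
      by (intro mult_right_mono) auto
    moreover have "1 * \<delta> \<le> D * \<delta>"
      using N1 Cons.prems(6) unfolding D_def by (intro mult_right_mono) linarith+
    ultimately show ?thesis using True by simp
  next
    case False
    have dist: "1 \<le> norm (of_nat l - of_nat a :: complex)"
    proof -
      have "norm (of_nat l - of_nat a :: complex) = \<bar>real l - real a\<bar>"
        by (metis norm_of_real of_real_diff of_real_of_nat_eq)
      then show ?thesis using False by linarith
    qed
    have le: "norm u \<le> norm ((of_nat l - of_nat a) * u)" for u :: complex
      using dist by (simp add: norm_mult mult_le_cancel_right1)
    have cl: "count_list (a # xs) l = count_list xs l" using False by simp
    have cN: "count_list xs l \<le> N"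
      using Cons.prems(4) count_le_length[of xs l] by simp
    have "i < count_list xs l \<Longrightarrow> norm ((deriv ^^ i) G (of_nat l)) \<le> 2 * real (N + 1) ^ i * \<delta>" for i
    proof (induction i)
      case 0
      have "norm (G (of_nat l)) \<le> norm (F (of_nat l) - F (of_nat a))"
        using le[of "G (of_nat l)"] G(2)[of "of_nat l"] by (metis add_diff_cancel_left')
      also have "\<dots> \<le> norm (F (of_nat l)) + norm (F (of_nat a))"
        by (rule norm_triangle_ineq4)
      also have "\<dots> \<le> \<delta> + \<delta>"
        using Fa Cons.prems(3)[of 0 l] 0 cl by auto
      finally show ?case by simp
    next
      case (Suc i)
      have *: "norm ((deriv ^^ i) G (of_nat l)) \<le> 2 * real (N + 1) ^ i * \<delta>"
        using Suc by auto
      have iN: "real (Suc i) + 1 \<le> real (N + 1)" using Suc.prems cN by simp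
      have "norm ((deriv ^^ Suc i) G (of_nat l)) \<le> norm ((of_nat l - of_nat a) * (deriv ^^ Suc i) G (of_nat l))"
        by (rule le)
      also have "\<dots> = norm ((deriv ^^ Suc i) F (of_nat l) - of_nat (Suc i) * (deriv ^^ i) G (of_nat l))"
        by (subst hd) simp
      also have "\<dots> \<le> norm ((deriv ^^ Suc i) F (of_nat l)) + real (Suc i) * norm ((deriv ^^ i) G (of_nat l))"
        by (metis norm_mult norm_of_nat norm_triangle_ineq4)
      also have "\<dots> \<le> \<delta> + real (Suc i) * (2 * real (N + 1) ^ i * \<delta>)"
        using Cons.prems(3)[of "Suc i" l] Suc.prems cl * by (intro add_mono mult_left_mono) auto
      also have "\<dots> \<le> (2 * real (N + 1) ^ i * \<delta>) + real (Suc i) * (2 * real (N + 1) ^ i * \<delta>)"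
      proof -
        have "(1::real) \<le> real (N + 1) ^ i" by (intro one_le_power) auto
        then have "1 * \<delta> \<le> 2 * real (N + 1) ^ i * \<delta>"
          using Cons.prems(6) by (intro mult_right_mono) linarith+
        then show ?thesis by simp
      qed
      also have "\<dots> = (real (Suc i) + 1) * (2 * real (N + 1) ^ i * \<delta>)"
        by (simp add: algebra_simps)
      also have "\<dots> \<le> real (N + 1) * (2 * real (N + 1) ^ i * \<delta>)"
        using iN Cons.prems(6) by (intro mult_right_mono) auto
      finally show ?case by simp
    qed
    from this[OF j] have "norm ((deriv ^^ j) G (of_nat l)) \<le> 2 * real (N + 1) ^ j * \<delta>" .
    also have "\<dots> \<le> D * \<delta>"
      unfolding D_def using j cN Cons.prems(6)
      by (intro mult_right_mono mult_left_mono power_increasing) auto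
    finally show ?thesis .
  qed
  have "norm (G z) \<le> ((M + \<delta>) / \<rho>) * (s / \<rho>) ^ length xs
      + (D * \<delta>) * (2 + 2 * s * real (N + 1) ^ N) ^ length xs"
  proof (rule Cons.IH)
    show "G holomorphic_on UNIV" by (rule G)
    fix w :: complex assume w: "norm w = R"
    have "\<rho> \<le> norm (w - of_nat a)"
      using norm_triangle_ineq2[of w "of_nat a"] w ah Cons.prems(8) by simp
    then have "\<rho> * norm (G w) \<le> norm (w - of_nat a) * norm (G w)"
      by (intro mult_right_mono) auto
    also have "\<dots> = norm (F w - F (of_nat a))"
      using G(2)[of w] by (metis add_diff_cancel_left' norm_mult)
    also have "\<dots> \<le> M + \<delta>"
      using norm_triangle_ineq4[of "F w" "F (of_nat a)"] Fa Cons.prems(2)[OF w] by linarith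
    finally show "norm (G w) \<le> (M + \<delta>) / \<rho>"
      using Cons.prems(9) by (simp add: field_simps)
  qed (use Cons.prems small N1 in \<open>auto simp: D_def\<close>)
  moreover have "norm (z - of_nat a) \<le> s"
    using norm_triangle_ineq4[of z "of_nat a"] Cons.prems(10,13) ah by simp
  ultimately have "norm (z - of_nat a) * norm (G z) \<le> s * (((M + \<delta>) / \<rho>) * (s / \<rho>) ^ length xs
      + (D * \<delta>) * (2 + 2 * s * real (N + 1) ^ N) ^ length xs)"
    by (intro mult_mono) (use Cons.prems in auto)
  moreover have "norm (F z) \<le> \<delta> + norm (z - of_nat a) * norm (G z)"
    using G(2)[of z] Fa by (metis add.commute add_mono_thms_linordered_semiring(2) norm_mult norm_triangle_le)
  ultimately have "norm (F z) \<le> \<delta> + s * (((M + \<delta>) / \<rho>) * (s / \<rho>) ^ length xs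
      + (D * \<delta>) * (2 + 2 * s * real (N + 1) ^ N) ^ length xs)"
    by linarith
  also have "\<dots> = M * (s / \<rho>) ^ Suc (length xs) + \<delta> * (1 + (s / \<rho>) ^ Suc (length xs)
      + s * D * (2 + s * D) ^ length xs)"
    unfolding D_def by (simp add: algebra_simps add_divide_distrib)
  \<comment> \<open>The three error terms stem from \<open>F a\<close>, from the
    \<open>\<delta>\<close> in the bound \<open>M + \<delta>\<close> on the circle, and from the
    data of \<open>G\<close>. The summand 2 in the base absorbs the first two.\<close>
  also have "\<dots> \<le> M * (s / \<rho>) ^ Suc (length xs) + \<delta> * (2 + s * D) ^ Suc (length xs)"
  proof -
    have "(s / \<rho>) ^ Suc (length xs) \<le> 1"
      using Cons.prems by (intro power_le_one) auto
    moreover have "1 \<le> (2 + s * D) ^ length xs"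
      using Cons.prems N1 by (intro one_le_power) (auto simp: D_def)
    ultimately have "1 + (s / \<rho>) ^ Suc (length xs) + s * D * (2 + s * D) ^ length xs
       \<le> 2 * (2 + s * D) ^ length xs + s * D * (2 + s * D) ^ length xs" by linarith
    also have "\<dots> = (2 + s * D) ^ Suc (length xs)" by (simp add: algebra_simps)
    finally show ?thesis using Cons.prems(6) by (intro add_left_mono mult_left_mono)
  qed
  finally show ?case by (simp add: D_def algebra_simps)
qed

section \<open>Siegel's lemma and Vandermonde systems\<close>

text \<open>Pigeonhole: \<open>Y\<close> is chosen so that each equation takes its values among
  \<open>Y\<^sup>2 + 1\<close> integers, fewer than \<open>(Y + 1)\<^sup>2\<close>; with two
  unknowns per equation the map cannot be injective. Differences of vectors with entries in
  \<open>{0..Y}\<close> stay bounded by \<open>Y\<close>.\<close>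

lemma siegel:
  fixes a :: "'e \<Rightarrow> 'v \<Rightarrow> int" and B :: int
  assumes fin: "finite E" "finite V" and card: "2 * card E \<le> card V" "card V > 0"
    and bd: "\<And>e v. e \<in> E \<Longrightarrow> v \<in> V \<Longrightarrow> \<bar>a e v\<bar> \<le> B" and B: "B \<ge> 1"
  obtains p where "\<exists>v\<in>V. p v \<noteq> 0" "\<And>v. v \<in> V \<Longrightarrow> \<bar>p v\<bar> \<le> 2 * int (card V) * B"
    "\<And>e. e \<in> E \<Longrightarrow> (\<Sum>v\<in>V. a e v * p v) = 0"
proof -
  define Y where "Y = 2 * int (card V) * B"
  have "1 * 1 \<le> int (card V) * B" using card B by (intro mult_mono) auto
  then have Y: "Y \<ge> 1" unfolding Y_def by simp
  define P where "P = PiE V (\<lambda>_. {0..Y})"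
  define Q where "Q = PiE E (\<lambda>_. {- (int (card V) * B * Y)..int (card V) * B * Y})"
  define \<phi> where "\<phi> = (\<lambda>p. \<lambda>e\<in>E. \<Sum>v\<in>V. a e v * p v)"
  have YY: "2 * (int (card V) * B * Y) + 1 = Y * Y + 1" unfolding Y_def by simp
  have cP: "card P = nat (Y + 1) ^ card V"
    unfolding P_def using fin by (simp add: card_PiE)
  have cQ: "card Q = nat (Y * Y + 1) ^ card E"
  proof -
    have "card {- (int (card V) * B * Y)..int (card V) * B * Y} = nat (Y * Y + 1)"
      unfolding YY[symmetric] by (simp add: mult_ac)
    then show ?thesis unfolding Q_def using fin by (simp add: card_PiE)
  qed
  have finQ: "finite Q" unfolding Q_def using fin by (intro finite_PiE) auto
  have im: "\<phi> ` P \<subseteq> Q"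
  proof
    fix y assume "y \<in> \<phi> ` P"
    then obtain p where p: "p \<in> P" "y = \<phi> p" by blast
    have "\<bar>\<Sum>v\<in>V. a e v * p v\<bar> \<le> int (card V) * B * Y" if "e \<in> E" for e
    proof -
      have "\<bar>\<Sum>v\<in>V. a e v * p v\<bar> \<le> (\<Sum>v\<in>V. \<bar>a e v * p v\<bar>)" by (rule sum_abs)
      also have "\<dots> \<le> (\<Sum>v\<in>V. B * Y)"
      proof (rule sum_mono)
        fix v assume v: "v \<in> V"
        then have "\<bar>p v\<bar> \<le> Y" using p unfolding P_def by (force simp: PiE_iff)
        then show "\<bar>a e v * p v\<bar> \<le> B * Y"
          unfolding abs_mult using bd[OF that v] B by (intro mult_mono) auto
      qed
      finally show ?thesis by (simp add: algebra_simps)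
    qed
    then have "\<forall>e\<in>E. (\<Sum>v\<in>V. a e v * p v) \<in> {- (int (card V) * B * Y)..int (card V) * B * Y}"
      by (auto simp: abs_le_iff minus_le_iff)
    then show "y \<in> Q" unfolding p(2) \<phi>_def Q_def by (auto simp: PiE_iff)
  qed
  have "card Q < card P"
  proof -
    have "Y * Y + 1 < (Y + 1) ^ 2" using Y by (simp add: power2_eq_square algebra_simps)
    then have l: "nat (Y * Y + 1) < nat (Y + 1) ^ 2"
      using Y by (simp add: nat_power_eq[symmetric])
    show ?thesis
    proof (cases "card E = 0")
      case True
      have "1 < nat (Y + 1) ^ card V" using Y card(2) by (intro one_less_power) auto
      then show ?thesis unfolding cP cQ True by simp
    next
      case False
      have "nat (Y * Y + 1) ^ card E < (nat (Y + 1) ^ 2) ^ card E"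
        using l False by (intro power_strict_mono) auto
      also have "\<dots> = nat (Y + 1) ^ (2 * card E)" by (simp add: power_mult)
      also have "\<dots> \<le> nat (Y + 1) ^ card V"
        using card Y by (intro power_increasing) auto
      finally show ?thesis unfolding cP cQ .
    qed
  qed
  then have "\<not> inj_on \<phi> P"
    using im finQ by (metis card_inj_on_le not_less)
  then obtain p q where pq: "p \<in> P" "q \<in> P" "\<phi> p = \<phi> q" "p \<noteq> q"
    unfolding inj_on_def by blast
  show thesis
  proof (rule that[of "\<lambda>v. p v - q v"])
    show "\<exists>v\<in>V. p v - q v \<noteq> 0"
    proof (rule ccontr)
      assume "\<not> ?thesis"
      then have "p = q" using pq(1,2) unfolding P_def by (intro PiE_ext) auto
      then show False using pq(4) by simp
    qed
    show "\<bar>p v - q v\<bar> \<le> 2 * int (card V) * B" if "v \<in> V" for v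
      using PiE_mem[OF pq(1)[unfolded P_def] that] PiE_mem[OF pq(2)[unfolded P_def] that]
      unfolding Y_def[symmetric] by auto
    show "(\<Sum>v\<in>V. a e v * (p v - q v)) = 0" if "e \<in> E" for e
    proof -
      have "\<phi> p e = \<phi> q e" using pq by simp
      then show ?thesis using that unfolding \<phi>_def by (simp add: right_diff_distrib sum_subtractf)
    qed
  qed
qed

text \<open>By linearity the weighted sum vanishes for every polynomial of degree below
  \<open>card V\<close>; the one with roots \<open>x v\<close> for \<open>v \<noteq> u\<close>
  isolates \<open>p u\<close>.\<close>

lemma vandermonde_trivial_kernel:
  fixes x :: "'v \<Rightarrow> 'a :: field" and p :: "'v \<Rightarrow> 'a"
  assumes fin: "finite V" and inj: "inj_on x V"
    and z: "\<And>l. l < card V \<Longrightarrow> (\<Sum>v\<in>V. p v * x v ^ l) = 0" and u: "u \<in> V"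
  shows "p u = 0"
proof -
  define P where "P = (\<Prod>v\<in>V - {u}. [:- x v, 1:])"
  have deg: "degree P < card V"
  proof -
    have "degree P \<le> (\<Sum>v\<in>V - {u}. degree [:- x v, 1:])"
      unfolding P_def using degree_prod_sum_le[of "V - {u}" "\<lambda>v. [:- x v, 1:]"] fin by (simp add: o_def)
    also have "\<dots> = card (V - {u})" by simp
    also have "\<dots> < card V" using fin u by (meson card_Diff1_less)
    finally show ?thesis .
  qed
  have "(\<Sum>v\<in>V. p v * poly P (x v)) = (\<Sum>v\<in>V. \<Sum>l\<le>degree P. coeff P l * (p v * x v ^ l))"
    by (simp add: poly_altdef sum_distrib_left algebra_simps)
  also have "\<dots> = (\<Sum>l\<le>degree P. coeff P l * (\<Sum>v\<in>V. p v * x v ^ l))"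
    by (subst sum.swap) (simp add: sum_distrib_left)
  also have "\<dots> = 0" using z deg by (intro sum.neutral) auto
  finally have "(\<Sum>v\<in>V. p v * poly P (x v)) = 0" .
  moreover have "(\<Sum>v\<in>V. p v * poly P (x v)) = p u * poly P (x u)"
  proof -
    have "poly P (x v) = 0" if "v \<in> V - {u}" for v
      unfolding P_def poly_prod using fin that by (intro prod_zero) auto
    then show ?thesis using fin u by (subst sum.remove[of V u]) auto
  qed
  moreover have "poly P (x u) \<noteq> 0"
    unfolding P_def poly_prod using fin inj u by (auto simp: prod_zero_iff inj_on_def)
  ultimately show ?thesis by simp
qed

section \<open>Linear forms in logarithms of integers\<close>

lemma count_list_concat_replicate:
  "count_list (concat (map (replicate T) [0..<h])) l = (if l < h then T else 0)"
proof (induction h)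
  case (Suc h)
  have "count_list (replicate T h) l = (if h = l then T else 0)"
    by (induction T) auto
  then show ?case using Suc by (auto simp: count_list_append)
qed simp

lemma length_concat_replicate: "length (concat (map (replicate T) [0..<h])) = h * T"
  by (induction h) auto

lemma abs_power_diff_le:
  fixes x y G :: real
  assumes "\<bar>x\<bar> \<le> G" "\<bar>y\<bar> \<le> G" "1 \<le> G"
  shows "\<bar>x ^ j - y ^ j\<bar> \<le> real j * G ^ j * \<bar>x - y\<bar>"
proof (induction j)
  case (Suc j)
  have "\<bar>x ^ Suc j - y ^ Suc j\<bar> = \<bar>x * (x ^ j - y ^ j) + (x - y) * y ^ j\<bar>"
    by (simp add: algebra_simps)
  also have "\<dots> \<le> \<bar>x\<bar> * \<bar>x ^ j - y ^ j\<bar> + \<bar>x - y\<bar> * \<bar>y\<bar> ^ j"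
    by (metis abs_mult abs_triangle_ineq power_abs)
  also have "\<dots> \<le> G * (real j * G ^ j * \<bar>x - y\<bar>) + \<bar>x - y\<bar> * G ^ Suc j"
  proof (intro add_mono mult_mono Suc)
    have "\<bar>y\<bar> ^ j \<le> G ^ j" using assms by (intro power_mono) auto
    also have "\<dots> \<le> G ^ Suc j" using assms by (intro power_increasing) auto
    finally show "\<bar>y\<bar> ^ j \<le> G ^ Suc j" .
  qed (use assms in auto)
  also have "\<dots> = real (Suc j) * G ^ Suc j * \<bar>x - y\<bar>" by (simp add: algebra_simps)
  finally show ?case .
qed simp

section \<open>The auxiliary function and one extrapolation step\<close>

locale auxiliary_function =
  fixes I :: "nat set" and q :: nat and \<alpha> :: "nat \<Rightarrow> nat" and b :: "nat \<Rightarrow> int"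
    and L :: nat and p :: "(nat \<Rightarrow> nat) \<Rightarrow> int"
  assumes finite_I: "finite I" and q: "q \<in> I" and \<alpha>: "\<And>i. i \<in> I \<Longrightarrow> \<alpha> i \<ge> 2"
    and bq: "b q \<noteq> 0"
begin

definition "V = PiE I (\<lambda>_. {..<L})"
text \<open>These integers arise from eliminating the logarithm with index \<open>q\<close>: up to a
  multiple of the linear form, \<open>b q * w v\<close> is the combination \<open>S v\<close> of the
  other logarithms with coefficients \<open>c v r\<close>.\<close>

definition c :: "(nat \<Rightarrow> nat) \<Rightarrow> nat \<Rightarrow> int" where
  "c v r = b q * int (v r) - b r * int (v q)"
definition w :: "(nat \<Rightarrow> nat) \<Rightarrow> real" where
  "w v = (\<Sum>i\<in>I. real (v i) * ln (real (\<alpha> i)))"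
definition "form = (\<Sum>i\<in>I. real_of_int (b i) * ln (real (\<alpha> i)))"
definition S :: "(nat \<Rightarrow> nat) \<Rightarrow> real" where
  "S v = (\<Sum>r\<in>I - {q}. real_of_int (c v r) * ln (real (\<alpha> r)))"
text \<open>Up to powers of logarithms, multiplication by such a monomial is a mixed partial
  derivative of Baker's function of several variables. Leaving the logarithms out keeps the values
  at integers integral.\<close>

definition mon :: "(nat \<Rightarrow> nat) \<Rightarrow> (nat \<Rightarrow> nat) \<Rightarrow> int" where
  "mon m v = (\<Prod>r\<in>I - {q}. c v r ^ m r)"
definition Z :: "(nat \<Rightarrow> nat) \<Rightarrow> nat \<Rightarrow> int" where
  "Z m l = (\<Sum>v\<in>V. mon m v * (\<Prod>i\<in>I. int (\<alpha> i) ^ v i) ^ l * p v)"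
definition f :: "(nat \<Rightarrow> nat) \<Rightarrow> complex \<Rightarrow> complex" where
  "f m z = (\<Sum>v\<in>V. of_int (p v * mon m v) * exp (of_real (w v) * z))"

lemma finite_V: "finite V"
  unfolding V_def using finite_I by (intro finite_PiE) auto

lemma card_V: "card V = L ^ card I"
  unfolding V_def using finite_I by (simp add: card_PiE)

lemma bq_w: "real_of_int (b q) * w v = S v + real (v q) * form"
proof -
  have "S v = (\<Sum>r\<in>I. real_of_int (c v r) * ln (real (\<alpha> r)))"
    unfolding S_def using finite_I q by (subst sum.remove[of I q]) (auto simp: c_def)
  also have "\<dots> = real_of_int (b q) * w v - real (v q) * form"
    by (simp add: c_def w_def form_def sum_distrib_left sum_subtractf[symmetric] algebra_simps)
  finally show ?thesis by simp
qed

lemma exp_w: "exp (real l * w v) = real_of_int ((\<Prod>i\<in>I. int (\<alpha> i) ^ v i) ^ l)"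
proof -
  have "exp (w v) = (\<Prod>i\<in>I. exp (real (v i) * ln (real (\<alpha> i))))"
    unfolding w_def using finite_I by (simp add: exp_sum)
  also have "\<dots> = (\<Prod>i\<in>I. real (\<alpha> i) ^ v i)"
    using \<alpha> by (intro prod.cong refl) (force simp: exp_of_nat_mult)
  finally show ?thesis by (simp add: exp_of_nat_mult)
qed

lemma Z_eq: "real_of_int (Z m l) = (\<Sum>v\<in>V. real_of_int (p v * mon m v) * exp (real l * w v))"
  unfolding Z_def exp_w by (simp add: mult_ac)

lemma exp_w_of_nat: "exp (complex_of_real (w v) * of_nat l) = of_real (exp (real l * w v))"
  by (simp add: exp_of_real[symmetric] mult.commute)

lemma f_of_nat: "f m (of_nat l) = of_int (Z m l)"
proof -
  have "f m (of_nat l) = of_real (\<Sum>v\<in>V. real_of_int (p v * mon m v) * exp (real l * w v))"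
    unfolding f_def exp_w_of_nat by (simp only: of_real_sum of_real_mult of_real_of_int_eq)
  then show ?thesis unfolding Z_eq[symmetric] by simp
qed

lemma f_holomorphic: "f m holomorphic_on UNIV"
  unfolding f_def by (intro holomorphic_intros)

lemma higher_deriv_f:
  "(deriv ^^ j) (f m) z = (\<Sum>v\<in>V. of_int (p v * mon m v) * of_real (w v) ^ j * exp (of_real (w v) * z))"
proof (induction j arbitrary: z)
  case 0
  then show ?case by (simp add: f_def)
next
  case (Suc j)
  have "(deriv ^^ j) (f m) = (\<lambda>z. \<Sum>v\<in>V. of_int (p v * mon m v) * of_real (w v) ^ j * exp (of_real (w v) * z))"
    using Suc by blast
  moreover have "((\<lambda>z. \<Sum>v\<in>V. of_int (p v * mon m v) * of_real (w v) ^ j * exp (of_real (w v) * z))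
     has_field_derivative
      (\<Sum>v\<in>V. of_int (p v * mon m v) * of_real (w v) ^ Suc j * exp (of_real (w v) * z))) (at z)"
    by (auto intro!: derivative_eq_intros sum.cong simp: sum_distrib_left sum_distrib_right mult_ac)
  ultimately show ?case by (simp add: DERIV_imp_deriv)
qed

text \<open>A factor \<open>S v\<close> raises one exponent of the monomial and contributes a
  logarithm, so the moment of order \<open>j\<close> is a real combination of values
  \<open>Z\<close> of order larger by \<open>j\<close>.\<close>

lemma S_moment_eq_0:
  assumes "\<And>\<mu>. sum \<mu> (I - {q}) \<le> k \<Longrightarrow> Z \<mu> l = 0" "sum m (I - {q}) + j \<le> k"
  shows "(\<Sum>v\<in>V. real_of_int (p v * mon m v) * S v ^ j * exp (real l * w v)) = 0"
  using assms(2)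
proof (induction j arbitrary: m)
  case 0
  then show ?case using assms(1)[of m] Z_eq[of m l] by simp
next
  case (Suc j)
  have mon_upd: "mon (m(r := Suc (m r))) v = c v r * mon m v" if "r \<in> I - {q}" for r v
  proof -
    have "mon (m(r := Suc (m r))) v = c v r ^ Suc (m r) * (\<Prod>i\<in>I - {q} - {r}. c v i ^ m i)"
      unfolding mon_def using finite_I that by (subst prod.remove[of _ r]) auto
    also have "\<dots> = c v r * mon m v"
      unfolding mon_def using finite_I that by (subst (2) prod.remove[of _ r]) auto
    finally show ?thesis .
  qed
  have sum_upd: "sum (m(r := Suc (m r))) (I - {q}) = Suc (sum m (I - {q}))" if "r \<in> I - {q}" for r
    using finite_I that sum.remove[of "I - {q}" r m] sum.remove[of "I - {q}" r "m(r := Suc (m r))"]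
    by simp
  have "(\<Sum>v\<in>V. real_of_int (p v * mon m v) * S v ^ Suc j * exp (real l * w v)) =
    (\<Sum>v\<in>V. \<Sum>r\<in>I - {q}. ln (real (\<alpha> r)) *
       (real_of_int (p v * (c v r * mon m v)) * S v ^ j * exp (real l * w v)))"
  proof (rule sum.cong)
    fix v
    define u where "u = real_of_int (p v * mon m v) * S v ^ j * exp (real l * w v)"
    have "real_of_int (p v * mon m v) * S v ^ Suc j * exp (real l * w v) = S v * u"
      unfolding u_def by simp
    also have "\<dots> = (\<Sum>r\<in>I - {q}. ln (real (\<alpha> r)) * (real_of_int (c v r) * u))"
      by (simp add: S_def sum_distrib_left sum_distrib_right mult_ac)
    finally show "real_of_int (p v * mon m v) * S v ^ Suc j * exp (real l * w v) =
      (\<Sum>r\<in>I - {q}. ln (real (\<alpha> r)) *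
        (real_of_int (p v * (c v r * mon m v)) * S v ^ j * exp (real l * w v)))"
      by (simp add: u_def mult_ac)
  qed simp
  also have "\<dots> = (\<Sum>r\<in>I - {q}. ln (real (\<alpha> r)) *
      (\<Sum>v\<in>V. real_of_int (p v * mon (m(r := Suc (m r))) v) * S v ^ j * exp (real l * w v)))"
    by (subst sum.swap) (simp add: sum_distrib_left mon_upd)
  also have "\<dots> = 0"
    using Suc sum_upd by (intro sum.neutral) auto
  finally show ?case .
qed

text \<open>Were the form zero, \<open>b q * w v\<close> would equal \<open>S v\<close> and the
  derivative would vanish by the moment identity; in general the form controls the difference of the
  two \<open>j\<close>-th powers. Multiplication by \<open>b q ^ j\<close> does no harm, since the
  integer \<open>b q\<close> has modulus at least 1.\<close>

lemma higher_deriv_f_bound: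
  assumes "\<And>\<mu>. sum \<mu> (I - {q}) \<le> k \<Longrightarrow> Z \<mu> l = 0" "sum m (I - {q}) + j \<le> k"
    and bd: "\<And>v. v \<in> V \<Longrightarrow> \<bar>real_of_int (p v)\<bar> \<le> P" "\<And>v. v \<in> V \<Longrightarrow> \<bar>real_of_int (mon m v)\<bar> \<le> Mo"
      "\<And>v. v \<in> V \<Longrightarrow> \<bar>S v\<bar> \<le> G" "\<And>v. v \<in> V \<Longrightarrow> \<bar>real_of_int (b q) * w v\<bar> \<le> G" "1 \<le> G"
      "\<And>v. v \<in> V \<Longrightarrow> w v \<le> W" "0 \<le> P" "0 \<le> Mo"
  shows "norm ((deriv ^^ j) (f m) (of_nat l)) \<le>
     real (card V) * (P * Mo * (real j * G ^ j * (real L * \<bar>form\<bar>)) * exp (real l * W))"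
proof -
  define B where "B = real_of_int (b q)"
  have B: "1 \<le> \<bar>B\<bar>" unfolding B_def using bq by linarith
  define s where "s = (\<Sum>v\<in>V. real_of_int (p v * mon m v) * w v ^ j * exp (real l * w v))"
  have "(deriv ^^ j) (f m) (of_nat l) = of_real s"
    unfolding higher_deriv_f s_def exp_w_of_nat
    by (simp only: of_real_sum of_real_mult of_real_of_int_eq of_real_power)
  then have "norm ((deriv ^^ j) (f m) (of_nat l)) = \<bar>s\<bar>" by simp
  also have "\<dots> \<le> \<bar>B ^ j * s\<bar>"
    using B by (simp add: abs_mult power_abs one_le_power mult_le_cancel_right1)
  also have "B ^ j * s = (\<Sum>v\<in>V. real_of_int (p v * mon m v) * (B * w v) ^ j * exp (real l * w v))"
    unfolding s_def by (simp add: sum_distrib_left power_mult_distrib mult_ac)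
  also have "\<dots> = (\<Sum>v\<in>V. real_of_int (p v * mon m v) * ((B * w v) ^ j - S v ^ j) * exp (real l * w v))"
    using S_moment_eq_0[OF assms(1,2)] by (simp add: algebra_simps sum_subtractf)
  also have "\<bar>\<dots>\<bar> \<le> (\<Sum>v\<in>V. P * Mo * (real j * G ^ j * (real L * \<bar>form\<bar>)) * exp (real l * W))"
  proof (rule order_trans[OF sum_abs], rule sum_mono)
    fix v assume v: "v \<in> V"
    have vL: "real (v q) \<le> real L" using v q unfolding V_def by (force simp: PiE_iff)
    have "\<bar>(B * w v) ^ j - S v ^ j\<bar> \<le> real j * G ^ j * \<bar>B * w v - S v\<bar>"
      using bd v unfolding B_def by (intro abs_power_diff_le) auto
    also have "B * w v - S v = real (v q) * form" unfolding B_def bq_w by simp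
    also have "\<bar>\<dots>\<bar> = real (v q) * \<bar>form\<bar>" by (simp add: abs_mult)
    also have "real j * G ^ j * (real (v q) * \<bar>form\<bar>) \<le> real j * G ^ j * (real L * \<bar>form\<bar>)"
      using vL bd(5) by (intro mult_left_mono mult_right_mono) auto
    finally have *: "\<bar>(B * w v) ^ j - S v ^ j\<bar> \<le> real j * G ^ j * (real L * \<bar>form\<bar>)" .
    show "\<bar>real_of_int (p v * mon m v) * ((B * w v) ^ j - S v ^ j) * exp (real l * w v)\<bar>
      \<le> P * Mo * (real j * G ^ j * (real L * \<bar>form\<bar>)) * exp (real l * W)"
      unfolding abs_mult of_int_mult using v bd *
      by (intro mult_mono mult_nonneg_nonneg) (auto intro: mult_left_mono)
  qed
  finally show ?thesis by simp
qed

text \<open>Trades order of vanishing for range: giving up \<open>T\<close> orders makes the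
  derivatives of orders below \<open>T\<close> small at all integers below \<open>h\<close>, which
  are \<open>h * T\<close> nodes with multiplicity. Interpolation then yields an integer of modulus
  at most 1/2.\<close>

lemma extrapolation_step:
  fixes h h' T k :: nat
  assumes zero: "\<And>\<mu> l. sum \<mu> (I - {q}) \<le> k + T \<Longrightarrow> l < h \<Longrightarrow> Z \<mu> l = 0"
    and bd: "\<And>v. v \<in> V \<Longrightarrow> \<bar>real_of_int (p v)\<bar> \<le> P"
      "\<And>v \<mu>. v \<in> V \<Longrightarrow> sum \<mu> (I - {q}) \<le> k \<Longrightarrow> \<bar>real_of_int (mon \<mu> v)\<bar> \<le> Mo"
      "\<And>v. v \<in> V \<Longrightarrow> \<bar>S v\<bar> \<le> G" "\<And>v. v \<in> V \<Longrightarrow> \<bar>real_of_int (b q) * w v\<bar> \<le> G" "1 \<le> G"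
      "\<And>v. v \<in> V \<Longrightarrow> w v \<le> W" "0 \<le> P" "0 \<le> Mo" "0 \<le> W"
    and h: "1 \<le> h" "h \<le> h'"
    and A1: "real (card V) * (P * Mo * exp (10 * real h' * W)) * (2 / 9) ^ (h * T) \<le> 1 / 4"
    and A2: "real (card V) * (P * Mo * (real T * G ^ T * (real L * \<bar>form\<bar>)) * exp (real h * W))
       * (2 + 4 * real h' * real (h * T + 1) ^ (h * T)) ^ (h * T) \<le> 1 / 4"
    and \<mu>: "sum \<mu> (I - {q}) \<le> k" and l: "l < h'"
  shows "Z \<mu> l = 0"
proof -
  define xs where "xs = concat (map (replicate T) [0..<h])"
  define \<delta> where "\<delta> = real (card V) * (P * Mo * (real T * G ^ T * (real L * \<bar>form\<bar>)) * exp (real h * W))"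
  have len: "length xs = h * T" unfolding xs_def by (rule length_concat_replicate)
  have \<delta>0: "0 \<le> \<delta>" unfolding \<delta>_def using bd by (intro mult_nonneg_nonneg) auto
  have w0: "0 \<le> w v" for v unfolding w_def using \<alpha> by (intro sum_nonneg mult_nonneg_nonneg) force+
  \<comment> \<open>Nodes and target lie below \<open>h'\<close>, so they are at most
    \<open>2 * h'\<close> apart, and the circle of radius \<open>10 * h'\<close> is at distance at
    least \<open>9 * h'\<close> from the nodes: a gain of 2/9 per node.\<close>
  have "norm (f \<mu> (of_nat l)) \<le> real (card V) * (P * Mo * exp (10 * real h' * W)) * ((2 * real h') / (9 * real h')) ^ length xs
     + \<delta> * (2 + 2 * (2 * real h') * real (h * T + 1) ^ (h * T)) ^ length xs"
  proof (rule entire_interpolation_bound[where F = "f \<mu>" and z = "of_nat l" and R = "10 * real h'" and h = "real h" and r = "real h'"])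
    show "f \<mu> holomorphic_on UNIV" by (rule f_holomorphic)
    fix z :: complex assume z: "norm z = 10 * real h'"
    have "norm (f \<mu> z) \<le> (\<Sum>v\<in>V. norm (of_int (p v * mon \<mu> v) * exp (of_real (w v) * z)))"
      unfolding f_def by (rule norm_sum)
    also have "\<dots> \<le> (\<Sum>v\<in>V. P * Mo * exp (10 * real h' * W))"
    proof (rule sum_mono)
      fix v assume v: "v \<in> V"
      have "w v * Re z \<le> w v * (10 * real h')"
        using complex_Re_le_cmod[of z] z w0 by (intro mult_left_mono) auto
      also have "\<dots> \<le> W * (10 * real h')" using bd(6)[OF v] by (intro mult_right_mono) auto
      finally have "norm (exp (of_real (w v) * z)) \<le> exp (10 * real h' * W)"
        by (simp add: norm_exp_eq_Re mult_ac)
      then show "norm (of_int (p v * mon \<mu> v) * exp (of_real (w v) * z)) \<le> P * Mo * exp (10 * real h' * W)"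
        unfolding norm_mult of_int_mult norm_of_int using v bd \<mu>
        by (intro mult_mono mult_nonneg_nonneg) auto
    qed
    finally show "norm (f \<mu> z) \<le> real (card V) * (P * Mo * exp (10 * real h' * W))" by simp
  next
    fix a j assume "j < count_list xs a"
    then have a: "a < h" and j: "j < T"
      unfolding xs_def count_list_concat_replicate by (auto split: if_splits)
    have "norm ((deriv ^^ j) (f \<mu>) (of_nat a)) \<le>
       real (card V) * (P * Mo * (real j * G ^ j * (real L * \<bar>form\<bar>)) * exp (real a * W))"
      using zero a j \<mu> bd by (intro higher_deriv_f_bound[where k = "k + T"]) auto
    also have "\<dots> \<le> \<delta>"
      unfolding \<delta>_def using a j bd mult_right_mono[of "real a" "real h" W]
      by (intro mult_left_mono mult_mono mult_nonneg_nonneg power_increasing mult_right_mono) auto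
    finally show "norm ((deriv ^^ j) (f \<mu>) (of_nat a)) \<le> \<delta>" .
  next
    fix a assume "a \<in> set xs"
    then show "real a \<le> real h" unfolding xs_def by auto
  qed (use len h l \<delta>0 in auto)
  also have "(2 * real h') / (9 * real h') = 2 / 9" using h by simp
  finally have "norm (f \<mu> (of_nat l)) \<le> 1 / 4 + 1 / 4"
    using A1 A2 unfolding len \<delta>_def by simp
  then have "real_of_int \<bar>Z \<mu> l\<bar> < 1" unfolding f_of_nat by simp
  then show ?thesis by linarith
qed

end

section \<open>Choice of the parameters\<close>

lemma exp_bound_power: "real k \<le> c \<Longrightarrow> 0 \<le> x \<Longrightarrow> x \<le> exp u \<Longrightarrow> 0 \<le> u \<Longrightarrow> x ^ k \<le> exp (c * u)"
proof -
  assume a: "real k \<le> c" "0 \<le> x" "x \<le> exp u" "0 \<le> u"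
  have "x ^ k \<le> exp u ^ k" using a by (intro power_mono) auto
  also have "\<dots> = exp (real k * u)" by (simp add: exp_of_nat_mult)
  also have "\<dots> \<le> exp (c * u)" using a by (simp add: mult_right_mono)
  finally show ?thesis .
qed

lemma le_exp_self: "x \<le> exp (x::real)"
  using exp_ge_add_one_self[of x] by linarith

text \<open>All sizes are powers of \<open>X\<close>. There are
  \<open>L ^ n = X ^ (5 * n\<^sup>2)\<close> unknowns against at most
  \<open>(K + 1) ^ (n - 1) * X\<^sup>2\<close> equations, and
  \<open>K + 1 \<le> X ^ (5 * n + 5)\<close>. Each stage gives up \<open>T\<close> orders and
  multiplies the range by \<open>X\<close>; the \<open>5 * n\<^sup>2\<close> stages that
  \<open>K\<close> permits lead from \<open>X\<^sup>2\<close> to a range exceeding the number of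
  unknowns. The condition \<open>100 * n ^ 3 \<le> X\<close> mainly pays for the exponent
  \<open>12 * n * X * K = 60 * n ^ 3 * X * T\<close>, to be compared with
  \<open>X\<^sup>2 * T\<close> zeros at the initial stage.\<close>

locale auxiliary_parameters = auxiliary_function +
  fixes n X :: nat
  assumes card_I: "card I = n" and L: "L = X ^ (5 * n)"
    and X: "100 * n ^ 3 \<le> X"
    and ln_\<alpha>: "\<And>i. i \<in> I \<Longrightarrow> ln (real (\<alpha> i)) \<le> real X"
    and b_le: "\<And>i. i \<in> I \<Longrightarrow> 2 * \<bar>real_of_int (b i)\<bar> \<le> exp (real X)"
begin

definition "T = X ^ (5 * n + 4)"
definition "W = real n * real L * real X"
definition "K = 5 * n\<^sup>2 * T"
definition "Mo = exp (6 * real n * real X * real K)"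

lemma n: "n \<ge> 1"
  using card_I finite_I q by (metis One_nat_def Suc_leI card_gt_0_iff empty_iff)

lemma X_ge: "X \<ge> 100" "n \<le> X" "100 * n \<le> X" "100 * n ^ 2 \<le> X" "1 \<le> X"
proof -
  have "n ^ 1 \<le> n ^ 3" "n ^ 2 \<le> n ^ 3" "1 \<le> n ^ 3" using n by (intro power_increasing | auto)+
  then show "X \<ge> 100" "n \<le> X" "100 * n \<le> X" "100 * n ^ 2 \<le> X" "1 \<le> X" using X by auto
qed

lemma L_exp: "real L \<le> exp (5 * real n * real X)"
proof -
  have "real X ^ (5 * n) \<le> exp (real (5 * n) * real X)"
    by (rule exp_bound_power) (auto intro: le_exp_self)
  then show ?thesis unfolding L by simp
qed

lemma v_le: "v \<in> V \<Longrightarrow> i \<in> I \<Longrightarrow> real (v i) \<le> real L"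
  unfolding V_def by (force simp: PiE_iff)

lemma c_le:
  assumes "v \<in> V" "r \<in> I" shows "\<bar>real_of_int (c v r)\<bar> \<le> exp (real X) * real L"
proof -
  have "\<bar>real_of_int (c v r)\<bar> \<le> \<bar>real_of_int (b q)\<bar> * real (v r) + \<bar>real_of_int (b r)\<bar> * real (v q)"
    unfolding c_def by (simp add: abs_mult order_trans[OF abs_triangle_ineq4])
  also have "\<dots> \<le> (exp (real X) / 2) * real L + (exp (real X) / 2) * real L"
    using b_le[OF q] b_le[OF assms(2)] v_le assms q by (intro add_mono mult_mono) auto
  finally show ?thesis by (simp add: mult.commute)
qed

lemma eXL_le: "exp (real X) * real L \<le> exp (6 * real n * real X)"
proof -
  have "exp (real X) * real L \<le> exp (real n * real X) * exp (5 * real n * real X)"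
    using L_exp n mult_right_mono[of 1 "real n" "real X"] by (intro mult_mono) auto
  then show ?thesis by (simp add: exp_add[symmetric] algebra_simps)
qed

lemma mon_le:
  assumes "v \<in> V" "sum m (I - {q}) \<le> K" shows "\<bar>real_of_int (mon m v)\<bar> \<le> Mo"
proof -
  define u where "u = 6 * real n * real X"
  have "\<bar>real_of_int (mon m v)\<bar> = (\<Prod>r\<in>I - {q}. \<bar>real_of_int (c v r)\<bar> ^ m r)"
    unfolding mon_def by (simp add: abs_prod power_abs)
  also have "\<dots> \<le> (\<Prod>r\<in>I - {q}. exp u ^ m r)"
    using order_trans[OF c_le eXL_le] assms unfolding u_def by (intro prod_mono conjI power_mono) auto
  also have "\<dots> = exp u ^ sum m (I - {q})" by (simp add: power_sum)
  also have "\<dots> \<le> exp u ^ K" using assms by (intro power_increasing) (auto simp: u_def)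
  also have "\<dots> = Mo" unfolding Mo_def u_def by (simp add: exp_of_nat_mult[symmetric] mult_ac)
  finally show ?thesis .
qed

lemma w_le: assumes "v \<in> V" shows "w v \<le> W"
proof -
  have "w v \<le> (\<Sum>i\<in>I. real L * real X)"
    unfolding w_def using assms v_le ln_\<alpha> \<alpha> by (intro sum_mono mult_mono) force+
  then show ?thesis unfolding W_def using card_I by simp
qed

definition "G = real n * real X * exp (6 * real n * real X)"

lemma S_le: assumes "v \<in> V" shows "\<bar>S v\<bar> \<le> G"
proof -
  have "\<bar>S v\<bar> \<le> (\<Sum>r\<in>I - {q}. \<bar>real_of_int (c v r) * ln (real (\<alpha> r))\<bar>)"
    unfolding S_def by (rule sum_abs)
  also have "\<dots> \<le> (\<Sum>r\<in>I - {q}. exp (6 * real n * real X) * real X)"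
    unfolding abs_mult
    using order_trans[OF c_le eXL_le] assms ln_\<alpha> \<alpha> by (intro sum_mono mult_mono) force+
  also have "\<dots> \<le> (\<Sum>r\<in>I. exp (6 * real n * real X) * real X)"
    using finite_I by (intro sum_mono2) auto
  finally show ?thesis unfolding G_def using card_I by (simp add: mult_ac)
qed

lemma w_ge_0: "0 \<le> w v"
  unfolding w_def using \<alpha> by (intro sum_nonneg mult_nonneg_nonneg) force+

lemma bq_w_le: assumes "v \<in> V" shows "\<bar>real_of_int (b q) * w v\<bar> \<le> G"
proof -
  have "\<bar>real_of_int (b q) * w v\<bar> \<le> exp (real X) * W"
    unfolding abs_mult using b_le[OF q] w_le[OF assms] w_ge_0[of v] by (intro mult_mono) auto
  also have "\<dots> = real n * real X * (exp (real X) * real L)" unfolding W_def by simp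
  also have "\<dots> \<le> G" unfolding G_def using eXL_le by (intro mult_left_mono) auto
  finally show ?thesis .
qed

lemma G_ge_1: "1 \<le> G"
proof -
  have "1 * 1 * 1 \<le> real n * real X * exp (6 * real n * real X)"
    using n X_ge by (intro mult_mono) auto
  then show ?thesis unfolding G_def by simp
qed

lemma G_le: "G \<le> exp (8 * real n * real X)"
proof -
  have "real n * real X \<le> exp (real n * real X)" by (rule le_exp_self)
  also have "\<dots> \<le> exp (2 * real n * real X)" by simp
  finally have "G \<le> exp (2 * real n * real X) * exp (6 * real n * real X)"
    unfolding G_def by (intro mult_right_mono) auto
  then show ?thesis by (simp add: exp_add[symmetric] mult_ac)
qed

lemma card_V_exp: "real (card V) \<le> exp (5 * (real n)\<^sup>2 * real X)"
proof -
  have "real X ^ (5 * n * n) \<le> exp (real (5 * n * n) * real X)"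
    by (rule exp_bound_power) (auto intro: le_exp_self)
  moreover have "card V = X ^ (5 * n * n)"
    unfolding card_V card_I by (subst L) (simp add: power_mult)
  ultimately show ?thesis by (simp add: power2_eq_square mult_ac)
qed

text \<open>The exponential type of the auxiliary function times the radius is dominated by the number
  of zeros, \<open>X ^ (t + 2) * T\<close>.\<close>

lemma exponent_budget:
  "3 + 10 * (real n)\<^sup>2 * real X + 12 * real n * real X * real K + W * (real (X ^ 2) + 10 * real (X ^ (t + 3)))
    \<le> real (X ^ (t + 2) * T)"
proof -
  define Y where "Y = real X ^ (5 * n + t + 5)"
  have X1: "real X \<ge> 1" using X_ge by simp
  have n1: "real n \<ge> 1" using n by simp
  have Y1: "1 \<le> Y" unfolding Y_def using X1 by (rule one_le_power)
  have XY: "real X \<le> Y" unfolding Y_def using X1 power_increasing[of 1 "5 * n + t + 5" "real X"] by simp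
  have a: "real X * real K \<le> 5 * (real n)\<^sup>2 * Y"
  proof -
    have "real X * real K = 5 * (real n)\<^sup>2 * real X ^ (5 * n + 5)"
      unfolding K_def T_def by (simp add: power_add power2_eq_square eval_nat_numeral)
    also have "\<dots> \<le> 5 * (real n)\<^sup>2 * Y"
      unfolding Y_def using X1 by (intro mult_left_mono power_increasing) auto
    finally show ?thesis .
  qed
  have b: "W * (real (X ^ 2) + 10 * real (X ^ (t + 3))) \<le> 11 * real n * Y"
  proof -
    have "real (X ^ 2) \<le> real (X ^ (t + 3))" using X_ge by (simp add: power_increasing)
    then have "W * (real (X ^ 2) + 10 * real (X ^ (t + 3))) \<le> W * (11 * real (X ^ (t + 3)))"
      unfolding W_def by (intro mult_left_mono) auto
    also have "\<dots> = 11 * real n * real X ^ (5 * n + (1 + (t + 3)))"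
      unfolding W_def unfolding L of_nat_power by (simp only: power_add power_one_right mult_ac)
    also have "\<dots> \<le> 11 * real n * Y"
      unfolding Y_def using X1 by (intro mult_left_mono power_increasing) auto
    finally show ?thesis .
  qed
  have "3 + 10 * (real n)\<^sup>2 * real X + 12 * real n * real X * real K + W * (real (X ^ 2) + 10 * real (X ^ (t + 3)))
    \<le> 3 * Y + 10 * (real n)\<^sup>2 * Y + 12 * real n * (5 * (real n)\<^sup>2 * Y) + 11 * real n * Y"
    using b XY Y1 mult_left_mono[OF a, of "12 * real n"] by (intro add_mono mult_left_mono) (auto simp: mult_ac)
  also have "\<dots> = (3 + 10 * (real n)\<^sup>2 + 60 * real n ^ 3 + 11 * real n) * Y"
    by (simp add: algebra_simps power2_eq_square power3_eq_cube)
  also have "\<dots> \<le> real X * Y"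
  proof (rule mult_right_mono)
    have "n ^ 1 \<le> n ^ 3" "n ^ 2 \<le> n ^ 3" "1 \<le> n ^ 3" using n by (intro power_increasing | auto)+
    then have "3 + 10 * n\<^sup>2 + 60 * n ^ 3 + 11 * n \<le> X" using X by simp
    then have "real (3 + 10 * n\<^sup>2 + 60 * n ^ 3 + 11 * n) \<le> real X" by (simp only: of_nat_le_iff)
    then show "3 + 10 * (real n)\<^sup>2 + 60 * real n ^ 3 + 11 * real n \<le> real X" by simp
  qed (use Y1 in simp)
  also have "\<dots> = real (X ^ (t + 2) * T)"
    unfolding Y_def T_def by (simp add: power_add eval_nat_numeral)
  finally show ?thesis .
qed


text \<open>Twice the number of unknowns times the largest coefficient of the linear system: the
  size of the solution in Siegel's lemma.\<close>

definition "P = 2 * real (card V) * exp (6 * real n * real X * real K + W * real (X ^ 2))"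

lemma W_nonneg: "0 \<le> W" unfolding W_def by simp

lemma growth_le:
  assumes N: "N = X ^ (t + 2) * T"
  shows "real (card V) * (P * Mo * exp (10 * real (X ^ (t + 3)) * W)) \<le> exp (real N) / 4"
proof -
  define A where "A = exp (5 * (real n)\<^sup>2 * real X)"
  define B where "B = exp (12 * real n * real X * real K + W * (real (X ^ 2) + 10 * real (X ^ (t + 3))))"
  have B_eq: "B = exp (6 * real n * real X * real K + W * real (X ^ 2)) * exp (6 * real n * real X * real K)
      * exp (10 * real (X ^ (t + 3)) * W)"
    unfolding B_def by (simp add: exp_add[symmetric] algebra_simps)
  have "8 \<le> exp (3::real)"
  proof -
    have "2 ^ 3 \<le> exp (1::real) ^ 3"
      using exp_ge_add_one_self[of "1::real"] by (intro power_mono) auto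
    then show ?thesis by (simp add: exp_of_nat_mult[symmetric])
  qed
  have "4 * (real (card V) * (P * Mo * exp (10 * real (X ^ (t + 3)) * W)))
      = 8 * (real (card V) * real (card V)) * B"
    unfolding B_eq P_def Mo_def by (simp add: mult_ac)
  also have "\<dots> \<le> exp 3 * (A * A) * B"
    using card_V_exp \<open>8 \<le> exp 3\<close> unfolding A_def B_def
    by (intro mult_right_mono mult_mono) auto
  also have "\<dots> = exp (3 + 10 * (real n)\<^sup>2 * real X + 12 * real n * real X * real K
      + W * (real (X ^ 2) + 10 * real (X ^ (t + 3))))"
    unfolding A_def B_def by (simp add: exp_add[symmetric])
  also have "\<dots> \<le> exp (real N)"
    using exponent_budget[of t] N by simp
  finally show ?thesis by simp
qed

text \<open>The dominant factor is the interpolation constant, crudely at most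
  \<open>exp (7 * N ^ 3)\<close>; the four other large factors contribute at most
  \<open>exp (4 * N)\<close>. As \<open>N = X ^ (t + 5 * n + 6)\<close> with
  \<open>t < 5 * n\<^sup>2\<close>, the exponent \<open>15 * n\<^sup>2 + 15 * n + 19 = 3 * (5 *
  n\<^sup>2 + 5 * n + 6) + 1\<close> suffices, where the final 1 pays for the factor 11.\<close>

lemma perturbation_le:
  assumes N: "N = X ^ (t + 2) * T" and t: "t < 5 * n\<^sup>2"
    and small: "\<bar>form\<bar> \<le> exp (- real (X ^ (15 * n\<^sup>2 + 15 * n + 19)))"
  shows "real T * G ^ T * (real L * \<bar>form\<bar>)
    * (2 + 4 * real (X ^ (t + 3)) * real (N + 1) ^ N) ^ N * exp (real N) \<le> 1"
proof -
  define y where "y = real N"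
  have N_eq: "N = X ^ (t + 5 * n + 6)" unfolding N T_def power_add[symmetric] by (rule arg_cong[of _ _ "\<lambda>k. X ^ k"]) simp
  have X1: "1 \<le> X" using X_ge by simp
  have N1: "1 \<le> N" unfolding N_eq using X1 by simp
  then have y1: "1 \<le> y" unfolding y_def by simp
  have le_N: "real (X ^ k) \<le> y" if "k \<le> t + 5 * n + 6" for k
    unfolding y_def N_eq of_nat_le_iff using that X1 by (intro power_increasing) auto
  have Ty: "real T \<le> exp y" and Ly: "real L \<le> exp y"
    using le_N[of "5 * n + 4"] le_N[of "5 * n"] le_exp_self[of y] unfolding T_def L by auto
  have Gy: "G ^ T \<le> exp y"
  proof -
    have "G ^ T \<le> exp (real T * (8 * real n * real X))"
      using G_le G_ge_1 by (intro exp_bound_power) auto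
    also have "real T * (8 * real n * real X) \<le> real T * real (X * X)"
    proof (rule mult_left_mono)
      have "8 * n * X \<le> X * X" using X_ge by (intro mult_right_mono) auto
      then show "8 * real n * real X \<le> real (X * X)" by (metis of_nat_le_iff of_nat_mult of_nat_numeral)
    qed simp
    also have "\<dots> = real (X ^ (5 * n + 6))"
      unfolding T_def by (simp add: power_add eval_nat_numeral)
    also have "\<dots> \<le> y" by (intro le_N) auto
    finally show ?thesis by simp
  qed
  have By: "(2 + 4 * real (X ^ (t + 3)) * real (N + 1) ^ N) ^ N \<le> exp (7 * y ^ 3)"
  proof -
    have "real (N + 1) ^ N \<le> exp (y * y)"
      using exp_ge_add_one_self[of y] y1 by (intro exp_bound_power) (auto simp: y_def)
    moreover have "4 * real (X ^ (t + 3)) \<le> 4 * y"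
      using le_N[of "t + 3"] by simp
    ultimately have "4 * real (X ^ (t + 3)) * real (N + 1) ^ N \<le> 4 * y * exp (y * y)"
      using y1 by (intro mult_mono) auto
    moreover have "2 * (1 * 1) \<le> 2 * (y * exp (y * y))" using y1 by (intro mult_left_mono mult_mono) auto
    ultimately have "2 + 4 * real (X ^ (t + 3)) * real (N + 1) ^ N \<le> (6 * y) * exp (y * y)" by simp
    also have "\<dots> \<le> exp (6 * y) * exp (y * y)" by (intro mult_right_mono le_exp_self) auto
    also have "\<dots> = exp (6 * y + y * y)" by (simp add: exp_add)
    also have "\<dots> \<le> exp (7 * y\<^sup>2)"
      using y1 mult_left_mono[of 1 y y] by (simp add: power2_eq_square)
    finally have "(2 + 4 * real (X ^ (t + 3)) * real (N + 1) ^ N) ^ N \<le> exp (y * (7 * y\<^sup>2))"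
      using y1 by (intro exp_bound_power) (auto simp: y_def)
    then show ?thesis by (simp add: power2_eq_square power3_eq_cube mult_ac)
  qed
  have "real T * G ^ T * (real L * \<bar>form\<bar>) * (2 + 4 * real (X ^ (t + 3)) * real (N + 1) ^ N) ^ N * exp (real N)
    \<le> exp y * exp y * (exp y * \<bar>form\<bar>) * exp (7 * y ^ 3) * exp y"
    unfolding y_def[symmetric] using Ty Gy Ly By G_ge_1
    by (intro mult_mono mult_right_mono mult_nonneg_nonneg zero_le_power) auto
  also have "\<dots> = exp (4 * y + 7 * y ^ 3) * \<bar>form\<bar>" by (simp add: exp_add[symmetric])
  also have "\<dots> \<le> exp (11 * y ^ 3) * \<bar>form\<bar>"
    using y1 power_increasing[of 1 3 y] by (intro mult_right_mono) auto
  also have "\<dots> \<le> exp (11 * y ^ 3) * exp (- real (X ^ (15 * n\<^sup>2 + 15 * n + 19)))"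
    using small by (intro mult_left_mono) auto
  also have "\<dots> = exp (11 * y ^ 3 - real (X ^ (15 * n\<^sup>2 + 15 * n + 19)))" by (simp add: exp_diff exp_minus divide_inverse)
  also have "\<dots> \<le> exp 0"
  proof -
    have "11 * N ^ 3 \<le> X * N ^ 3" using X_ge by (intro mult_right_mono) auto
    also have "\<dots> = X ^ Suc ((t + 5 * n + 6) * 3)" by (simp only: N_eq power_Suc power_mult)
    also have "\<dots> \<le> X ^ (15 * n\<^sup>2 + 15 * n + 19)"
      using X1 t by (intro power_increasing) auto
    finally have "real (11 * N ^ 3) \<le> real (X ^ (15 * n\<^sup>2 + 15 * n + 19))" by (simp only: of_nat_le_iff)
    then show ?thesis unfolding y_def by simp
  qed
  finally show ?thesis by simp
qed

lemma extrapolation: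
  assumes p_le: "\<And>v. v \<in> V \<Longrightarrow> \<bar>real_of_int (p v)\<bar> \<le> P"
    and zero: "\<And>\<mu> l. sum \<mu> (I - {q}) \<le> K \<Longrightarrow> l < X ^ 2 \<Longrightarrow> Z \<mu> l = 0"
    and small: "\<bar>form\<bar> \<le> exp (- real (X ^ (15 * n\<^sup>2 + 15 * n + 19)))"
    and t: "t \<le> 5 * n\<^sup>2" "sum \<mu> (I - {q}) \<le> (5 * n\<^sup>2 - t) * T" "l < X ^ (t + 2)"
  shows "Z \<mu> l = 0"
  using t
proof (induction t arbitrary: \<mu> l)
  case 0
  then show ?case using zero[of \<mu> l] by (simp add: K_def power2_eq_square)
next
  case (Suc t)
  define N where "N = X ^ (t + 2) * T"
  define k where "k = (5 * n\<^sup>2 - Suc t) * T"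
  have kT: "k + T = (5 * n\<^sup>2 - t) * T"
    using Suc.prems(1) unfolding k_def by (simp add: Suc_diff_Suc[symmetric])
  have kK: "k \<le> K" unfolding k_def K_def by (intro mult_right_mono) auto
  have P0: "0 \<le> P" unfolding P_def by simp
  have M0: "0 \<le> Mo" unfolding Mo_def by simp
  have h: "X ^ (t + 2) \<le> X ^ (t + 3)" using X_ge by (intro power_increasing) auto
  have l': "l < X ^ (t + 3)" using Suc.prems(3) by (simp add: eval_nat_numeral)
  note g = growth_le[OF N_def]
  show ?case
  proof (rule extrapolation_step[where h = "X ^ (t + 2)" and h' = "X ^ (t + 3)" and T = T and k = k])
    show "Z \<mu> l = 0" if "sum \<mu> (I - {q}) \<le> k + T" "l < X ^ (t + 2)" for \<mu> l
      using Suc that kT by auto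
    show "real (card V) * (P * Mo * exp (10 * real (X ^ (t + 3)) * W)) * (2 / 9) ^ (X ^ (t + 2) * T) \<le> 1 / 4"
    proof -
      \<comment> \<open>The gain 2/9 per node beats the growth \<open>exp N\<close> because
        \<open>e < 9 / 2\<close>.\<close>
      have "exp (1::real) \<le> 9 / 2" using exp_le by simp
      then have "(2 / 9) \<le> exp (-1 :: real)" by (simp add: exp_minus field_simps)
      then have "(2 / 9) ^ N \<le> exp (-1 :: real) ^ N" by (intro power_mono) auto
      also have "\<dots> = exp (- real N)" by (simp add: exp_of_nat_mult[symmetric])
      finally have "real (card V) * (P * Mo * exp (10 * real (X ^ (t + 3)) * W)) * (2 / 9) ^ N
          \<le> (exp (real N) / 4) * exp (- real N)"
        using g P0 M0 by (intro mult_mono) auto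
      then show ?thesis unfolding N_def[symmetric] by (simp add: exp_minus)
    qed
    show "real (card V) * (P * Mo * (real T * G ^ T * (real L * \<bar>form\<bar>)) * exp (real (X ^ (t + 2)) * W))
       * (2 + 4 * real (X ^ (t + 3)) * real (X ^ (t + 2) * T + 1) ^ (X ^ (t + 2) * T)) ^ (X ^ (t + 2) * T) \<le> 1 / 4"
      (is "?l \<le> _")
    proof -
      define B where "B = (2 + 4 * real (X ^ (t + 3)) * real (N + 1) ^ N) ^ N"
      define F where "F = real T * G ^ T * (real L * \<bar>form\<bar>)"
      have FB: "0 \<le> F * B" unfolding F_def B_def using G_ge_1 by (intro mult_nonneg_nonneg zero_le_power) auto
      have "real (X ^ (t + 2)) \<le> real (X ^ (t + 3))" using h by (simp only: of_nat_le_iff)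
      then have "real (X ^ (t + 2)) * W \<le> 10 * real (X ^ (t + 3)) * W"
        using W_nonneg by (intro mult_right_mono) linarith+
      then have "real (card V) * (P * Mo * exp (real (X ^ (t + 2)) * W)) \<le> exp (real N) / 4"
        using P0 M0 by (intro order_trans[OF _ g] mult_left_mono) auto
      then have "(F * B) * (real (card V) * (P * Mo * exp (real (X ^ (t + 2)) * W))) \<le> (F * B) * (exp (real N) / 4)"
        using FB by (rule mult_left_mono)
      also have "\<dots> \<le> 1 / 4"
        using perturbation_le[OF N_def _ small] Suc.prems(1) unfolding F_def B_def by simp
      finally show ?thesis unfolding N_def[symmetric] B_def F_def by (simp add: mult_ac)
    qed
  qed (use p_le mon_le kK S_le bq_w_le G_ge_1 w_le P0 M0 W_nonneg h l' X_ge Suc.prems in \<open>auto simp: k_def\<close>)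
qed

lemma form_not_small:
  assumes p_le: "\<And>v. v \<in> V \<Longrightarrow> \<bar>real_of_int (p v)\<bar> \<le> P" and p: "\<exists>v\<in>V. p v \<noteq> 0"
    and zero: "\<And>\<mu> l. sum \<mu> (I - {q}) \<le> K \<Longrightarrow> l < X ^ 2 \<Longrightarrow> Z \<mu> l = 0"
    and indep: "\<And>k :: nat \<Rightarrow> int. (\<Sum>i\<in>I. real_of_int (k i) * ln (real (\<alpha> i))) = 0 \<Longrightarrow> \<forall>i\<in>I. k i = 0"
  shows "exp (- real (X ^ (15 * n\<^sup>2 + 15 * n + 19))) \<le> \<bar>form\<bar>"
proof (rule ccontr)
  assume "\<not> ?thesis"
  then have small: "\<bar>form\<bar> \<le> exp (- real (X ^ (15 * n\<^sup>2 + 15 * n + 19)))" by simp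
  define x where "x v = exp (w v)" for v
  \<comment> \<open>Independence of the logarithms enters here: distinct exponent vectors give
    distinct Vandermonde nodes.\<close>
  have "inj_on x V"
  proof
    fix u v assume uv: "u \<in> V" "v \<in> V" "x u = x v"
    then have "w u = w v" unfolding x_def by simp
    then have "(\<Sum>i\<in>I. real_of_int (int (u i) - int (v i)) * ln (real (\<alpha> i))) = 0"
      unfolding w_def by (simp add: left_diff_distrib sum_subtractf)
    from indep[OF this] show "u = v" using uv unfolding V_def by (intro PiE_ext[of u I _ v]) auto
  qed
  moreover have "(\<Sum>v\<in>V. real_of_int (p v) * x v ^ l) = 0" if "l < card V" for l
  proof -
    have "card V = X ^ (5 * n * n)"
      unfolding card_V card_I by (subst L) (simp add: power_mult)
    also have "\<dots> \<le> X ^ (5 * n\<^sup>2 + 2)"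
      using X_ge by (intro power_increasing) (auto simp: power2_eq_square)
    finally have "Z (\<lambda>_. 0) l = 0"
      using that by (intro extrapolation[OF p_le zero small, of "5 * n\<^sup>2"]) auto
    then show ?thesis
      using Z_eq[of "\<lambda>_. 0" l] unfolding x_def mon_def by (simp add: exp_of_nat_mult)
  qed
  ultimately have "real_of_int (p v) = 0" if "v \<in> V" for v
    using vandermonde_trivial_kernel[of V x "\<lambda>v. real_of_int (p v)"] finite_V that by blast
  then show False using p by auto
qed

end


theorem linear_form_lower_bound:
  fixes I :: "nat set" and \<alpha> :: "nat \<Rightarrow> nat" and b :: "nat \<Rightarrow> int" and n X :: nat
  assumes I: "finite I" "card I = n" and \<alpha>: "\<And>i. i \<in> I \<Longrightarrow> \<alpha> i \<ge> 2"
    and X: "100 * n ^ 3 \<le> X" and ln_\<alpha>: "\<And>i. i \<in> I \<Longrightarrow> ln (real (\<alpha> i)) \<le> real X"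
    and b_le: "\<And>i. i \<in> I \<Longrightarrow> 2 * \<bar>real_of_int (b i)\<bar> \<le> exp (real X)"
    and b: "\<exists>i\<in>I. b i \<noteq> 0"
    and indep: "\<And>k :: nat \<Rightarrow> int. (\<Sum>i\<in>I. real_of_int (k i) * ln (real (\<alpha> i))) = 0 \<Longrightarrow> \<forall>i\<in>I. k i = 0"
  shows "exp (- real (X ^ (15 * n\<^sup>2 + 15 * n + 19))) \<le> \<bar>\<Sum>i\<in>I. real_of_int (b i) * ln (real (\<alpha> i))\<bar>"
proof -
  obtain q where q: "q \<in> I" "b q \<noteq> 0" using b by blast
  define L where "L = X ^ (5 * n)"
  \<comment> \<open>Only \<open>Z\<close> and \<open>f\<close> depend on the coefficients. A dummy
    zero family makes the sizes available for stating the linear system, and its solution is put in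
    by the second interpretation.\<close>
  interpret A: auxiliary_parameters I q \<alpha> b L "\<lambda>_. 0" n X
    by unfold_locales (use assms q L_def in auto)
  \<comment> \<open>\<open>Z\<close> depends on its first argument only through the values on
    \<open>I - {q}\<close>, so these finitely many restricted functions represent all
    conditions.\<close>
  define M where "M = PiE (I - {q}) (\<lambda>_. {..A.K}) \<inter> {m. sum m (I - {q}) \<le> A.K}"
  define E where "E = M \<times> {..<X ^ 2}"
  define a where "a = (\<lambda>(m, l) v. A.mon m v * (\<Prod>i\<in>I. int (\<alpha> i) ^ v i) ^ l)"
  define B where "B = \<lfloor>exp (6 * real n * real X * real A.K + A.W * real (X ^ 2))\<rfloor>"
  have B1: "B \<ge> 1" unfolding B_def using A.W_nonneg by simp
  have finM: "finite M" unfolding M_def using I by (intro finite_Int disjI1 finite_PiE) auto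
  have cardE: "2 * card E \<le> card A.V"
  proof -
    have n1: "n \<ge> 1" by (rule A.n)
    have TX: "A.K + 1 \<le> X ^ (5 * n + 5)"
    proof -
      have T1: "1 \<le> A.T" unfolding A.T_def using A.X_ge(5) by simp
      have "A.K + 1 \<le> 5 * n\<^sup>2 * A.T + A.T" unfolding A.K_def using T1 by simp
      also have "\<dots> = (5 * n\<^sup>2 + 1) * A.T" by simp
      also have "\<dots> \<le> X * A.T"
        using A.X_ge(1,4) by (intro mult_right_mono) linarith+
      also have "\<dots> = X ^ (5 * n + 5)" unfolding A.T_def by (simp add: power_add eval_nat_numeral)
      finally show ?thesis .
    qed
    have "card M \<le> card (PiE (I - {q}) (\<lambda>_. {..A.K}))"
      unfolding M_def using I by (intro card_mono finite_PiE) auto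
    also have "\<dots> = (A.K + 1) ^ (n - 1)" using I q by (simp add: card_PiE)
    also have "\<dots> \<le> (X ^ (5 * n + 5)) ^ (n - 1)" using TX by (intro power_mono) auto
    finally have "card M \<le> X ^ ((5 * n + 5) * (n - 1))" by (simp add: power_mult)
    then have "2 * card E \<le> X * (X ^ ((5 * n + 5) * (n - 1)) * X ^ 2)"
      unfolding E_def card_cartesian_product using A.X_ge by (intro mult_mono) auto
    also have "\<dots> = X ^ ((5 * n + 5) * (n - 1) + 3)"
      by (simp add: power_add power2_eq_square power3_eq_cube)
    also have "\<dots> \<le> X ^ (5 * n * n)"
    proof (rule power_increasing)
      obtain k where "n = Suc k" using n1 by (cases n) auto
      then show "(5 * n + 5) * (n - 1) + 3 \<le> 5 * n * n" by (simp add: algebra_simps)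
    qed (use A.X_ge in simp)
    also have "\<dots> = card A.V" unfolding A.card_V I(2) by (subst L_def) (simp add: power_mult)
    finally show ?thesis .
  qed
  have a_le: "\<bar>a e v\<bar> \<le> B" if e: "e \<in> E" and v: "v \<in> A.V" for e v
  proof -
    obtain m l where ml: "e = (m, l)" "m \<in> M" "l < X ^ 2" using e unfolding E_def by auto
    have "\<bar>real_of_int (a e v)\<bar> = \<bar>real_of_int (A.mon m v)\<bar> * exp (real l * A.w v)"
      unfolding ml a_def A.exp_w by (simp add: abs_mult prod_nonneg)
    also have "\<dots> \<le> A.Mo * exp (real (X ^ 2) * A.W)"
    proof -
      have "real l \<le> real (X ^ 2)" using ml(3) by (simp only: of_nat_le_iff)
      then have "real l * A.w v \<le> real (X ^ 2) * A.W"
        using A.w_le[OF v] A.w_ge_0[of v] by (intro mult_mono) auto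
      then show ?thesis using A.mon_le[OF v, of m] ml(2) unfolding M_def
        by (intro mult_mono) auto
    qed
    also have "\<dots> = exp (6 * real n * real X * real A.K + A.W * real (X ^ 2))"
      unfolding A.Mo_def by (simp add: exp_add mult_ac)
    finally have "real_of_int \<bar>a e v\<bar> \<le> exp (6 * real n * real X * real A.K + A.W * real (X ^ 2))" by simp
    then show ?thesis unfolding B_def by (simp only: le_floor_iff)
  qed
  have cV: "card A.V > 0"
    unfolding A.card_V using A.X_ge(1) by (simp add: L_def)
  obtain p where p: "\<exists>v\<in>A.V. p v \<noteq> 0" "\<And>v. v \<in> A.V \<Longrightarrow> \<bar>p v\<bar> \<le> 2 * int (card A.V) * B"
    "\<And>e. e \<in> E \<Longrightarrow> (\<Sum>v\<in>A.V. a e v * p v) = 0"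
    using siegel[of E A.V a B, OF _ A.finite_V cardE cV a_le B1] finM unfolding E_def by blast
  interpret A': auxiliary_parameters I q \<alpha> b L p n X
    by unfold_locales (use assms q L_def in auto)
  have "exp (- real (X ^ (15 * n\<^sup>2 + 15 * n + 19))) \<le> \<bar>A.form\<bar>"
  proof (rule A'.form_not_small)
    show "\<bar>real_of_int (p v)\<bar> \<le> A.P" if "v \<in> A.V" for v
    proof -
      have "\<bar>real_of_int (p v)\<bar> \<le> real_of_int (2 * int (card A.V) * B)"
        using p(2)[OF that] by linarith
      also have "\<dots> \<le> A.P" unfolding A.P_def B_def by (simp add: mult_left_mono)
      finally show ?thesis .
    qed
    fix \<mu> l assume \<mu>: "sum \<mu> (I - {q}) \<le> A.K" and l: "l < X ^ 2"
    define m where "m = restrict \<mu> (I - {q})"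
    have "\<mu> r \<le> A.K" if "r \<in> I - {q}" for r
      using \<mu> member_le_sum[of r "I - {q}" \<mu>] that I by auto
    moreover have "sum m (I - {q}) = sum \<mu> (I - {q})" unfolding m_def by (rule sum.cong) auto
    ultimately have "(m, l) \<in> E" unfolding E_def M_def using \<mu> l by (auto simp: m_def)
    then have "(\<Sum>v\<in>A.V. a (m, l) v * p v) = 0" by (rule p(3))
    moreover have "A.mon m v = A.mon \<mu> v" for v
      unfolding A.mon_def m_def by (rule prod.cong) auto
    ultimately show "A'.Z \<mu> l = 0" unfolding A'.Z_def a_def by simp
  qed (use p indep in auto)
  then show ?thesis unfolding A.form_def .
qed

section \<open>Pell equations\<close>

text \<open>Coefficients of the odd powers of \<open>sqrt (X + 2) + sqrt X\<close>, divided by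
  powers of 2. The recursion multiplies by the unit \<open>X + 1 + sqrt (X * (X + 2))\<close>, which
  is half the square of that number.\<close>

fun pell_u pell_v :: "nat \<Rightarrow> nat \<Rightarrow> nat" where
  "pell_u X 0 = 1"
| "pell_v X 0 = 1"
| "pell_u X (Suc t) = (X + 1) * pell_u X t + X * pell_v X t"
| "pell_v X (Suc t) = (X + 1) * pell_v X t + (X + 2) * pell_u X t"

lemma pell_equation: "(X + 2) * (pell_u X t)\<^sup>2 = X * (pell_v X t)\<^sup>2 + 2"
proof (induction t)
  case (Suc t)
  define u v where "u = int (pell_u X t)" and "v = int (pell_v X t)"
  have "(int X + 2) * u\<^sup>2 = int X * v\<^sup>2 + 2"
    using arg_cong[OF Suc, of int] unfolding u_def v_def by (simp add: algebra_simps)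
  then have "(int X + 2) * ((int X + 1) * u + int X * v)\<^sup>2 = int X * ((int X + 1) * v + (int X + 2) * u)\<^sup>2 + 2"
    by algebra
  then have "int ((X + 2) * (pell_u X (Suc t))\<^sup>2) = int (X * (pell_v X (Suc t))\<^sup>2 + 2)"
    unfolding u_def v_def
    by (simp only: pell_u.simps pell_v.simps of_nat_add of_nat_mult of_nat_power of_nat_numeral of_nat_1)
  then show ?case by (simp only: of_nat_eq_iff)
qed simp

lemma pell_pos: "pell_u X t \<ge> 1" "pell_v X t \<ge> 1"
  by (induction t) auto

lemma pell_gt_1:
  assumes "t \<ge> 1" shows "pell_u X t > 1 \<or> X = 0" "pell_v X t > 1"
proof -
  obtain k where t: "t = Suc k" using assms by (cases t) auto
  have "(X + 1) * 1 + X * 1 \<le> (X + 1) * pell_u X k + X * pell_v X k"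
    using pell_pos[of X k] by (intro add_mono mult_le_mono) auto
  then show "pell_u X t > 1 \<or> X = 0" unfolding t by simp linarith
  have "(X + 1) * 1 + (X + 2) * 1 \<le> (X + 1) * pell_v X k + (X + 2) * pell_u X k"
    using pell_pos[of X k] by (intro add_mono mult_le_mono) auto
  then show "pell_v X t > 1" unfolding t by simp
qed

text \<open>Descent by the inverse of the unit: it carries a positive solution with
  \<open>u > 1\<close> to a smaller positive one, so every solution comes from
  \<open>u = v = 1\<close>.\<close>

lemma pell_complete:
  assumes "X \<ge> 1" "(X + 2) * u\<^sup>2 = X * v\<^sup>2 + 2" "u \<ge> 1" "v \<ge> 1"
  shows "\<exists>t. u = pell_u X t \<and> v = pell_v X t"
  using assms(2-)
proof (induction u arbitrary: v rule: less_induct)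
  case (less u)
  define U V x where "U = int u" and "V = int v" and "x = int X"
  have eq: "(x + 2) * U\<^sup>2 = x * V\<^sup>2 + 2"
    using arg_cong[OF less.prems(1), of int] unfolding U_def V_def x_def by (simp add: algebra_simps)
  have pos: "x \<ge> 1" "U \<ge> 1" "V \<ge> 1" using less.prems assms(1) unfolding U_def V_def x_def by auto
  show ?case
  proof (cases "u = 1")
    case True
    then have "x * (V\<^sup>2 - 1) = 0" using eq unfolding U_def by (simp add: algebra_simps)
    then have "V\<^sup>2 = 1\<^sup>2" using pos by simp
    then have "V = 1" using pos power2_eq_iff_nonneg[of V 1] by simp
    then show ?thesis using True unfolding V_def by (intro exI[of _ 0]) simp
  next
    case False
    then have U2: "U \<ge> 2" using less.prems unfolding U_def by simp
    define U' and V' where "U' = (x + 1) * U - x * V" and "V' = (x + 1) * V - (x + 2) * U"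
    have eq': "(x + 2) * U'\<^sup>2 = x * V'\<^sup>2 + 2"
      using eq unfolding U'_def V'_def by algebra
    have inverse: "U = (x + 1) * U' + x * V'" "V = (x + 1) * V' + (x + 2) * U'"
      unfolding U'_def V'_def by (auto simp: algebra_simps)
    have "x * V\<^sup>2 - x * U\<^sup>2 = 2 * (U\<^sup>2 - 1)" using eq by (simp add: algebra_simps)
    moreover have "U\<^sup>2 > 1" using U2 by (simp add: one_less_power)
    ultimately have "x * U\<^sup>2 < x * V\<^sup>2" by simp
    then have "U\<^sup>2 < V\<^sup>2" using pos by simp
    then have "U < V" using pos by (intro power_less_imp_less_base[of U 2 V]) auto
    then have U'_less: "U' < U" using pos unfolding U'_def by (simp add: algebra_simps)
    have "(x * V)\<^sup>2 < ((x + 1) * U)\<^sup>2"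
    proof -
      have "((x + 1) * U)\<^sup>2 - (x * V)\<^sup>2 = U\<^sup>2 + 2 * x" using eq by algebra
      then show ?thesis using pos \<open>U\<^sup>2 > 1\<close> by linarith
    qed
    then have "x * V < (x + 1) * U" using pos by (intro power_less_imp_less_base[of "x * V" 2]) auto
    then have U'_pos: "U' \<ge> 1" unfolding U'_def by simp
    \<comment> \<open>A negative \<open>V'\<close> has modulus at least \<open>U'\<close>, and the
      formula for \<open>U\<close> in terms of \<open>U'\<close> and \<open>V'\<close> would give
      \<open>U \<le> U'\<close>.\<close>
    have V'_neg: "\<not> V' < 0"
    proof
      assume "V' < 0"
      have "x * U'\<^sup>2 \<le> x * V'\<^sup>2"
      proof -
        have "x * V'\<^sup>2 - x * U'\<^sup>2 = 2 * (U'\<^sup>2 - 1)" using eq' by (simp add: algebra_simps)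
        moreover have "U'\<^sup>2 \<ge> 1" using U'_pos by (simp add: one_le_power)
        ultimately show ?thesis by simp
      qed
      then have "U'\<^sup>2 \<le> (- V')\<^sup>2" using pos by simp
      then have "U' \<le> - V'" by (rule power2_le_imp_le) (use \<open>V' < 0\<close> in linarith)
      then have "x * U' \<le> x * (- V')" using pos by (intro mult_left_mono) auto
      then have "U \<le> U'" using inverse(1) by (simp add: algebra_simps)
      then show False using U'_less by simp
    qed
    have V'_pos: "V' \<ge> 1"
    proof (rule ccontr)
      assume "\<not> ?thesis"
      then have "V' = 0" using V'_neg by simp
      then have "(x + 2) * U'\<^sup>2 = 2" using eq' by simp
      moreover have "(x + 2) * 1 \<le> (x + 2) * U'\<^sup>2"
        using pos U'_pos by (intro mult_left_mono) (auto simp: one_le_power)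
      ultimately show False using pos by simp
    qed
    have n: "int (nat U') = U'" "int (nat V') = V'" using U'_pos V'_pos by auto
    have "int ((X + 2) * (nat U')\<^sup>2) = int (X * (nat V')\<^sup>2 + 2)"
      using eq' unfolding x_def by (simp only: of_nat_add of_nat_mult of_nat_power of_nat_numeral n)
    then have "(X + 2) * (nat U')\<^sup>2 = X * (nat V')\<^sup>2 + 2" by (simp only: of_nat_eq_iff)
    moreover have "nat U' < u" "1 \<le> nat U'" "1 \<le> nat V'"
      using U'_less U'_pos V'_pos unfolding U_def by auto
    ultimately obtain t where t: "nat U' = pell_u X t" "nat V' = pell_v X t"
      using less.IH by blast
    have "int u = int (pell_u X (Suc t))" "int v = int (pell_v X (Suc t))"
      using inverse n t unfolding U_def V_def x_def by (auto simp: algebra_simps)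
    then show ?thesis by (metis of_nat_eq_iff)
  qed
qed

text \<open>Modulo \<open>X + 2\<close> the index \<open>2 * t + 1\<close> itself appears, up to
  sign, as the residue. A prime that divides both \<open>X + 2\<close> and the coordinate therefore
  divides the index. The two congruences are proved by simultaneous induction.\<close>

lemma pell_u_cong: "int (X + 2) dvd int (pell_u X t) - (-1) ^ t * int (2 * t + 1)"
  and pell_v_cong': "int (X + 2) dvd int (pell_v X t) - (-1) ^ t"
proof (induction t)
  case (Suc t)
  {
    case 1
    obtain a b where ab: "int (pell_u X t) = (-1) ^ t * int (2 * t + 1) + int (X + 2) * a"
      "int (pell_v X t) = (-1) ^ t + int (X + 2) * b"
      using Suc by (metis add.commute diff_eq_eq dvd_def)
    have "int (pell_u X (Suc t)) - (-1) ^ Suc t * int (2 * Suc t + 1) =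
       int (X + 2) * ((-1) ^ t * int (2 * t + 2) + (int X + 1) * a + int X * b)"
      by (simp add: ab algebra_simps)
    then show ?case by simp
  next
    case 2
    obtain b where b: "int (pell_v X t) = (-1) ^ t + int (X + 2) * b"
      using Suc by (metis add.commute diff_eq_eq dvd_def)
    have "int (pell_v X (Suc t)) - (-1) ^ Suc t =
       int (X + 2) * ((-1) ^ t + (int X + 1) * b + int (pell_u X t))"
      by (simp add: b algebra_simps)
    then show ?case by simp
  }
qed auto

lemma pell_v_cong: "int X dvd int (pell_v X t) - int (2 * t + 1)"
  and pell_u_cong': "int X dvd int (pell_u X t) - 1"
proof (induction t)
  case (Suc t)
  {
    case 1
    obtain a b where ab: "int (pell_v X t) = int (2 * t + 1) + int X * a"
      "int (pell_u X t) = 1 + int X * b"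
      using Suc by (metis add.commute diff_eq_eq dvd_def)
    have "int (pell_v X (Suc t)) - int (2 * Suc t + 1) =
       int X * (int (2 * t + 1) + (int X + 1) * a + 1 + (int X + 2) * b)"
      by (simp add: ab algebra_simps)
    then show ?case by simp
  next
    case 2
    obtain b where b: "int (pell_u X t) = 1 + int X * b"
      using Suc by (metis add.commute diff_eq_eq dvd_def)
    have "int (pell_u X (Suc t)) - 1 = int X * (1 + (int X + 1) * b + int (pell_v X t))"
      by (simp add: b algebra_simps)
    then show ?case by simp
  }
qed auto

text \<open>Stated for arbitrary roots \<open>A\<close> and \<open>B\<close>, so that the sign of
  \<open>B\<close> can be switched and a composite solution can serve as a new pair of
  roots.\<close>

lemma pell_closed_form:
  fixes A B :: real
  assumes "A\<^sup>2 = real X + 2" "B\<^sup>2 = real X"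
  shows "A * real (pell_u X t) + B * real (pell_v X t) = (A + B) ^ (2 * t + 1) / 2 ^ t"
proof (induction t)
  case (Suc t)
  have "(A + B)\<^sup>2 / 2 = real X + 1 + A * B"
    using assms by (simp add: power2_sum)
  have "A * real (pell_u X (Suc t)) + B * real (pell_v X (Suc t)) =
     (A * real (pell_u X t) + B * real (pell_v X t)) * (real X + 1 + A * B)"
    using assms by (simp add: algebra_simps power2_eq_square) algebra
  also have "\<dots> = (A + B) ^ (2 * t + 1) / 2 ^ t * ((A + B)\<^sup>2 / 2)"
    unfolding Suc \<open>(A + B)\<^sup>2 / 2 = _\<close> ..
  finally show ?case by (simp add: power2_eq_square mult_ac)
qed simp

text \<open>The solution number \<open>m = 2 * t + 1\<close> is the \<open>m\<close>-th power of the fundamental one. A factorization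
  of \<open>m\<close> therefore factors both coordinates, where the cofactors solve a Pell equation of the same shape.\<close>

lemma pell_compose:
  assumes X: "X \<ge> 1" and t: "2 * t + 1 = (2 * \<pi> + 1) * (2 * \<tau> + 1)"
  defines "Y \<equiv> X * (pell_v X \<tau>)\<^sup>2"
  shows "pell_u X t = pell_u X \<tau> * pell_u Y \<pi>" "pell_v X t = pell_v X \<tau> * pell_v Y \<pi>"
    "Y + 2 = (X + 2) * (pell_u X \<tau>)\<^sup>2"
proof -
  show Y2: "Y + 2 = (X + 2) * (pell_u X \<tau>)\<^sup>2" unfolding Y_def using pell_equation[of X \<tau>] by simp
  define A B where "A = sqrt (real X + 2)" and "B = sqrt (real X)"
  have AB: "A\<^sup>2 = real X + 2" "B\<^sup>2 = real X" "A > 0" "B > 0" unfolding A_def B_def using X by auto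
  have t_eq: "t = \<tau> * (2 * \<pi> + 1) + \<pi>" using t by (simp add: algebra_simps)
  have *: "A * real (pell_u X t) + B' * real (pell_v X t)
      = A * real (pell_u X \<tau>) * real (pell_u Y \<pi>) + B' * real (pell_v X \<tau>) * real (pell_v Y \<pi>)"
    if B': "B'\<^sup>2 = real X" for B'
  proof -
    define C D where "C = A * real (pell_u X \<tau>)" and "D = B' * real (pell_v X \<tau>)"
    have C: "C\<^sup>2 = real Y + 2"
    proof -
      have "C\<^sup>2 = real ((X + 2) * (pell_u X \<tau>)\<^sup>2)" unfolding C_def power_mult_distrib AB by (simp add: algebra_simps)
      then show ?thesis unfolding Y2[symmetric] by simp
    qed
    have D: "D\<^sup>2 = real Y" unfolding D_def power_mult_distrib B' Y_def by simp
    have "C * real (pell_u Y \<pi>) + D * real (pell_v Y \<pi>) = (C + D) ^ (2 * \<pi> + 1) / 2 ^ \<pi>"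
      by (rule pell_closed_form[OF C D])
    also have "C + D = (A + B') ^ (2 * \<tau> + 1) / 2 ^ \<tau>"
      unfolding C_def D_def by (rule pell_closed_form[OF AB(1) B'])
    also have "((A + B') ^ (2 * \<tau> + 1) / 2 ^ \<tau>) ^ (2 * \<pi> + 1) / 2 ^ \<pi> =
       (A + B') ^ ((2 * \<tau> + 1) * (2 * \<pi> + 1)) / 2 ^ (\<tau> * (2 * \<pi> + 1) + \<pi>)"
      unfolding power_divide power_mult power_add[of 2 "\<tau> * (2 * \<pi> + 1)"] by simp
    also have "\<dots> = (A + B') ^ (2 * t + 1) / 2 ^ t"
      unfolding t t_eq[symmetric] by (simp add: mult.commute)
    also have "\<dots> = A * real (pell_u X t) + B' * real (pell_v X t)"
      by (rule pell_closed_form[OF AB(1) B', symmetric])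
    finally show ?thesis unfolding C_def D_def ..
  qed
  have 1: "A * real (pell_u X t) + B * real (pell_v X t)
      = A * real (pell_u X \<tau>) * real (pell_u Y \<pi>) + B * real (pell_v X \<tau>) * real (pell_v Y \<pi>)"
    by (rule *) (rule AB)
  have 2: "A * real (pell_u X t) + - B * real (pell_v X t)
      = A * real (pell_u X \<tau>) * real (pell_u Y \<pi>) + - B * real (pell_v X \<tau>) * real (pell_v Y \<pi>)"
    by (rule *) (use AB in simp)
  have "A * real (pell_u X t) = A * real (pell_u X \<tau> * pell_u Y \<pi>)"
    "B * real (pell_v X t) = B * real (pell_v X \<tau> * pell_v Y \<pi>)"
    unfolding of_nat_mult mult.assoc[symmetric] using 1 2 by linarith+
  then have "real (pell_u X t) = real (pell_u X \<tau> * pell_u Y \<pi>)"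
    "real (pell_v X t) = real (pell_v X \<tau> * pell_v Y \<pi>)" using AB by auto
  then show "pell_u X t = pell_u X \<tau> * pell_u Y \<pi>" "pell_v X t = pell_v X \<tau> * pell_v Y \<pi>"
    by (simp_all only: of_nat_eq_iff)
qed

lemma odd_prime_factor_index:
  fixes t p :: nat
  assumes "prime p" "p dvd 2 * t + 1"
  obtains \<pi> \<tau> where "p = 2 * \<pi> + 1" "2 * t + 1 = (2 * \<pi> + 1) * (2 * \<tau> + 1)" "\<pi> \<ge> 1"
proof -
  obtain k where k: "2 * t + 1 = p * k" using assms(2) by (auto simp: dvd_def)
  then have "odd (p * k)" by (metis even_plus_one_iff dvd_triv_left)
  then obtain \<pi> \<tau> where pk: "p = 2 * \<pi> + 1" "k = 2 * \<tau> + 1" by (auto elim!: oddE)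
  moreover have "\<pi> \<ge> 1" using pk assms(1) by (cases \<pi>) auto
  ultimately show thesis using k that by blast
qed

text \<open>Splitting \<open>p\<close> off the index makes \<open>pell_u Y \<pi>\<close> a factor of
  the coordinate, and it exceeds 1. A prime factor \<open>r\<close> of it divides
  \<open>X + 2\<close> by hypothesis, hence \<open>Y + 2\<close>, and by the congruence also
  \<open>2 * \<pi> + 1 = p\<close>. So \<open>r = p\<close>.\<close>

lemma pell_u_prime_factor:
  assumes X: "X \<ge> 1" and p: "prime p" "p dvd 2 * t + 1"
    and u: "\<And>r. prime r \<Longrightarrow> r dvd pell_u X t \<Longrightarrow> r dvd X + 2"
  shows "p dvd X + 2"
proof -
  obtain \<pi> \<tau> where pt: "p = 2 * \<pi> + 1" "2 * t + 1 = (2 * \<pi> + 1) * (2 * \<tau> + 1)" "\<pi> \<ge> 1"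
    using odd_prime_factor_index[OF p] by blast
  define Y where "Y = X * (pell_v X \<tau>)\<^sup>2"
  note c = pell_compose[OF X pt(2), folded Y_def]
  have "Y \<noteq> 0" unfolding Y_def using X pell_pos(2)[of X \<tau>] by simp
  then have "pell_u Y \<pi> \<noteq> 1" using pell_gt_1(1)[OF pt(3), of Y] by simp
  then obtain r where r: "prime r" "r dvd pell_u Y \<pi>" using prime_factor_nat by blast
  have rX: "r dvd X + 2" using u r c(1) by simp
  then have "r dvd Y + 2" unfolding c(3) by (rule dvd_mult2)
  then have "int r dvd int (Y + 2)" by (simp only: int_dvd_int_iff)
  then have "int r dvd int (pell_u Y \<pi>) - (-1) ^ \<pi> * int (2 * \<pi> + 1)"
    using pell_u_cong[of Y \<pi>] by (rule dvd_trans)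
  then have "int r dvd (-1) ^ \<pi> * int (2 * \<pi> + 1)"
    using r(2) by (metis dvd_diff_commute dvd_minus_iff dvd_diffD int_dvd_int_iff zdvd_zdiffD)
  then have "int r dvd int p" unfolding pt(1)
    by (cases "even \<pi>") (simp_all del: of_nat_add of_nat_mult of_nat_Suc)
  then have "r = p" using r p by (simp add: primes_dvd_imp_eq)
  then show ?thesis using rX by simp
qed

text \<open>As for the first coordinate, now with the residue of \<open>pell_v Y \<pi>\<close>
  modulo \<open>Y\<close>, a multiple of \<open>X\<close>.\<close>

lemma pell_v_prime_factor:
  assumes X: "X \<ge> 1" and p: "prime p" "p dvd 2 * t + 1"
    and v: "\<And>r. prime r \<Longrightarrow> r dvd pell_v X t \<Longrightarrow> r dvd X"
  shows "p dvd X"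
proof -
  obtain \<pi> \<tau> where pt: "p = 2 * \<pi> + 1" "2 * t + 1 = (2 * \<pi> + 1) * (2 * \<tau> + 1)" "\<pi> \<ge> 1"
    using odd_prime_factor_index[OF p] by blast
  define Y where "Y = X * (pell_v X \<tau>)\<^sup>2"
  note c = pell_compose[OF X pt(2), folded Y_def]
  have "pell_v Y \<pi> \<noteq> 1" using pell_gt_1(2)[OF pt(3), of Y] by simp
  then obtain r where r: "prime r" "r dvd pell_v Y \<pi>" using prime_factor_nat by blast
  have rX: "r dvd X" using v r c(2) by simp
  then have "int r dvd int Y" unfolding Y_def by simp
  then have "int r dvd int (pell_v Y \<pi>) - int (2 * \<pi> + 1)"
    using pell_v_cong[of Y \<pi>] by (rule dvd_trans)
  then have "int r dvd int (2 * \<pi> + 1)"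
    using r(2) by (metis dvd_diff_commute int_dvd_int_iff zdvd_zdiffD)
  then have "r = p" using r p unfolding pt(1)[symmetric] by (simp add: primes_dvd_imp_eq)
  then show ?thesis using rX by simp
qed

text \<open>A prime in the odd index would divide both \<open>X + 2\<close> and \<open>X\<close>,
  hence 2. So the index is 1 and the first coordinate is 1.\<close>

lemma pell_power_solution:
  fixes X h g :: nat
  assumes X: "odd X" and eq: "(X + 2) * ((X + 2) ^ h)\<^sup>2 = X * (X ^ g)\<^sup>2 + 2"
  shows "h = 0"
proof (rule ccontr)
  assume h: "h \<noteq> 0"
  have X1: "X \<ge> 1" using X by (cases X) auto
  obtain t where t: "(X + 2) ^ h = pell_u X t" "X ^ g = pell_v X t"
    using pell_complete[OF X1 eq] X1 by auto
  have "2 * t + 1 \<noteq> 1"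
  proof
    assume "2 * t + 1 = 1"
    then have "(X + 2) ^ h = 1" using t by simp
    then show False using h by simp
  qed
  then obtain p where p: "prime p" "p dvd 2 * t + 1" using prime_factor_nat by blast
  have "p dvd X + 2"
    using X1 p by (rule pell_u_prime_factor) (metis t(1) prime_dvd_power)
  moreover have "p dvd X"
    using X1 p by (rule pell_v_prime_factor) (metis t(2) prime_dvd_power)
  ultimately have "p dvd 2" by (metis dvd_add_right_iff)
  then have "p = 2" using p by (simp add: primes_dvd_imp_eq)
  then show False using p by simp
qed

text \<open>With \<open>X = 1\<close> only the first coordinate is restricted, so the prime 3 may
  occur in the index. A comparison modulo 9 leaves the indices 1 and 3, that is,
  \<open>m = 1\<close> and \<open>m = 5\<close>.\<close>

lemma pell_power_solution_3:
  assumes eq: "3 * (3 ^ h)\<^sup>2 = m\<^sup>2 + (2::nat)"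
  shows "m \<le> 5"
proof -
  have "m \<ge> 1"
  proof (rule ccontr)
    assume "\<not> ?thesis"
    then have "3 * (3 ^ h)\<^sup>2 = (2::nat)" using eq by simp
    moreover have "(3 ^ h)\<^sup>2 \<ge> (1::nat)" by simp
    ultimately show False by linarith
  qed
  have "(1 + 2) * (3 ^ h)\<^sup>2 = 1 * m\<^sup>2 + (2::nat)" using eq by simp
  then obtain t where t: "3 ^ h = pell_u 1 t" "m = pell_v 1 t"
    using pell_complete[of 1 "3 ^ h" m] \<open>m \<ge> 1\<close> by auto
  have only3: "p = 3" if p: "prime p" "p dvd 2 * t + 1" for p
  proof -
    have "p dvd 1 + 2"
    proof (rule pell_u_prime_factor[OF _ p])
      fix r :: nat assume r: "prime r" "r dvd pell_u 1 t"
      then show "r dvd 1 + 2" using t(1) prime_dvd_power[of r 3 h] by (simp add: numeral_3_eq_3)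
    qed simp
    moreover have "(1::nat) + 2 = 3" by simp
    ultimately have "p dvd 3" by metis
    then show ?thesis using p by (simp add: primes_dvd_imp_eq)
  qed
  show ?thesis
  proof (cases "t = 0")
    case False
    then obtain p where p: "prime p" "p dvd 2 * t + 1" using prime_factor_nat[of "2 * t + 1"] by auto
    then obtain \<pi> \<tau> where pt: "p = 2 * \<pi> + 1" "2 * t + 1 = (2 * \<pi> + 1) * (2 * \<tau> + 1)"
      using odd_prime_factor_index by blast
    then have "\<pi> = 1" using only3[OF p] by simp
    define Y where "Y = 1 * (pell_v 1 \<tau>)\<^sup>2"
    have "(1::nat) \<le> 1" by simp
    note c = pell_compose[OF this pt(2), folded Y_def]
    \<comment> \<open>For \<open>\<pi> = 1\<close> the cofactor is \<open>2 * Y + 1\<close>, and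
      \<open>Y + 2 = 3 * (pell_u 1 \<tau>)\<^sup>2\<close>.\<close>
    have u: "pell_u Y \<pi> + 3 = 6 * (pell_u 1 \<tau>)\<^sup>2" using c(3) unfolding \<open>\<pi> = 1\<close> by simp
    have "\<tau> = 0"
    proof (rule ccontr)
      assume "\<tau> \<noteq> 0"
      have d: "pell_u 1 \<tau> dvd 3 ^ h" "pell_u Y \<pi> dvd 3 ^ h" unfolding t(1) c(1) by auto
      obtain i where i: "pell_u 1 \<tau> = 3 ^ i" "i \<le> h" using d(1) by (auto simp: divides_primepow_nat)
      obtain k where k: "pell_u Y \<pi> = 3 ^ k" "k \<le> h" using d(2) by (auto simp: divides_primepow_nat)
      have "pell_u 1 \<tau> > 1" using pell_gt_1(1)[of \<tau> 1] \<open>\<tau> \<noteq> 0\<close> by simp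
      then have "i \<noteq> 0" using i by (cases i) auto
      then obtain i' where i': "i = Suc i'" by (cases i) auto
      have e: "3 ^ k + 3 = 6 * (9 * (3 ^ i')\<^sup>2 :: nat)" using u i k by (simp add: i' power_mult_distrib)
      show False
      proof (cases "k \<ge> 2")
        case True
        then obtain k' where "k = k' + 2" by (metis add.commute le_Suc_ex)
        then have "9 * 3 ^ k' + 3 = 9 * (6 * (3 ^ i')\<^sup>2 :: nat)" using e by (simp add: power_add)
        then show False by presburger
      next
        case False
        then have "3 ^ k \<le> (3::nat)" using power_increasing[of k 1 "3::nat"] by simp
        moreover have "6 * (9 * 1) \<le> 6 * (9 * (3 ^ i')\<^sup>2 :: nat)" by simp
        ultimately show False using e by linarith
      qed
    qed
    then have "t = 1" using pt(2) \<open>\<pi> = 1\<close> by simp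
    then show ?thesis using t by simp
  qed (use t in simp)
qed

section \<open>Pairs dependent at two nearby positions\<close>

text \<open>The subtractive Euclidean algorithm on the exponents, carried out on the bases: the
  smaller base divides the larger, and the quotient satisfies a relation with exponent
  \<open>p - q\<close>.\<close>

lemma common_base:
  fixes x y :: nat
  assumes "x \<ge> 2" "y \<ge> 2" "p > 0" "q > 0" "x ^ p = y ^ q"
  shows "\<exists>r i j. r \<ge> 2 \<and> i > 0 \<and> j > 0 \<and> x = r ^ i \<and> y = r ^ j"
  using assms
proof (induction "x + y" arbitrary: x y p q rule: less_induct)
  case less
  have step: "\<exists>r i j. r \<ge> 2 \<and> i > 0 \<and> j > 0 \<and> x = r ^ i \<and> y = r ^ j"
    if xy: "x < y" "x \<ge> 2" "y \<ge> 2" "p > 0" "q > 0" "x ^ p = y ^ q"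
      and IH: "\<And>x' y' p q. x' + y' < x + y \<Longrightarrow> x' \<ge> 2 \<Longrightarrow> y' \<ge> 2 \<Longrightarrow> p > 0 \<Longrightarrow> q > 0 \<Longrightarrow> x' ^ p = y' ^ q
        \<Longrightarrow> \<exists>r i j. r \<ge> 2 \<and> i > 0 \<and> j > 0 \<and> x' = r ^ i \<and> y' = r ^ j"
    for x y p q :: nat
  proof -
    have "x ^ q < y ^ q" using xy by (intro power_strict_mono) auto
    then have "x ^ q < x ^ p" using xy by simp
    then have qp: "q < p" using xy(2) by (simp add: power_strict_increasing_iff)
    have "x ^ q dvd y ^ q" unfolding xy(6)[symmetric] using qp by (simp add: le_imp_power_dvd)
    then have "x dvd y" using xy(5) by (simp add: pow_divides_pow_iff)
    then obtain z where z: "y = x * z" by (auto simp: dvd_def)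
    have "x ^ q * x ^ (p - q) = x ^ q * z ^ q"
      using xy(6) qp unfolding z power_mult_distrib by (simp add: power_add[symmetric])
    then have e: "x ^ (p - q) = z ^ q" using xy(2) by simp
    have z2: "z \<ge> 2"
    proof (rule ccontr)
      assume "\<not> z \<ge> 2"
      then have "z = 0 \<or> z = 1" by auto
      then show False using z xy by auto
    qed
    have "x + z < x + y" using z xy(2) z2 by simp
    from IH[OF this xy(2) z2 _ xy(5) e] qp
    obtain r i j where "r \<ge> 2" "i > 0" "j > 0" "x = r ^ i" "z = r ^ j" by auto
    then show ?thesis using z
      by (intro exI[of _ r] exI[of _ i] exI[of _ "i + j"]) (auto simp: power_add)
  qed
  consider "x = y" | "x < y" | "y < x" by linarith
  then show ?case
  proof cases
    case 1
    then show ?thesis using less.prems by (intro exI[of _ x] exI[of _ 1]) auto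
  next
    case 2
    show ?thesis by (rule step[OF 2 less.prems]) (rule less.hyps)
  next
    case 3
    have "\<exists>r i j. r \<ge> 2 \<and> i > 0 \<and> j > 0 \<and> y = r ^ i \<and> x = r ^ j"
    proof (rule step[OF 3 less.prems(2,1,4,3) less.prems(5)[symmetric]])
      fix x' y' p q :: nat
      assume "x' + y' < y + x"
      then have "x' + y' < x + y" by simp
      then show "x' \<ge> 2 \<Longrightarrow> y' \<ge> 2 \<Longrightarrow> p > 0 \<Longrightarrow> q > 0 \<Longrightarrow> x' ^ p = y' ^ q
        \<Longrightarrow> \<exists>r i j. r \<ge> 2 \<and> i > 0 \<and> j > 0 \<and> x' = r ^ i \<and> y' = r ^ j"
        by (rule less.hyps)
    qed
    then show ?thesis by blast
  qed
qed

text \<open>A nontrivial relation between the logarithms of two integers above 1 has coefficients of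
  opposite signs, hence positive exponents on both sides.\<close>

definition dependent_pair :: "nat \<Rightarrow> nat \<Rightarrow> bool" where
  "dependent_pair x y \<longleftrightarrow> (\<exists>p q. p > 0 \<and> q > 0 \<and> x ^ p = y ^ q)"

lemma dependent_pair_common_base:
  assumes "dependent_pair x y" "x \<ge> 2" "y \<ge> 2"
  obtains r i j where "r \<ge> 2" "i > 0" "j > 0" "x = r ^ i" "y = r ^ j"
proof -
  obtain p q where "p > 0" "q > 0" "x ^ p = y ^ q"
    using assms(1) unfolding dependent_pair_def by blast
  from common_base[OF assms(2,3) this] that show thesis by blast
qed

lemma dependent_pair_commute: "dependent_pair x y \<longleftrightarrow> dependent_pair y x"
  unfolding dependent_pair_def by metis

section \<open>Congruences for powers\<close>

lemma binomial_cong_square: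
  fixes x :: int
  shows "x\<^sup>2 dvd (1 + x) ^ e - 1 - int e * x"
proof (induction e)
  case (Suc e)
  then obtain k where k: "(1 + x) ^ e = 1 + int e * x + x\<^sup>2 * k"
    by (auto simp: dvd_def algebra_simps)
  have "(1 + x) ^ Suc e - 1 - int (Suc e) * x = x\<^sup>2 * (int e + (1 + x) * k)"
    by (simp add: k algebra_simps power2_eq_square)
  then show ?case by simp
qed simp

lemma binomial_cong_square_neg:
  fixes x :: int
  assumes "odd f"
  shows "x\<^sup>2 dvd (x - 1) ^ f + 1 - int f * x"
proof -
  have "1 + - x = - (x - 1)" by simp
  then have "(1 + - x) ^ f = - ((x - 1) ^ f)" by (simp only: power_minus_odd[OF assms])
  then have "(1 + - x) ^ f - 1 - int f * (- x) = - ((x - 1) ^ f + 1 - int f * x)" by simp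
  then have "(- x)\<^sup>2 dvd - ((x - 1) ^ f + 1 - int f * x)"
    using binomial_cong_square[of "- x" f] by metis
  then show ?thesis by (simp only: power2_minus dvd_minus_iff)
qed

lemma minus_one_dvd_power: "(x::int) - 1 dvd x ^ f - 1"
proof (induction f)
  case (Suc f)
  have "x ^ Suc f - 1 = x * (x ^ f - 1) + (x - 1)" by (simp add: algebra_simps)
  then show ?case using Suc by (metis dvd_add dvd_mult dvd_refl)
qed simp

lemma add_one_dvd_power: "(x::int) + 1 dvd x ^ f - (-1) ^ f"
proof (induction f)
  case (Suc f)
  have "x ^ Suc f - (-1) ^ Suc f = x * (x ^ f - (-1) ^ f) + (x + 1) * (-1) ^ f"
    by (simp add: algebra_simps)
  then show ?case using Suc by simp
qed simp

lemma power_mod_dvd_minus: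
  fixes s :: int
  shows "s ^ k - 1 dvd s ^ l - s ^ (l mod k)"
proof -
  have "(s ^ k) - 1 dvd (s ^ k) ^ (l div k) - 1"
    by (rule minus_one_dvd_power)
  then have "s ^ k - 1 dvd s ^ (l mod k) * ((s ^ k) ^ (l div k) - 1)" by simp
  also have "s ^ (l mod k) * ((s ^ k) ^ (l div k) - 1) = s ^ l - s ^ (l mod k)"
    by (simp add: algebra_simps power_mult[symmetric] power_add[symmetric])
  finally show ?thesis .
qed

lemma power_mod_dvd_plus:
  fixes r :: int
  shows "r ^ i + 1 dvd r ^ j - (-1) ^ (j div i) * r ^ (j mod i)"
proof -
  have "r ^ i + 1 dvd r ^ (j mod i) * ((r ^ i) ^ (j div i) - (-1) ^ (j div i))"
    using add_one_dvd_power by (rule dvd_mult)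
  also have "r ^ (j mod i) * ((r ^ i) ^ (j div i) - (-1) ^ (j div i)) = r ^ j - (-1) ^ (j div i) * r ^ (j mod i)"
    by (simp add: algebra_simps power_mult[symmetric] power_add[symmetric])
  finally show ?thesis .
qed

lemma power_minus_one_dvd:
  fixes s :: nat
  assumes "s \<ge> 2" "k > 0" "int s ^ k - 1 dvd int s ^ l - 1"
  shows "k dvd l"
proof -
  have "int s ^ k - 1 dvd (int s ^ l - 1) - (int s ^ l - int s ^ (l mod k))"
    using assms(3) power_mod_dvd_minus by (rule dvd_diff)
  then have d: "int s ^ k - 1 dvd int s ^ (l mod k) - 1" by simp
  have "int s ^ (l mod k) < int s ^ k" using assms by (intro power_strict_increasing) auto
  moreover have "int s ^ (l mod k) \<ge> 1" using assms by (intro one_le_power) auto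
  ultimately have "int s ^ (l mod k) - 1 = 0"
    using zdvd_not_zless[of "int s ^ (l mod k) - 1" "int s ^ k - 1"] d by linarith
  then have "int (s ^ (l mod k)) = int 1" by simp
  then have "s ^ (l mod k) = 1" by (simp only: of_nat_eq_iff)
  then have "l mod k = 0" using assms(1) by (simp add: power_eq_1_iff)
  then show ?thesis by auto
qed

section \<open>Pairs at distance one\<close>

lemma odd_power_plus_one_eq_two_power:
  fixes w f g :: nat
  assumes "odd w" "odd f" "w ^ f + 1 = 2 ^ g"
  shows "w ^ f = w"
proof -
  obtain a where a: "int w ^ f + 1 - int f * (1 + int w) = (1 + int w)\<^sup>2 * a"
    using binomial_cong_square_neg[OF assms(2), of "1 + int w"] by (auto simp: dvd_def)
  then have e: "int w ^ f + 1 = (1 + int w) * (int f + (1 + int w) * a)"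
    by (simp add: algebra_simps power2_eq_square)
  \<comment> \<open>The cofactor of \<open>w + 1\<close> is congruent to \<open>f\<close> modulo the
    even number \<open>w + 1\<close>, hence odd; as a divisor of a power of 2 it must be 1.\<close>
  define Q where "Q = int f + (1 + int w) * a"
  have "odd Q" unfolding Q_def using assms by simp
  have "Q dvd 2 ^ g"
  proof -
    have "int (2 ^ g) = (1 + int w) * Q" using e arg_cong[OF assms(3), of int] unfolding Q_def by simp
    then show ?thesis by simp
  qed
  then have "is_unit Q"
    using \<open>odd Q\<close> coprime_common_divisor[of Q "2 ^ g" Q] by simp
  moreover have "Q > 0"
  proof -
    have "0 < (1 + int w) * Q" unfolding Q_def e[symmetric] by (simp add: add_nonneg_pos)
    then show ?thesis by (simp add: zero_less_mult_iff)
  qed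
  ultimately have "Q = 1" by simp
  then have "int w ^ f = int w" using e unfolding Q_def by simp
  then show ?thesis by (metis of_nat_eq_iff of_nat_power)
qed

lemma odd_part_unique:
  fixes A B :: nat
  assumes "2 ^ a * A = 2 ^ b * B" "odd A" "odd B"
  shows "A = B"
proof -
  have *: "a \<ge> b" if "2 ^ a * A = 2 ^ b * B" "odd A" for a b A B :: nat
  proof (rule ccontr)
    assume "\<not> ?thesis"
    then obtain d where "b = a + Suc d" by (metis less_iff_Suc_add not_le add_Suc_right)
    then have "2 ^ a * A = 2 ^ a * (2 * (2 ^ d * B))" using that by (simp add: power_add)
    then have "A = 2 * (2 ^ d * B)" by (simp only: mult_cancel1) simp
    then show False using that by simp
  qed
  have "a = b" using *[OF assms(1,2)] *[OF assms(1)[symmetric] assms(3)] by simp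
  then show ?thesis using assms(1) by simp
qed

text \<open>Comparison modulo \<open>x\<^sup>2\<close> and \<open>(x + 1)\<^sup>2\<close> gives
  \<open>x dvd e\<close> and \<open>x + 1 dvd f\<close>; since \<open>f\<close> is odd,
  \<open>x\<close> and then \<open>e\<close> are even. So \<open>x ^ f\<close> is a square minus 1
  and splits as \<open>y * (y + 2)\<close> with \<open>x dvd y\<close>. Every prime of
  \<open>y + 2\<close> divides \<open>x\<close>, hence \<open>y\<close>, hence 2, and both factors
  become explicit in terms of a power of 2.\<close>

lemma power_successor_equation:
  fixes x e f :: nat
  assumes x: "x \<ge> 2" and f: "odd f" "f \<ge> 2" and e: "e \<ge> 2" and eq: "x ^ f + 1 = (x + 1) ^ e"
  shows "x = 2 \<and> e = 2"
proof -
  have f3: "f \<ge> 3" using f by (cases "f = 2") auto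
  define X where "X = int x"
  have X: "X \<ge> 2" using x unfolding X_def by simp
  have EQ: "X ^ f + 1 = (1 + X) ^ e"
    using arg_cong[OF eq, of int] unfolding X_def by (simp add: add.commute)
  have "X\<^sup>2 dvd X ^ f" using f by (intro le_imp_power_dvd)
  then have "X\<^sup>2 dvd X ^ f - ((1 + X) ^ e - 1 - int e * X)"
    using binomial_cong_square[of X e] by (rule dvd_diff)
  then have "X * X dvd int e * X" unfolding EQ[symmetric] power2_eq_square by simp
  then have "X dvd int e" using X by simp
  then have xe: "x dvd e" unfolding X_def by simp
  have "(1 + X)\<^sup>2 dvd (1 + X) ^ e" using e by (intro le_imp_power_dvd)
  moreover have "(1 + X)\<^sup>2 dvd (1 + X) ^ e - int f * (1 + X)"
    using binomial_cong_square_neg[OF f(1), of "1 + X"] EQ by simp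
  ultimately have "(1 + X)\<^sup>2 dvd (1 + X) ^ e - ((1 + X) ^ e - int f * (1 + X))" by (rule dvd_diff)
  then have "(1 + X) * (1 + X) dvd int f * (1 + X)" by (simp add: power2_eq_square)
  then have "1 + X dvd int f" using X by simp
  then have "int (x + 1) dvd int f" unfolding X_def by (simp add: add.commute)
  then have xf: "x + 1 dvd f" by (simp only: int_dvd_int_iff)
  have "even x" using xf f(1) by (metis dvd_trans even_plus_one_iff)
  then have "even e" using xe by (rule dvd_trans)
  then obtain e' where e': "e = 2 * e'" by (auto simp: dvd_def)
  define G where "G = (x + 1) ^ e' + 1"
  have e'0: "e' \<noteq> 0" using e e' by auto
  have "x ^ f + 1 = ((x + 1) ^ e')\<^sup>2" using eq e' by (simp add: power_mult[symmetric] mult.commute)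
  moreover obtain y where y: "(x + 1) ^ e' = y + 1"
    by (cases "(x + 1) ^ e'") auto
  ultimately have fac: "x ^ f = y * (y + 2)" by (simp add: power2_eq_square)
  have Gy: "G = y + 2" unfolding G_def y by simp
  have xy: "x dvd y"
  proof -
    have "X dvd (1 + X) ^ e' - 1"
      using minus_one_dvd_power[of "1 + X" e'] by simp
    moreover have "(1 + X) ^ e' - 1 = int y" using arg_cong[OF y, of int] unfolding X_def by (simp add: add.commute)
    ultimately show ?thesis unfolding X_def by simp
  qed
  have prime2: "p = 2" if p: "prime p" "p dvd G" for p
  proof -
    have "p dvd x ^ f" unfolding fac Gy[symmetric] using p by simp
    then have "p dvd x" using p by (metis prime_dvd_power)
    then have "p dvd y" using xy by (rule dvd_trans)
    then have "p dvd 2" using p(2) unfolding Gy by (metis dvd_add_right_iff)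
    then show ?thesis using p by (simp add: primes_dvd_imp_eq)
  qed
  have G_pow: "\<exists>g. G = 2 ^ g"
  proof -
    have "G \<noteq> 0" unfolding Gy by simp
    then obtain m where m: "G = 2 ^ multiplicity 2 G * m" "\<not> 2 dvd m"
      using multiplicity_decompose'[of G 2] by auto
    have "m = 1"
    proof (rule ccontr)
      assume "m \<noteq> 1"
      then obtain p where "prime p" "p dvd m" using prime_factor_nat by blast
      moreover have "m dvd G" by (subst m(1)) simp
      ultimately have "2 dvd m" using prime2[of p] dvd_trans by blast
      then show False using m(2) by simp
    qed
    then show ?thesis using m(1) by (intro exI[of _ "multiplicity 2 G"]) simp
  qed
  then obtain g where g: "G = 2 ^ g" by blast
  have "(x + 1) ^ e' \<ge> (x + 1) ^ 1" using e'0 by (intro power_increasing) auto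
  then have y0: "y \<ge> 2" using y x by simp
  have "g \<ge> 2"
  proof (rule ccontr)
    assume "\<not> ?thesis"
    then have "(2::nat) ^ g \<le> 2 ^ 1" by (intro power_increasing) auto
    then show False using g Gy y0 by simp
  qed
  then obtain g' where g': "g = g' + 2" by (metis add.commute le_Suc_ex)
  have y_eq: "y = 2 * (2 * 2 ^ g' - 1)" using g Gy g' by (simp add: power_add)
  have odd: "odd (2 * 2 ^ g' - 1 :: nat)" by simp
  have xf_eq: "x ^ f = 2 ^ (g' + 3) * (2 * 2 ^ g' - 1)"
    unfolding fac Gy[symmetric] g g' by (subst y_eq) (simp add: power_add)
  \<comment> \<open>Comparing odd parts leaves \<open>w ^ f + 1 = 2 ^ (g' + 1)\<close> for the odd
    part \<open>w\<close> of \<open>x\<close>.\<close>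
  define \<mu> where "\<mu> = multiplicity 2 x"
  obtain w where w: "x = 2 ^ \<mu> * w" "\<not> 2 dvd w"
    unfolding \<mu>_def using multiplicity_decompose'[of x 2] x by auto
  have "x ^ f = 2 ^ (\<mu> * f) * w ^ f"
    unfolding w(1) by (simp add: power_mult_distrib power_mult)
  then have "2 ^ (\<mu> * f) * w ^ f = 2 ^ (g' + 3) * (2 * 2 ^ g' - 1)" using xf_eq by simp
  then have "w ^ f = 2 * 2 ^ g' - 1"
    by (rule odd_part_unique) (use w(2) odd in auto)
  moreover have "(2::nat) ^ g' \<ge> 1" by simp
  ultimately have wf: "w ^ f + 1 = 2 ^ (g' + 1)" by simp
  have "w ^ f = w" using odd_power_plus_one_eq_two_power[OF _ f(1) wf] w(2) by simp
  then have "w ^ f = w ^ 1" by simp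
  then have "w = 1"
    using f3 power_inject_exp[of w f 1] w(2) by (cases w) auto
  then have "y = 2" using wf y_eq by simp
  then have "x = 2" using xy x dvd_imp_le[of x 2] by simp
  moreover have "e' = 1"
  proof -
    have "(3::nat) ^ e' = 3 ^ 1" using y \<open>y = 2\<close> \<open>x = 2\<close> by simp
    then show ?thesis by (simp only: power_inject_exp)
  qed
  ultimately show ?thesis using e' by simp
qed


lemma int_power_eq_1:
  fixes r k :: nat
  assumes "r \<ge> 2" "int r ^ k = 1" shows "k = 0"
proof -
  have "int (r ^ k) = int 1" using assms by simp
  then have "r ^ k = 1" by (simp only: of_nat_eq_iff)
  then show ?thesis using assms by (simp add: power_eq_1_iff)
qed

lemma power_eq_power_imp_exponent_less:
  fixes r :: nat
  assumes "r \<ge> 2" "r ^ i < r ^ j" shows "i < j"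
  using assms by (simp add: power_strict_increasing_iff)

text \<open>As powers of \<open>r\<close> the numbers satisfy \<open>x dvd y\<close>; read in terms
  of \<open>s\<close>, this makes \<open>y + 1\<close> a power of \<open>x + 1\<close>. Then
  \<open>y\<close> is -1 modulo \<open>x + 1 = r ^ i + 1\<close>, and among the residues of powers
  of \<open>r\<close> only odd powers of \<open>x\<close> achieve this.\<close>

theorem dependent_successor_pairs:
  assumes "2 \<le> x" "x < y" "dependent_pair x y" "dependent_pair (x + 1) (y + 1)"
  shows "x = 2 \<and> y = 8"
proof -
  obtain r i j where r: "r \<ge> 2" "i > 0" "j > 0" "x = r ^ i" "y = r ^ j"
    using dependent_pair_common_base[OF assms(3)] assms by auto
  obtain s k l where s: "s \<ge> 2" "k > 0" "l > 0" "x + 1 = s ^ k" "y + 1 = s ^ l"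
    using dependent_pair_common_base[OF assms(4)] assms by auto
  have ij: "i < j" using assms(2) r power_eq_power_imp_exponent_less by metis
  have "s ^ k < s ^ l" using assms(2) s(4,5) by linarith
  then have kl: "k < l" using s(1) power_eq_power_imp_exponent_less by blast
  have I: "int x = int r ^ i" "int y = int r ^ j" "int x = int s ^ k - 1" "int y = int s ^ l - 1"
    using r(4,5) arg_cong[OF s(4), of int] arg_cong[OF s(5), of int] by simp_all
  have "int x dvd int y" unfolding I(1,2) using ij by (intro le_imp_power_dvd) simp
  then have "k dvd l" unfolding I(3,4) by (intro power_minus_one_dvd[OF s(1,2)])
  then obtain e where e: "l = k * e" by (auto simp: dvd_def)
  have "e \<noteq> 0" "e \<noteq> 1" using e kl by auto
  then have e2: "e \<ge> 2" by simp
  have ye: "y + 1 = (x + 1) ^ e" unfolding s e by (simp add: power_mult)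
  define f j0 where "f = j div i" and "j0 = j mod i"
  have j0: "j0 < i" unfolding j0_def using r by simp
  have small: "1 \<le> int r ^ j0" "int r ^ j0 < int x"
    using r j0 unfolding I(1) by (auto intro: power_strict_increasing)
  have "int x + 1 dvd int y + 1"
  proof -
    have "x + 1 dvd y + 1" unfolding ye using e2 by (simp add: dvd_power)
    then have "int (x + 1) dvd int (y + 1)" by (simp only: int_dvd_int_iff)
    then show ?thesis by (simp add: add.commute)
  qed
  moreover have "int x + 1 dvd int y - (-1) ^ f * int r ^ j0"
    unfolding I(1,2) f_def j0_def by (rule power_mod_dvd_plus)
  ultimately have "int x + 1 dvd (int y + 1) - (int y - (-1) ^ f * int r ^ j0)" by (rule dvd_diff)
  then have d: "int x + 1 dvd 1 + (-1) ^ f * int r ^ j0" by simp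
  have odd_f: "odd f"
  proof
    assume "even f"
    then have "int x + 1 dvd 1 + int r ^ j0" using d by simp
    then show False using zdvd_not_zless[of "1 + int r ^ j0" "int x + 1"] small by linarith
  qed
  then have "int x + 1 dvd int r ^ j0 - 1" using d by (simp add: dvd_diff_commute)
  then have "int r ^ j0 = 1"
    using zdvd_not_zless[of "int r ^ j0 - 1" "int x + 1"] small by linarith
  then have "j0 = 0" using r(1) int_power_eq_1 by blast
  then have "j = i * f" unfolding f_def j0_def by (simp add: mult.commute mod_eq_0_iff_dvd)
  then have yf: "y = x ^ f" using r by (simp add: power_mult)
  have "f \<noteq> 0" "f \<noteq> 1" using yf assms by (auto intro: Nat.gr0I)
  then have "f \<ge> 2" by simp
  then have "x = 2 \<and> e = 2"
    using power_successor_equation[of x f e] assms(1) odd_f e2 ye yf by simp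
  then show ?thesis using ye by simp
qed

section \<open>Pairs at distance two\<close>

lemma no_gap_two_power_solution:
  fixes x e f :: nat
  assumes x: "odd x" and f: "odd f" and e: "e \<ge> 2" and eq: "x ^ f + 2 = (x + 2) ^ e"
  shows False
proof -
  \<comment> \<open>Both sides are expanded modulo the square of the midpoint \<open>M\<close> of
    \<open>x\<close> and \<open>x + 2\<close>. This gives \<open>M dvd e - f\<close>, and as
    \<open>M\<close> is even the exponents have equal parity, so the equation is of Pell
    type.\<close>
  define M where "M = int x + 1"
  have M: "M > 0" unfolding M_def by simp
  have EQ: "(M - 1) ^ f + 2 = (1 + M) ^ e"
    using arg_cong[OF eq, of int] unfolding M_def by (simp add: add.commute)
  have "M\<^sup>2 dvd ((M - 1) ^ f + 1 - int f * M) - ((1 + M) ^ e - 1 - int e * M)"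
    using binomial_cong_square_neg[OF f, of M] binomial_cong_square[of M e] by (rule dvd_diff)
  also have "((M - 1) ^ f + 1 - int f * M) - ((1 + M) ^ e - 1 - int e * M) = (int e - int f) * M"
    unfolding EQ[symmetric] by (simp add: algebra_simps)
  finally have "M dvd int e - int f" using M by (simp add: power2_eq_square)
  moreover have "even M" unfolding M_def using x by simp
  ultimately have "even (int e - int f)" by (rule dvd_trans[rotated])
  then have "odd e" using f by simp
  then obtain h where h: "e = 2 * h + 1" by (auto elim: oddE)
  obtain g where g: "f = 2 * g + 1" using f by (auto elim: oddE)
  have "(x + 2) * ((x + 2) ^ h)\<^sup>2 = x * (x ^ g)\<^sup>2 + 2"
    using eq unfolding g h by (simp add: power_mult[symmetric] mult.commute)
  then have "h = 0" by (rule pell_power_solution[OF x])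
  then show False using h e by simp
qed

text \<open>The exponent is odd by reduction modulo 4, which yields the Pell equation with
  \<open>X = 1\<close>.\<close>

lemma square_plus_two_power_of_three:
  fixes m l :: nat
  assumes "odd m" "m\<^sup>2 + 2 = 3 ^ l"
  shows "m \<le> 5"
proof -
  obtain n where n: "m = 2 * n + 1" using assms(1) by (auto elim: oddE)
  have "m\<^sup>2 = 4 * (n * n + n) + 1" unfolding n power2_eq_square by (simp add: algebra_simps)
  then have "m\<^sup>2 mod 4 = 1" by presburger
  have "odd l"
  proof
    assume "even l"
    then obtain h where "l = 2 * h" by (auto simp: dvd_def)
    then have "(3::nat) ^ l mod 4 = 9 ^ h mod 4" by (simp add: power_mult)
    moreover have "(9::nat) mod 4 = 1" by simp
    ultimately have "(3::nat) ^ l mod 4 = 1" using power_mod[of "9::nat" 4 h] by simp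
    then show False using assms(2) \<open>m\<^sup>2 mod 4 = 1\<close> by presburger
  qed
  then obtain h where h: "l = 2 * h + 1" by (auto elim: oddE)
  have "3 * (3 ^ h)\<^sup>2 = m\<^sup>2 + (2::nat)"
    using assms(2) unfolding h by (simp add: power_mult[symmetric] mult.commute)
  then show ?thesis by (rule pell_power_solution_3)
qed

text \<open>If \<open>i\<close> is minimal then \<open>r\<close> has order \<open>2 * i\<close> and \<open>s\<close> has order \<open>k\<close> modulo \<open>r ^ i + 1\<close>, so that the
  second solution consists of powers of the first one, unless \<open>s = 3\<close>, where \<open>r ^ 0 + 2 = 3\<close> interferes.\<close>

lemma no_second_gap_two:
  fixes r s i j k l :: nat
  assumes r: "r \<ge> 2" and s: "s \<ge> 2" and pos: "i > 0" "k > 0" and ij: "i < j"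
    and eq1: "r ^ i + 2 = s ^ k" and eq2: "r ^ j + 2 = s ^ l"
    and minimal: "\<And>i' k'. 0 < i' \<Longrightarrow> i' < i \<Longrightarrow> r ^ i' + 2 \<noteq> s ^ k'"
  shows False
proof -
  have "r ^ i < r ^ j" using r ij by (intro power_strict_increasing) auto
  then have "s ^ k < s ^ l" using eq1 eq2 by simp
  then have kl: "k < l" using s power_eq_power_imp_exponent_less by blast
  \<comment> \<open>For even \<open>r\<close> also \<open>s\<close> is even; as \<open>j\<close> and
    \<open>l\<close> exceed 1, two multiples of 4 would differ by 2.\<close>
  have odd_r: "odd r"
  proof
    assume "even r"
    then have "2 ^ 2 dvd r ^ 2" by (rule dvd_power_same)
    also have "r ^ 2 dvd r ^ j" using ij pos by (intro le_imp_power_dvd) simp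
    finally have 4: "4 dvd r ^ j" by simp
    have "even (s ^ k)" unfolding eq1[symmetric] using \<open>even r\<close> pos by simp
    then have "even s" by simp
    then have "2 ^ 2 dvd s ^ 2" by (rule dvd_power_same)
    also have "s ^ 2 dvd s ^ l" using kl pos by (intro le_imp_power_dvd) simp
    finally have "4 dvd r ^ j + 2" unfolding eq2 by simp
    then have "4 dvd (2::nat)" using 4 by (metis dvd_add_right_iff)
    then show False by simp
  qed
  then have r3: "r \<ge> 3" using r by (cases "r = 2") auto
  define x where "x = r ^ i"
  have x2: "x + 2 = s ^ k" unfolding x_def by (rule eq1)
  have "odd x" unfolding x_def using odd_r by simp
  then have "odd (s ^ k)" unfolding x2[symmetric] by simp
  then have "odd s" using pos by simp
  then have s3: "s \<ge> 3" using s by (cases "s = 2") auto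
  have x3: "x \<ge> 3" using r3 pos power_increasing[of 1 i r] unfolding x_def by simp
  define f j0 e l0 where "f = j div i" and "j0 = j mod i" and "e = l div k" and "l0 = l mod k"
  have j0: "j0 < i" and l0: "l0 < k" unfolding j0_def l0_def using pos by auto
  have j_eq: "j = i * f + j0" and l_eq: "l = k * e + l0" unfolding f_def j0_def e_def l0_def by auto
  define u v where "u = int r ^ j0" and "v = int s ^ l0"
  \<comment> \<open>Odd bases are at least 3, so \<open>u\<close> and \<open>v\<close> are at most
    about a third of the modulus \<open>x + 1\<close>. The combinations of them below are then too
    small to be nonzero multiples of it.\<close>
  have u: "1 \<le> u" "3 * u \<le> int x"
  proof -
    show "1 \<le> u" unfolding u_def using r by simp
    have "3 * u \<le> int r * u" using r3 \<open>1 \<le> u\<close> by (intro mult_right_mono) auto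
    also have "\<dots> = int r ^ Suc j0" unfolding u_def by simp
    also have "\<dots> \<le> int r ^ i" using r j0 by (intro power_increasing) auto
    finally show "3 * u \<le> int x" unfolding x_def by simp
  qed
  have v: "1 \<le> v" "3 * v \<le> int x + 2"
  proof -
    show "1 \<le> v" unfolding v_def using s by simp
    have "3 * v \<le> int s * v" using s3 \<open>1 \<le> v\<close> by (intro mult_right_mono) auto
    also have "\<dots> = int s ^ Suc l0" unfolding v_def by simp
    also have "\<dots> \<le> int s ^ k" using s l0 by (intro power_increasing) auto
    also have "\<dots> = int x + 2" using arg_cong[OF x2, of int] by simp
    finally show "3 * v \<le> int x + 2" .
  qed
  have X: "int x = int r ^ i" "int x + 1 = int s ^ k - 1"
    using arg_cong[OF x2, of int] unfolding x_def by auto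
  have Y: "int r ^ j + 2 = int s ^ l" using arg_cong[OF eq2, of int] by simp
  have "int x + 1 dvd int r ^ j - (-1) ^ f * u"
    unfolding X(1) f_def j0_def u_def by (rule power_mod_dvd_plus)
  moreover have "int x + 1 dvd int s ^ l - v"
    unfolding X(2) l0_def v_def by (rule power_mod_dvd_minus)
  ultimately have "int x + 1 dvd (int s ^ l - v) - (int r ^ j - (-1) ^ f * u)" by (rule dvd_diff[rotated])
  then have d: "int x + 1 dvd 2 - v + (-1) ^ f * u" unfolding Y[symmetric] by (simp add: algebra_simps)
  show False
  proof (cases "even f")
    case True
    then have d': "int x + 1 dvd 2 - v + u" using d by simp
    have uv: "u + 2 = v"
    proof (rule ccontr)
      assume "u + 2 \<noteq> v"
      then have "\<bar>int x + 1\<bar> \<le> \<bar>2 - v + u\<bar>" using d' by (intro dvd_imp_le_int) auto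
      then show False using u v x3 by linarith
    qed
    then have uv': "r ^ j0 + 2 = s ^ l0"
    proof -
      have "int (r ^ j0 + 2) = int (s ^ l0)" using uv unfolding u_def v_def by simp
      then show ?thesis by (simp only: of_nat_eq_iff)
    qed
    \<comment> \<open>Minimality leaves only the interfering equation \<open>r ^ 0 + 2 = 3\<close>.
      Then \<open>s = 3\<close>, and \<open>r ^ j\<close>, an even power of \<open>x\<close>, is a
      square that lies 2 below a power of 3.\<close>
    then have "j0 = 0" using minimal[of j0 l0] j0 by auto
    then have "s ^ l0 = 3" using uv' by simp
    then have "s dvd 3" by (metis dvd_power gr0I power_0 one_eq_numeral_iff semiring_norm(84))
    then have "s = 3" using s3 dvd_imp_le[of s 3] by simp
    obtain g where g: "f = 2 * g" using True by (auto simp: dvd_def)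
    have "g \<noteq> 0" using j_eq g \<open>j0 = 0\<close> ij by auto
    have "r ^ j = (x ^ g)\<^sup>2"
      unfolding j_eq \<open>j0 = 0\<close> g x_def by (simp add: power_mult[symmetric] mult_ac)
    then have "(x ^ g)\<^sup>2 + 2 = 3 ^ l" using eq2 \<open>s = 3\<close> by simp
    then have "x ^ g \<le> 5" using square_plus_two_power_of_three \<open>odd x\<close> by simp
    moreover have "x ^ 1 \<le> x ^ g" using x3 \<open>g \<noteq> 0\<close> by (intro power_increasing) auto
    ultimately have "x \<le> 5" by simp
    then have "x = 3 \<or> x = 5" using \<open>odd x\<close> x3 by (cases "x = 4") auto
    then have "3 ^ k = (5::nat) \<or> 3 ^ k = (7::nat)" using x2 \<open>s = 3\<close> by auto
    moreover have "3 dvd (3::nat) ^ k" using pos by simp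
    ultimately show False by auto
  next
    case False
    then have d': "int x + 1 dvd 2 - v - u" using d by simp
    have "u + v = 2"
    proof (rule ccontr)
      assume "u + v \<noteq> 2"
      then have "\<bar>int x + 1\<bar> \<le> \<bar>2 - v - u\<bar>" using d' by (intro dvd_imp_le_int) auto
      then show False using u v x3 by linarith
    qed
    then have "u = 1" "v = 1" using u v by auto
    then have "j0 = 0" "l0 = 0" unfolding u_def v_def using r s int_power_eq_1 by blast+
    then have yx: "r ^ j = x ^ f" "s ^ l = (x + 2) ^ e"
      unfolding j_eq l_eq x_def x2[unfolded x_def] by (auto simp: power_mult)
    have "e \<noteq> 0" "e \<noteq> 1" using l_eq kl pos \<open>l0 = 0\<close> by auto
    then show False using no_gap_two_power_solution[of x f e] \<open>odd x\<close> False eq2 yx by simp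
  qed
qed

theorem no_dependent_pairs_gap_two:
  assumes "2 \<le> x" "x < y" "dependent_pair x y" "dependent_pair (x + 2) (y + 2)"
  shows False
proof -
  obtain r i j where r: "r \<ge> 2" "i > 0" "j > 0" "x = r ^ i" "y = r ^ j"
    using dependent_pair_common_base[OF assms(3)] assms by auto
  obtain s k l where s: "s \<ge> 2" "k > 0" "l > 0" "x + 2 = s ^ k" "y + 2 = s ^ l"
    using dependent_pair_common_base[OF assms(4)] assms by auto
  have ij: "i < j" using assms(2) r power_eq_power_imp_exponent_less by metis
  define P where "P i \<longleftrightarrow> 0 < i \<and> (\<exists>k. r ^ i + 2 = s ^ k)" for i
  \<comment> \<open>The least exponent may be smaller than \<open>i\<close>, but \<open>j\<close>
    still exceeds it and provides the second solution.\<close>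
  define i0 where "i0 = (LEAST i. P i)"
  have "P i" unfolding P_def using r s by metis
  then have i0: "P i0" "i0 \<le> i" unfolding i0_def by (auto intro: LeastI Least_le)
  then obtain k0 where k0: "r ^ i0 + 2 = s ^ k0" unfolding P_def by blast
  have "k0 > 0" using k0 by (cases k0) auto
  have "r ^ j + 2 = s ^ l" using r(5) s(5) by simp
  moreover have "0 < i0" using i0(1) unfolding P_def by blast
  moreover have "i0 < j" using i0(2) ij by simp
  ultimately show False
  proof (intro no_second_gap_two[OF r(1) s(1) _ \<open>k0 > 0\<close> _ k0])
    show "r ^ i' + 2 \<noteq> s ^ k'" if "0 < i'" "i' < i0" for i' k'
      using not_less_Least[of i' P] that unfolding i0_def P_def by blast
  qed
qed

section \<open>Relations of bounded size and dependent logarithms\<close>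

text \<open>Fraction-free elimination: a pivot \<open>x j p0\<close> reduces the system to 2 by 2
  minors in the remaining unknowns, bounded by \<open>2 * V\<^sup>2\<close>. With
  \<open>z = 2 * n * V\<close> the new bound is at most
  \<open>z * (z\<^sup>2) ^ (3 ^ (n - 1))\<close>, which \<open>z ^ (3 ^ n)\<close> dominates. The
  equations, indexed by \<open>p\<close>, may be infinitely many (they will come from the primes),
  since each elimination singles out just one of them.\<close>

lemma bounded_integer_relation:
  fixes I :: "nat set" and x :: "nat \<Rightarrow> 'p \<Rightarrow> int" and k :: "nat \<Rightarrow> int" and V :: int
  assumes "finite I" "card I = n" "V \<ge> 1" "\<And>i p. i \<in> I \<Longrightarrow> \<bar>x i p\<bar> \<le> V"
    and "\<exists>i\<in>I. k i \<noteq> 0" "\<And>p. (\<Sum>i\<in>I. k i * x i p) = 0"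
  shows "\<exists>k'. (\<exists>i\<in>I. k' i \<noteq> 0) \<and> (\<forall>i\<in>I. \<bar>k' i\<bar> \<le> (2 * int n * V) ^ (3 ^ n)) \<and> (\<forall>p. (\<Sum>i\<in>I. k' i * x i p) = 0)"
  using assms
proof (induction I arbitrary: n V x k rule: finite_induct)
  case (insert j I)
  have n: "n = Suc (card I)" using insert by simp
  define B where "B = (2 * int (card I) * (2 * V\<^sup>2)) ^ (3 ^ card I)"
  have big: "(1::int) \<le> (2 * int n * V) ^ (3 ^ n)"
  proof (rule one_le_power)
    have "1 * 1 \<le> 2 * int n * V" using insert.prems(2) n by (intro mult_mono) auto
    then show "1 \<le> 2 * int n * V" by simp
  qed
  show ?case
  proof (cases "\<forall>p. x j p = 0")
    case True
    then show ?thesis using insert.hyps big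
      by (intro exI[of _ "\<lambda>i. if i = j then 1 else 0"]) (auto intro!: sum.neutral)
  next
    case False
    then obtain p0 where p0: "x j p0 \<noteq> 0" by blast
    define y where "y i p = x j p0 * x i p - x i p0 * x j p" for i p
    have rel: "(\<Sum>i\<in>I. k i * x i p) = - k j * x j p" for p
      using insert.prems(5)[of p] insert.hyps by simp
    have kI: "\<exists>i\<in>I. k i \<noteq> 0"
    proof (rule ccontr)
      assume neg: "\<not> ?thesis"
      then have "k j * x j p0 = 0" using rel[of p0] by simp
      then have "k j = 0" using p0 by simp
      then show False using insert.prems(4) neg by auto
    qed
    have sum_y: "(\<Sum>i\<in>I. h i * y i p) = x j p0 * (\<Sum>i\<in>I. h i * x i p) - (\<Sum>i\<in>I. h i * x i p0) * x j p" for h p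
      unfolding y_def by (simp add: algebra_simps sum_subtractf sum_distrib_left sum_distrib_right)
    have y0: "(\<Sum>i\<in>I. k i * y i p) = 0" for p
      unfolding sum_y rel by (simp add: algebra_simps)
    have y_le: "\<bar>y i p\<bar> \<le> 2 * V\<^sup>2" if "i \<in> I" for i p
    proof -
      have "\<bar>x j p0 * x i p\<bar> \<le> V * V" "\<bar>x i p0 * x j p\<bar> \<le> V * V"
        unfolding abs_mult using insert.prems(2,3) that by (auto intro!: mult_mono)
      then show ?thesis unfolding y_def power2_eq_square by linarith
    qed
    have V2: "2 * V\<^sup>2 \<ge> 1" using one_le_power[OF insert.prems(2), of 2] by linarith
    obtain h where "(\<exists>i\<in>I. h i \<noteq> 0) \<and> (\<forall>i\<in>I. \<bar>h i\<bar> \<le> B) \<and> (\<forall>p. (\<Sum>i\<in>I. h i * y i p) = 0)"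
      using insert.IH[OF refl V2 y_le kI y0] unfolding B_def by (rule exE)
    then have h: "\<exists>i\<in>I. h i \<noteq> 0" "\<forall>i\<in>I. \<bar>h i\<bar> \<le> B" "\<forall>p. (\<Sum>i\<in>I. h i * y i p) = 0"
      by auto
    have B0: "0 \<le> B" using h(1,2) by fastforce
    \<comment> \<open>After scaling the other coefficients by the pivot, equation \<open>p0\<close>
      dictates the coefficient \<open>- S\<close> at \<open>j\<close>.\<close>
    define S where "S = (\<Sum>i\<in>I. h i * x i p0)"
    have S: "\<bar>S\<bar> \<le> int (card I) * (B * V)"
    proof -
      have "\<bar>S\<bar> \<le> (\<Sum>i\<in>I. \<bar>h i * x i p0\<bar>)" unfolding S_def by (rule sum_abs)
      also have "\<dots> \<le> (\<Sum>i\<in>I. B * V)"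
        unfolding abs_mult using h(2) insert.prems(3) B0 by (intro sum_mono mult_mono) auto
      finally show ?thesis by simp
    qed
    have bound: "int n * V * B \<le> (2 * int n * V) ^ (3 ^ n)"
    proof -
      define z where "z = 2 * int n * V"
      have z1: "1 \<le> z" unfolding z_def using insert.prems(2) n mult_mono[of 1 "2 * int n" 1 V] by simp
      have "B \<le> (z\<^sup>2) ^ (3 ^ card I)"
        unfolding B_def
      proof (rule power_mono)
        have "int (card I) * (4 * V\<^sup>2) \<le> (int n * int n) * (4 * V\<^sup>2)"
          unfolding n by (intro mult_right_mono) (auto simp: algebra_simps)
        then show "2 * int (card I) * (2 * V\<^sup>2) \<le> z\<^sup>2"
          unfolding z_def by (simp add: power2_eq_square algebra_simps)
      qed simp
      also have "\<dots> = z ^ (2 * 3 ^ card I)" by (simp add: power_mult)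
      finally have "int n * V * B \<le> z * z ^ (2 * 3 ^ card I)"
        using insert.prems(2) B0 by (intro mult_mono) (auto simp: z_def)
      also have "\<dots> = z ^ (1 + 2 * 3 ^ card I)" by simp
      also have "\<dots> \<le> z ^ (3 ^ n)"
        using z1 by (intro power_increasing) (auto simp: n)
      finally show ?thesis unfolding z_def .
    qed
    have VB: "0 \<le> V * B" using B0 insert.prems(2) by simp
    define h' where "h' i = (if i = j then - S else x j p0 * h i)" for i
    have h'I: "i \<noteq> j" if "i \<in> I" for i using that insert.hyps by auto
    show ?thesis
    proof (intro exI[of _ h'] conjI ballI allI)
      show "\<exists>i\<in>insert j I. h' i \<noteq> 0"
        using h(1) p0 h'I unfolding h'_def by auto
      fix i assume i: "i \<in> insert j I"
      have "\<bar>h' i\<bar> \<le> int n * V * B"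
      proof (cases "i = j")
        case True
        have "int (card I) * (B * V) \<le> int n * V * B" using VB n by (simp add: algebra_simps)
        then show ?thesis using S True unfolding h'_def by simp
      next
        case False
        then have "\<bar>x j p0 * h i\<bar> \<le> V * B"
          unfolding abs_mult using i insert.prems(2,3) h(2) by (intro mult_mono) auto
        also have "\<dots> \<le> int n * V * B"
          using mult_right_mono[OF _ VB, of 1 "int n"] n by (simp add: mult.assoc)
        finally show ?thesis using False unfolding h'_def by simp
      qed
      also note bound
      finally show "\<bar>h' i\<bar> \<le> (2 * int n * V) ^ (3 ^ n)" .
    next
      fix p
      have "(\<Sum>i\<in>insert j I. h' i * x i p) = - S * x j p + (\<Sum>i\<in>I. x j p0 * (h i * x i p))"
        using insert.hyps h'I unfolding h'_def by (simp add: mult.assoc cong: sum.cong)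
      also have "\<dots> = (\<Sum>i\<in>I. h i * y i p)"
        unfolding sum_y S_def by (simp add: sum_distrib_left)
      finally show "(\<Sum>i\<in>insert j I. h' i * x i p) = 0" using h(3) by simp
    qed
  qed
qed simp

text \<open>Unique factorization turns a relation over the reals into an integer linear system:
  collecting positive and negative exponents in \<open>A\<close> and \<open>B\<close>, the relation
  says \<open>A = B\<close>.\<close>

lemma log_relation_iff_multiplicity:
  fixes \<alpha> :: "nat \<Rightarrow> nat" and k :: "nat \<Rightarrow> int"
  assumes "finite I" "\<And>i. i \<in> I \<Longrightarrow> \<alpha> i \<ge> 1"
  shows "(\<Sum>i\<in>I. real_of_int (k i) * ln (real (\<alpha> i))) = 0 \<longleftrightarrow>
    (\<forall>p. prime p \<longrightarrow> (\<Sum>i\<in>I. k i * int (multiplicity p (\<alpha> i))) = 0)"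
proof -
  define A where "A = (\<Prod>i\<in>I. \<alpha> i ^ nat (k i))"
  define B where "B = (\<Prod>i\<in>I. \<alpha> i ^ nat (- k i))"
  have pos: "A > 0" "B > 0" unfolding A_def B_def using assms by (auto intro!: prod_pos simp: Suc_le_eq)
  have ln_prod': "ln (real (\<Prod>i\<in>I. \<alpha> i ^ e i)) = (\<Sum>i\<in>I. real (e i) * ln (real (\<alpha> i)))" for e
  proof -
    have "ln (\<Prod>i\<in>I. real (\<alpha> i) ^ e i) = (\<Sum>i\<in>I. ln (real (\<alpha> i) ^ e i))"
      using assms by (intro ln_prod) (force simp: Suc_le_eq)+
    also have "\<dots> = (\<Sum>i\<in>I. real (e i) * ln (real (\<alpha> i)))"
      using assms by (intro sum.cong refl) (auto intro!: ln_realpow simp: Suc_le_eq)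
    finally show ?thesis by simp
  qed
  have k_eq: "real_of_int (k i) = real (nat (k i)) - real (nat (- k i))" for i by simp
  have "(\<Sum>i\<in>I. real_of_int (k i) * ln (real (\<alpha> i))) = ln (real A) - ln (real B)"
    unfolding A_def B_def ln_prod' k_eq by (simp add: left_diff_distrib sum_subtractf)
  then have 1: "(\<Sum>i\<in>I. real_of_int (k i) * ln (real (\<alpha> i))) = 0 \<longleftrightarrow> A = B"
    using pos by simp
  have mult: "multiplicity p (\<Prod>i\<in>I. \<alpha> i ^ e i) = (\<Sum>i\<in>I. e i * multiplicity p (\<alpha> i))" if "prime p" for p e
  proof -
    have "multiplicity p (\<Prod>i\<in>I. \<alpha> i ^ e i) = (\<Sum>i\<in>I. multiplicity p (\<alpha> i ^ e i))"
      using assms that by (intro prime_elem_multiplicity_prod_distrib) (auto simp: image_iff Suc_le_eq)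
    also have "\<dots> = (\<Sum>i\<in>I. e i * multiplicity p (\<alpha> i))"
      using assms that by (intro sum.cong refl prime_elem_multiplicity_power_distrib) (auto simp: Suc_le_eq)
    finally show ?thesis .
  qed
  have "A = B \<longleftrightarrow> (\<forall>p. prime p \<longrightarrow> multiplicity p A = multiplicity p B)"
    using pos multiplicity_eq_nat[of A B] by auto
  also have "\<dots> \<longleftrightarrow> (\<forall>p. prime p \<longrightarrow> (\<Sum>i\<in>I. k i * int (multiplicity p (\<alpha> i))) = 0)"
  proof -
    have "multiplicity p A = multiplicity p B \<longleftrightarrow> (\<Sum>i\<in>I. k i * int (multiplicity p (\<alpha> i))) = 0"
      if "prime p" for p
    proof -
      have k_eq: "k i = int (nat (k i)) - int (nat (- k i))" for i by simp
      have "(\<Sum>i\<in>I. k i * int (multiplicity p (\<alpha> i))) = int (multiplicity p A) - int (multiplicity p B)"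
        unfolding A_def B_def mult[OF that] by (subst k_eq) (simp add: left_diff_distrib sum_subtractf)
      then show ?thesis by auto
    qed
    then show ?thesis by blast
  qed
  finally show ?thesis using 1 by simp
qed

lemma multiplicity_le_log:
  fixes p a :: nat
  assumes "prime p" "a \<ge> 1" "ln (real a) \<le> real X"
  shows "multiplicity p a \<le> 2 * X"
proof -
  have "p ^ multiplicity p a dvd a" by (rule multiplicity_dvd)
  then have "p ^ multiplicity p a \<le> a" using assms by (intro dvd_imp_le) auto
  moreover have "2 ^ multiplicity p a \<le> p ^ multiplicity p a"
    using prime_ge_2_nat[OF assms(1)] by (intro power_mono) auto
  ultimately have "real (2 ^ multiplicity p a) \<le> real a" by linarith
  then have "ln (real (2 ^ multiplicity p a)) \<le> ln (real a)"
    using assms(2) by (subst ln_le_cancel_iff) auto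
  then have "real (multiplicity p a) * ln 2 \<le> real X" using assms(3) by (simp add: ln_realpow)
  moreover have "real (multiplicity p a) * (1 / 2) \<le> real (multiplicity p a) * ln 2"
    using ln2_ge_two_thirds by (intro mult_left_mono) auto
  ultimately show ?thesis by linarith
qed

lemma bounded_log_relation:
  fixes \<alpha> :: "nat \<Rightarrow> nat" and k :: "nat \<Rightarrow> int"
  assumes "finite I" "card I = n" "\<And>i. i \<in> I \<Longrightarrow> \<alpha> i \<ge> 1" "\<And>i. i \<in> I \<Longrightarrow> ln (real (\<alpha> i)) \<le> real X" "X \<ge> 1"
    and "\<exists>i\<in>I. k i \<noteq> 0" "(\<Sum>i\<in>I. real_of_int (k i) * ln (real (\<alpha> i))) = 0"
  shows "\<exists>k'. (\<exists>i\<in>I. k' i \<noteq> 0) \<and> (\<forall>i\<in>I. \<bar>k' i\<bar> \<le> int ((4 * n * X) ^ (3 ^ n))) \<and>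
    (\<Sum>i\<in>I. real_of_int (k' i) * ln (real (\<alpha> i))) = 0"
proof -
  define x where "x i p = (if prime p then int (multiplicity p (\<alpha> i)) else 0)" for i p
  have x_le: "\<bar>x i p\<bar> \<le> int (2 * X)" if "i \<in> I" for i p
    using multiplicity_le_log[of p "\<alpha> i" X] assms(3,4)[OF that] unfolding x_def by auto
  have X1: "int (2 * X) \<ge> 1" using assms(5) by simp
  have "(\<Sum>i\<in>I. k i * x i p) = 0" for p
    using assms(7) log_relation_iff_multiplicity[where I = I and \<alpha> = \<alpha> and k = k, OF assms(1,3)] unfolding x_def by (cases "prime p") auto
  from bounded_integer_relation[OF assms(1,2) X1 x_le assms(6) this]
  obtain k' where "(\<exists>i\<in>I. k' i \<noteq> 0) \<and> (\<forall>i\<in>I. \<bar>k' i\<bar> \<le> (2 * int n * int (2 * X)) ^ (3 ^ n)) \<and>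
    (\<forall>p. (\<Sum>i\<in>I. k' i * x i p) = 0)" by (rule exE)
  then have k': "\<exists>i\<in>I. k' i \<noteq> 0" "\<forall>i\<in>I. \<bar>k' i\<bar> \<le> (2 * int n * int (2 * X)) ^ (3 ^ n)"
    "\<forall>p. (\<Sum>i\<in>I. k' i * x i p) = 0" by auto
  show ?thesis
  proof (intro exI[of _ k'] conjI k'(1))
    have "(2 * int n * int (2 * X)) = int (4 * n * X)" by simp
    then show "\<forall>i\<in>I. \<bar>k' i\<bar> \<le> int ((4 * n * X) ^ (3 ^ n))" using k'(2) by (simp only: of_nat_power)
    have "(\<Sum>i\<in>I. k' i * int (multiplicity p (\<alpha> i))) = 0" if "prime p" for p
      using k'(3)[rule_format, of p] that unfolding x_def by simp
    then show "(\<Sum>i\<in>I. real_of_int (k' i) * ln (real (\<alpha> i))) = 0"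
      using log_relation_iff_multiplicity[where I = I and \<alpha> = \<alpha> and k = k', OF assms(1,3)] by blast
  qed
qed


section \<open>Lower bounds for forms in possibly dependent logarithms\<close>

lemma nat_power_le_exp: "real ((c * X) ^ e) \<le> exp (real (c * e * X))"
proof -
  have "real (c * X) ^ e \<le> exp (real e * real (c * X))"
    by (rule exp_bound_power) (auto intro: le_exp_self)
  then show ?thesis by (simp add: mult_ac)
qed

lemma power_add_le_power_Suc:
  fixes a b c :: nat
  assumes "a \<ge> 1" "b \<ge> 1" shows "a ^ c + b \<le> (a + b) ^ Suc c"
proof -
  have "a ^ c * 1 + b * 1 \<le> a ^ c * a + b * (a + b) ^ c"
    using assms by (intro add_mono mult_le_mono) auto
  also have "\<dots> \<le> (a + b) ^ c * a + b * (a + b) ^ c"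
    by (intro add_mono mult_le_mono power_mono) auto
  finally show ?thesis by (simp add: algebra_simps)
qed

text \<open>Nonvanishing of the form takes the place of independence. One constant serves as factor
  and as exponent, since only polynomial dependence on \<open>X\<close> matters.\<close>

definition lower_bound_constant :: "nat \<Rightarrow> nat \<Rightarrow> bool" where
  "lower_bound_constant n C \<longleftrightarrow> (\<forall>I \<alpha> (b :: nat \<Rightarrow> int) X. finite I \<longrightarrow> card I = n \<longrightarrow> (\<forall>i\<in>I. \<alpha> i \<ge> 2) \<longrightarrow> X \<ge> 1 \<longrightarrow>
     (\<forall>i\<in>I. ln (real (\<alpha> i)) \<le> real X) \<longrightarrow> (\<forall>i\<in>I. 2 * \<bar>real_of_int (b i)\<bar> \<le> exp (real X)) \<longrightarrow>
     (\<Sum>i\<in>I. real_of_int (b i) * ln (real (\<alpha> i))) \<noteq> 0 \<longrightarrow>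
     exp (- real ((C * X) ^ C)) \<le> \<bar>\<Sum>i\<in>I. real_of_int (b i) * ln (real (\<alpha> i))\<bar>)"

lemma lower_bound_constantD:
  fixes I :: "nat set" and \<alpha> :: "nat \<Rightarrow> nat" and b :: "nat \<Rightarrow> int"
  assumes "lower_bound_constant n C" "finite I" "card I = n" "\<And>i. i \<in> I \<Longrightarrow> \<alpha> i \<ge> 2" "X \<ge> 1"
    "\<And>i. i \<in> I \<Longrightarrow> ln (real (\<alpha> i)) \<le> real X" "\<And>i. i \<in> I \<Longrightarrow> 2 * \<bar>real_of_int (b i)\<bar> \<le> exp (real X)"
    "(\<Sum>i\<in>I. real_of_int (b i) * ln (real (\<alpha> i))) \<noteq> 0"
  shows "exp (- real ((C * X) ^ C)) \<le> \<bar>\<Sum>i\<in>I. real_of_int (b i) * ln (real (\<alpha> i))\<bar>"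
  by (rule assms(1)[unfolded lower_bound_constant_def, rule_format, of I \<alpha> X b]) (use assms in auto)

text \<open>For dependent logarithms, a relation with small coefficients and
  \<open>k j \<noteq> 0\<close> removes \<open>\<alpha> j\<close>: \<open>k j * form\<close> is a
  form in one logarithm fewer, whose coefficients are bounded by the exponential of a multiple of
  \<open>X\<close>, and induction applies.\<close>

theorem linear_form_lower_bound_dependent: "\<exists>C. lower_bound_constant n C"
proof (induction n)
  case 0
  show ?case unfolding lower_bound_constant_def by (intro exI[of _ 0]) auto
next
  case (Suc n)
  then obtain C0 where C0: "lower_bound_constant n C0" by blast
  define N where "N = Suc n"
  \<comment> \<open>\<open>D * X\<close> bounds the logarithm of twice a new coefficient:
    \<open>4 * N * 3 ^ N * X\<close> for the relation, \<open>X\<close> for \<open>b\<close>, and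
    \<open>X\<close> for a remaining factor 2.\<close>
  define D where "D = 4 * N * 3 ^ N + 2"
  define E where "E = 15 * N\<^sup>2 + 15 * N + 19"
  define C where "C = 100 * N ^ 3 + E + (C0 * D + 1) + D + Suc C0"
  have "lower_bound_constant N C"
    unfolding lower_bound_constant_def
  proof (intro allI impI)
    fix I :: "nat set" and \<alpha> :: "nat \<Rightarrow> nat" and b :: "nat \<Rightarrow> int" and X :: nat
    assume I: "finite I" "card I = N" and \<alpha>: "\<forall>i\<in>I. \<alpha> i \<ge> 2" and X: "X \<ge> 1"
      and ln_\<alpha>: "\<forall>i\<in>I. ln (real (\<alpha> i)) \<le> real X" and b_le: "\<forall>i\<in>I. 2 * \<bar>real_of_int (b i)\<bar> \<le> exp (real X)"
      and nz: "(\<Sum>i\<in>I. real_of_int (b i) * ln (real (\<alpha> i))) \<noteq> 0"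
    define form where "form = (\<Sum>i\<in>I. real_of_int (b i) * ln (real (\<alpha> i)))"
    have CX: "C * X \<ge> 1" using X unfolding C_def by simp
    have "exp (- real ((C * X) ^ C)) \<le> \<bar>form\<bar>"
    proof (cases "\<forall>k :: nat \<Rightarrow> int. (\<Sum>i\<in>I. real_of_int (k i) * ln (real (\<alpha> i))) = 0 \<longrightarrow> (\<forall>i\<in>I. k i = 0)")
      case True
      define X' where "X' = 100 * N ^ 3 * X"
      have X': "X \<le> X'" "100 * N ^ 3 \<le> X'" unfolding X'_def N_def using X by auto
      have "exp (- real (X' ^ E)) \<le> \<bar>form\<bar>"
        unfolding form_def E_def
      proof (rule linear_form_lower_bound[OF I])
        show "\<exists>i\<in>I. b i \<noteq> 0" using nz by (metis (no_types, lifting) mult_eq_0_iff of_int_0 sum.neutral)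
        show "ln (real (\<alpha> i)) \<le> real X'" if "i \<in> I" for i
          using ln_\<alpha> X'(1) that by (meson of_nat_le_iff order_trans)
        show "2 * \<bar>real_of_int (b i)\<bar> \<le> exp (real X')" if "i \<in> I" for i
        proof -
          have "exp (real X) \<le> exp (real X')" using X'(1) by simp
          then show ?thesis using b_le[rule_format, OF that] by linarith
        qed
      qed (use True \<alpha> X' in auto)
      moreover have "X' ^ E \<le> (C * X) ^ C"
      proof -
        have "X' ^ E \<le> (C * X) ^ E" unfolding X'_def C_def by (intro power_mono mult_le_mono) auto
        also have "\<dots> \<le> (C * X) ^ C" using CX by (intro power_increasing) (auto simp: C_def)
        finally show ?thesis .
      qed
      then have "exp (- real ((C * X) ^ C)) \<le> exp (- real (X' ^ E))" by (simp only: exp_le_cancel_iff neg_le_iff_le of_nat_le_iff)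
      ultimately show ?thesis by linarith
    next
      case False
      then obtain k0 :: "nat \<Rightarrow> int" where k0: "(\<Sum>i\<in>I. real_of_int (k0 i) * ln (real (\<alpha> i))) = 0" "\<exists>i\<in>I. k0 i \<noteq> 0"
        by blast
      define B where "B = (4 * N * X) ^ (3 ^ N)"
      have \<alpha>1: "\<alpha> i \<ge> 1" if "i \<in> I" for i using \<alpha>[rule_format, OF that] by simp
      obtain k where "(\<exists>i\<in>I. k i \<noteq> 0) \<and> (\<forall>i\<in>I. \<bar>k i\<bar> \<le> int B) \<and>
          (\<Sum>i\<in>I. real_of_int (k i) * ln (real (\<alpha> i))) = 0"
        using bounded_log_relation[of I N \<alpha> X k0, OF I \<alpha>1 ln_\<alpha>[rule_format] X k0(2,1)]
        unfolding B_def by (rule exE)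
      then have k: "\<exists>i\<in>I. k i \<noteq> 0" "\<And>i. i \<in> I \<Longrightarrow> \<bar>k i\<bar> \<le> int B"
        "(\<Sum>i\<in>I. real_of_int (k i) * ln (real (\<alpha> i))) = 0" by auto
      obtain j where j: "j \<in> I" "k j \<noteq> 0" using k(1) by blast
      define X' where "X' = D * X"
      have B_exp: "real B \<le> exp (real (4 * N * 3 ^ N * X))" unfolding B_def by (rule nat_power_le_exp)
      define b' where "b' i = k j * b i - b j * k i" for i
      have form': "(\<Sum>i\<in>I - {j}. real_of_int (b' i) * ln (real (\<alpha> i))) = real_of_int (k j) * form"
      proof -
        have "(\<Sum>i\<in>I - {j}. real_of_int (b' i) * ln (real (\<alpha> i))) = (\<Sum>i\<in>I. real_of_int (b' i) * ln (real (\<alpha> i)))"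
          using I(1) j(1) by (subst sum.remove[of I j]) (auto simp: b'_def)
        also have "\<dots> = real_of_int (k j) * form - real_of_int (b j) * (\<Sum>i\<in>I. real_of_int (k i) * ln (real (\<alpha> i)))"
          unfolding form_def b'_def by (simp add: algebra_simps sum_subtractf sum_distrib_left)
        finally show ?thesis using k(3) by simp
      qed
      have b'_le: "2 * \<bar>real_of_int (b' i)\<bar> \<le> exp (real X')" if "i \<in> I - {j}" for i
      proof -
        have kB: "\<bar>real_of_int (k i)\<bar> \<le> real B" if "i \<in> I" for i
          using k(2)[OF that] by (metis of_int_abs of_int_le_iff of_int_of_nat_eq)
        have "\<bar>real_of_int (b' i)\<bar> \<le> \<bar>real_of_int (k j) * real_of_int (b i)\<bar> + \<bar>real_of_int (b j) * real_of_int (k i)\<bar>"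
          unfolding b'_def by (simp add: abs_triangle_ineq4)
        also have "\<dots> \<le> real B * (exp (real X) / 2) + (exp (real X) / 2) * real B"
          unfolding abs_mult using kB j that b_le by (intro add_mono mult_mono) auto
        finally have "2 * \<bar>real_of_int (b' i)\<bar> \<le> 2 * (real B * exp (real X))" by simp
        also have "\<dots> \<le> exp (real X) * (exp (real (4 * N * 3 ^ N * X)) * exp (real X))"
        proof (intro mult_mono)
          have "1 + real X \<le> exp (real X)" by (rule exp_ge_add_one_self)
          then show "2 \<le> exp (real X)" using X by linarith
        qed (use B_exp in auto)
        also have "\<dots> = exp (real X')" unfolding X'_def D_def by (simp add: exp_add[symmetric] algebra_simps)
        finally show ?thesis .
      qed
      have "exp (- real ((C0 * X') ^ C0)) \<le> \<bar>real_of_int (k j) * form\<bar>"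
        unfolding form'[symmetric]
      proof (rule lower_bound_constantD[OF C0])
        show "card (I - {j}) = n" using I j by (simp add: N_def)
        show "X' \<ge> 1" unfolding X'_def D_def using X by simp
        show "ln (real (\<alpha> i)) \<le> real X'" if "i \<in> I - {j}" for i
        proof -
          have "X \<le> X'" unfolding X'_def D_def by simp
          then show ?thesis using ln_\<alpha> that by (meson DiffD1 of_nat_le_iff order_trans)
        qed
        show "(\<Sum>i\<in>I - {j}. real_of_int (b' i) * ln (real (\<alpha> i))) \<noteq> 0"
          unfolding form' using j nz form_def by simp
      qed (use I \<alpha> b'_le in auto)
      also have "\<dots> \<le> exp (real X') * \<bar>form\<bar>"
      proof -
        have "\<bar>real_of_int (k j)\<bar> \<le> real B"
          using k(2)[OF j(1)] by (metis of_int_abs of_int_le_iff of_int_of_nat_eq)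
        also have "\<dots> \<le> exp (real X')"
          using B_exp unfolding X'_def D_def by (rule order_trans) simp
        finally show ?thesis unfolding abs_mult by (intro mult_right_mono) auto
      qed
      finally have "exp (- real X') * exp (- real ((C0 * X') ^ C0)) \<le> exp (- real X') * (exp (real X') * \<bar>form\<bar>)"
        by (intro mult_left_mono) auto
      then have low: "exp (- real (X' + (C0 * X') ^ C0)) \<le> \<bar>form\<bar>"
        by (simp add: exp_add[symmetric] mult.assoc[symmetric])
      have "X' + (C0 * X') ^ C0 \<le> (C * X) ^ C"
      proof -
        have X'1: "X' \<ge> 1" unfolding X'_def D_def using X by simp
        have "(C0 * X') ^ C0 \<le> (C0 * X' + 1) ^ C0" by (intro power_mono) auto
        then have "X' + (C0 * X') ^ C0 \<le> (C0 * X' + 1) ^ C0 + X'" by simp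
        also have "\<dots> \<le> (C0 * X' + 1 + X') ^ Suc C0" using X'1 by (intro power_add_le_power_Suc) auto
        also have "\<dots> \<le> (C * X) ^ Suc C0"
        proof (intro power_mono)
          have "C0 * X' + 1 + X' \<le> (C0 * D + 1 + D) * X" unfolding X'_def using X by (simp add: algebra_simps)
          also have "\<dots> \<le> C * X" unfolding C_def by (intro mult_le_mono) auto
          finally show "C0 * X' + 1 + X' \<le> C * X" .
        qed simp
        also have "\<dots> \<le> (C * X) ^ C" using CX by (intro power_increasing) (auto simp: C_def)
        finally show ?thesis .
      qed
      then have "exp (- real ((C * X) ^ C)) \<le> exp (- real (X' + (C0 * X') ^ C0))"
        by (simp only: exp_le_cancel_iff neg_le_iff_le of_nat_le_iff)
      then show ?thesis using low by linarith
    qed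
    then show "exp (- real ((C * X) ^ C)) \<le> \<bar>\<Sum>i\<in>I. real_of_int (b i) * ln (real (\<alpha> i))\<bar>"
      unfolding form_def .
  qed
  then show ?case unfolding N_def by blast
qed

section \<open>Bounds for dependent triples\<close>

lemma odd_ge_2_prime_factor:
  fixes n :: nat
  assumes "odd n" "n \<ge> 2"
  obtains p where "prime p" "odd p" "p dvd n"
proof -
  obtain p where p: "prime p" "p dvd n" using prime_factor_nat[of n] assms by auto
  then have "odd p" using assms(1) dvd_trans by blast
  then show thesis using p that by blast
qed

text \<open>A prime of \<open>a + 1\<close> divides neither neighbour, so \<open>p1 = 0\<close>. One
  of \<open>a\<close> and \<open>a + 2\<close> has an odd prime factor, which cannot divide the
  other: for even \<open>a\<close> the halves are consecutive integers above 1, one of them odd. For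
  \<open>a = 2\<close> this fails, as 2 and 4 are dependent.\<close>

lemma consecutive_independent:
  fixes a :: nat and p0 p1 p2 :: int
  assumes a: "a \<ge> 3"
    and rel: "real_of_int p0 * ln (real a) + real_of_int p1 * ln (real (a + 1)) + real_of_int p2 * ln (real (a + 2)) = 0"
  shows "p0 = 0 \<and> p1 = 0 \<and> p2 = 0"
proof -
  define \<alpha> where "\<alpha> i = a + i" for i
  define k where "k i = (if i = 0 then p0 else if i = 1 then p1 else p2)" for i :: nat
  have "(\<Sum>i\<in>{0,1,2}. real_of_int (k i) * ln (real (\<alpha> i))) = 0"
    using rel unfolding \<alpha>_def k_def by (simp add: add_ac)
  moreover have "\<alpha> i \<ge> 1" for i unfolding \<alpha>_def using a by simp
  ultimately have mult: "(\<Sum>i\<in>{0,1,2}. k i * int (multiplicity q (\<alpha> i))) = 0" if "prime q" for q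
    using log_relation_iff_multiplicity[where I = "{0,1,2}" and \<alpha> = \<alpha> and k = k] that by simp
  have m: "p0 * int (multiplicity q a) + p1 * int (multiplicity q (a + 1)) + p2 * int (multiplicity q (a + 2)) = 0"
    if "prime q" for q
    using mult[OF that] unfolding \<alpha>_def k_def by (simp add: add.assoc)
  have nz: "multiplicity q n \<noteq> 0" if "prime q" "q dvd n" "n > 0" for q n :: nat
    using that by (simp add: prime_multiplicity_gt_zero_iff)
  have z: "multiplicity q n = 0" if "\<not> q dvd n" for q n :: nat
    using that by (rule not_dvd_imp_multiplicity_0)
  obtain q where q: "prime q" "q dvd a + 1" using prime_factor_nat[of "a + 1"] a by auto
  have q_ndvd: "\<not> q dvd a" "\<not> q dvd a + 2"
  proof -
    show "\<not> q dvd a" using q by (metis dvd_add_right_iff not_prime_unit)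
    show "\<not> q dvd a + 2"
    proof
      assume "q dvd a + 2"
      then have "q dvd (a + 2) - (a + 1)" using q(2) by (rule dvd_diff_nat)
      then show False using q(1) by simp
    qed
  qed
  have "p1 * int (multiplicity q (a + 1)) = 0" using m[OF q(1)] z q_ndvd by simp
  then have p1: "p1 = 0" using nz[OF q] by simp
  have "(\<exists>r. prime r \<and> odd r \<and> r dvd a) \<or> (\<exists>r. prime r \<and> odd r \<and> r dvd a + 2)"
  proof (cases "odd a")
    case True
    then obtain r where "prime r" "odd r" "r dvd a" using odd_ge_2_prime_factor[of a] a by auto
    then show ?thesis by blast
  next
    case False
    then obtain d where d: "a = 2 * d" by (auto simp: dvd_def)
    have d2: "d \<ge> 2" using d a by simp
    show ?thesis
    proof (cases "odd d")
      case True
      then obtain r where "prime r" "odd r" "r dvd d" using odd_ge_2_prime_factor[of d] d2 by auto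
      then show ?thesis unfolding d using dvd_mult by blast
    next
      case False
      then obtain r where r: "prime r" "odd r" "r dvd d + 1" using odd_ge_2_prime_factor[of "d + 1"] d2 by auto
      have "a + 2 = 2 * (d + 1)" using d by simp
      then have "r dvd a + 2" using r(3) by (metis dvd_mult)
      then show ?thesis using r by blast
    qed
  qed
  then obtain r where r: "prime r" "odd r" "r dvd a \<or> r dvd a + 2" by blast
  have not_both: "\<not> (r dvd a \<and> r dvd a + 2)"
  proof
    assume "r dvd a \<and> r dvd a + 2"
    then have "r dvd 2" by (metis dvd_add_right_iff)
    then have "r = 2" using r(1) by (simp add: primes_dvd_imp_eq)
    then show False using r(2) by simp
  qed
  have pos: "ln (real a) > 0" "ln (real (a + 2)) > 0" using a by auto
  have e: "real_of_int p0 * ln (real a) + real_of_int p2 * ln (real (a + 2)) = 0" using rel p1 by simp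
  have m': "p0 * int (multiplicity r a) + p2 * int (multiplicity r (a + 2)) = 0" using m[OF r(1)] p1 by simp
  show ?thesis
  proof (cases "r dvd a")
    case True
    then have "p0 * int (multiplicity r a) = 0" using m' z[of r "a + 2"] not_both by simp
    then have "p0 = 0" using nz[OF r(1) True] a by simp
    then show ?thesis using e pos p1 by simp
  next
    case False
    then have "p2 * int (multiplicity r (a + 2)) = 0" using m' z[of r a] by simp
    then have "p2 = 0" using nz[OF r(1), of "a + 2"] r(3) False by simp
    then show ?thesis using e pos p1 by simp
  qed
qed

lemma log_relation_dependent_pair:
  fixes x y :: int and X Y :: nat
  assumes "X \<ge> 2" "Y \<ge> 2" "x \<noteq> 0 \<or> y \<noteq> 0" "real_of_int x * ln (real X) + real_of_int y * ln (real Y) = 0"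
  shows "dependent_pair X Y"
proof -
  have pos: "ln (real X) > 0" "ln (real Y) > 0" using assms by auto
  have e: "real_of_int x * ln (real X) = - real_of_int y * ln (real Y)" using assms(4) by simp
  have nz: "x \<noteq> 0" "y \<noteq> 0" using e assms(3) pos by auto
  have "\<bar>real_of_int x\<bar> * ln (real X) = \<bar>real_of_int y\<bar> * ln (real Y)"
    using arg_cong[OF e, of abs] pos by (simp add: abs_mult)
  then have "real (nat \<bar>x\<bar>) * ln (real X) = real (nat \<bar>y\<bar>) * ln (real Y)" by simp
  then have "ln (real X ^ nat \<bar>x\<bar>) = ln (real Y ^ nat \<bar>y\<bar>)"
    using assms by (simp add: ln_realpow)
  then have "real X ^ nat \<bar>x\<bar> = real Y ^ nat \<bar>y\<bar>" using assms by (subst (asm) ln_inj_iff) auto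
  then have "X ^ nat \<bar>x\<bar> = Y ^ nat \<bar>y\<bar>" by (metis of_nat_eq_iff of_nat_power)
  then show ?thesis unfolding dependent_pair_def using nz by (intro exI[of _ "nat \<bar>x\<bar>"] exI[of _ "nat \<bar>y\<bar>"]) auto
qed

text \<open>The cross product of \<open>y\<close> and \<open>z\<close> annihilates both. If it meets
  \<open>x\<close> only in zero products, then two of its entries vanish, as at most one
  \<open>x i\<close> is zero, and the third follows because no row is zero. So \<open>y\<close> and
  \<open>z\<close> are parallel, and the first two rows alone can be combined.\<close>

lemma elimination_vector:
  fixes x y z :: "nat \<Rightarrow> int"
  assumes row: "\<And>i. i < 3 \<Longrightarrow> y i \<noteq> 0 \<or> z i \<noteq> 0"
    and x: "\<And>i j. i < j \<Longrightarrow> j < 3 \<Longrightarrow> x i \<noteq> 0 \<or> x j \<noteq> 0"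
    and H: "\<And>i. i < 3 \<Longrightarrow> \<bar>y i\<bar> \<le> H" "\<And>i. i < 3 \<Longrightarrow> \<bar>z i\<bar> \<le> H" "1 \<le> H"
  shows "\<exists>t0 t1 t2. t0 * y 0 + t1 * y 1 + t2 * y 2 = 0 \<and> t0 * z 0 + t1 * z 1 + t2 * z 2 = 0 \<and>
    (t0 * x 0 \<noteq> 0 \<or> t1 * x 1 \<noteq> 0 \<or> t2 * x 2 \<noteq> 0) \<and>
    \<bar>t0\<bar> \<le> 2 * H\<^sup>2 \<and> \<bar>t1\<bar> \<le> 2 * H\<^sup>2 \<and> \<bar>t2\<bar> \<le> 2 * H\<^sup>2"
proof -
  define t0 t1 t2 where "t0 = y 1 * z 2 - y 2 * z 1" and "t1 = y 2 * z 0 - y 0 * z 2" and "t2 = y 0 * z 1 - y 1 * z 0"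
  have bd: "\<bar>y i * z j - y k * z l\<bar> \<le> 2 * H\<^sup>2" if "i < 3" "j < 3" "k < 3" "l < 3" for i j k l
  proof -
    have "\<bar>y i * z j\<bar> \<le> H * H" "\<bar>y k * z l\<bar> \<le> H * H"
      unfolding abs_mult using H that by (auto intro!: mult_mono)
    then show ?thesis unfolding power2_eq_square by linarith
  qed
  have HH: "H \<le> 2 * H\<^sup>2"
  proof -
    have "H * 1 \<le> H * (2 * H)" using H(3) by (intro mult_left_mono) auto
    then show ?thesis by (simp add: power2_eq_square)
  qed
  show ?thesis
  proof (cases "t0 * x 0 \<noteq> 0 \<or> t1 * x 1 \<noteq> 0 \<or> t2 * x 2 \<noteq> 0")
    case True
    have "t0 * y 0 + t1 * y 1 + t2 * y 2 = 0" "t0 * z 0 + t1 * z 1 + t2 * z 2 = 0"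
      unfolding t0_def t1_def t2_def by algebra+
    moreover have "\<bar>t0\<bar> \<le> 2 * H\<^sup>2" "\<bar>t1\<bar> \<le> 2 * H\<^sup>2" "\<bar>t2\<bar> \<le> 2 * H\<^sup>2"
      unfolding t0_def t1_def t2_def by (rule bd; simp)+
    ultimately show ?thesis using True by blast
  next
    case False
    have x': "x 0 \<noteq> 0 \<or> x 1 \<noteq> 0" "x 0 \<noteq> 0 \<or> x 2 \<noteq> 0" "x 1 \<noteq> 0 \<or> x 2 \<noteq> 0"
      using x[of 0 1] x[of 0 2] x[of 1 2] by auto
    have r: "y 0 \<noteq> 0 \<or> z 0 \<noteq> 0" "y 1 \<noteq> 0 \<or> z 1 \<noteq> 0" "y 2 \<noteq> 0 \<or> z 2 \<noteq> 0"
      using row[of 0] row[of 1] row[of 2] by auto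
    have i0: "t1 = 0 \<Longrightarrow> t2 = 0 \<Longrightarrow> t0 = 0"
    proof -
      assume "t1 = 0" "t2 = 0"
      then have "y 0 * t0 = 0" "z 0 * t0 = 0" unfolding t0_def t1_def t2_def by algebra+
      then show "t0 = 0" using r(1) by auto
    qed
    have i1: "t0 = 0 \<Longrightarrow> t2 = 0 \<Longrightarrow> t1 = 0"
    proof -
      assume "t0 = 0" "t2 = 0"
      then have "y 1 * t1 = 0" "z 1 * t1 = 0" unfolding t0_def t1_def t2_def by algebra+
      then show "t1 = 0" using r(2) by auto
    qed
    have i2: "t0 = 0 \<Longrightarrow> t1 = 0 \<Longrightarrow> t2 = 0"
    proof -
      assume "t0 = 0" "t1 = 0"
      then have "y 2 * t2 = 0" "z 2 * t2 = 0" unfolding t0_def t1_def t2_def by algebra+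
      then show "t2 = 0" using r(3) by auto
    qed
    have "t2 = 0" using False x' i0 i1 i2 by auto
    then have par: "y 0 * z 1 = y 1 * z 0" unfolding t2_def by simp
    show ?thesis
    proof (cases "y 0 = 0")
      case True
      then have "z 0 \<noteq> 0" "y 1 = 0" using r par by auto
      then have "z 1 \<noteq> 0" using r by auto
      then show ?thesis using x'(1) True \<open>y 1 = 0\<close> \<open>z 0 \<noteq> 0\<close> H(2)[of 0] H(2)[of 1] HH
        by (intro exI[of _ "z 1"] exI[of _ "- z 0"] exI[of _ 0]) auto
    next
      case y0: False
      have "y 1 \<noteq> 0"
      proof
        assume "y 1 = 0"
        then have "z 1 = 0" using par y0 by simp
        then show False using r(2) \<open>y 1 = 0\<close> by simp
      qed
      then show ?thesis using x'(1) y0 par H(1)[of 0] H(1)[of 1] HH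
        by (intro exI[of _ "y 1"] exI[of _ "- y 0"] exI[of _ 0]) (auto simp: mult.commute)
    qed
  qed
qed

lemma ln_add_bounds:
  fixes b i :: nat
  assumes "b \<ge> 1" "i \<le> 2"
  shows "0 \<le> ln (real (b + i)) - ln (real b)" "ln (real (b + i)) - ln (real b) \<le> 2 / real b"
proof -
  have "ln (real (b + i)) - ln (real b) = ln (1 + real i / real b)"
  proof -
    have "1 + real i / real b = real (b + i) / real b" using assms by (simp add: field_simps)
    then show ?thesis using assms by (simp add: ln_div)
  qed
  moreover have "ln (1 + real i / real b) \<le> real i / real b" by (rule ln_add_one_self_le_self) simp
  moreover have "real i / real b \<le> 2 / real b" using assms by (simp add: divide_right_mono)
  moreover have "0 \<le> ln (1 + real i / real b)" by simp
  ultimately show "0 \<le> ln (real (b + i)) - ln (real b)" "ln (real (b + i)) - ln (real b) \<le> 2 / real b" by auto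
qed

text \<open>The conditions \<open>a \<ge> 3\<close>, \<open>a \<noteq> 8\<close> and
  \<open>c \<ge> 9\<close> keep the exceptional pair \<open>(2, 8)\<close> away from
  \<open>(a, b)\<close> in either order and from \<open>(b, c)\<close>. The position of
  \<open>a\<close> relative to \<open>b\<close> and \<open>c\<close> is left open.\<close>

locale dependent_triples =
  fixes a b c :: nat and x y z :: "nat \<Rightarrow> int" and H :: nat
  assumes a: "a \<ge> 3" "a \<noteq> 8" and b: "b \<ge> 2" "b \<noteq> a" and bc: "b < c" and c: "c \<ge> 9"
    and nontrivial: "\<And>i. i < 3 \<Longrightarrow> x i \<noteq> 0 \<or> y i \<noteq> 0 \<or> z i \<noteq> 0"
    and rel: "\<And>i. i < 3 \<Longrightarrow> real_of_int (x i) * ln (real (a + i)) + real_of_int (y i) * ln (real (b + i))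
        + real_of_int (z i) * ln (real (c + i)) = 0"
    and H: "\<And>i. i < 3 \<Longrightarrow> \<bar>x i\<bar> \<le> int H" "\<And>i. i < 3 \<Longrightarrow> \<bar>y i\<bar> \<le> int H" "\<And>i. i < 3 \<Longrightarrow> \<bar>z i\<bar> \<le> int H"
begin

lemma row: assumes "i < 3" shows "y i \<noteq> 0 \<or> z i \<noteq> 0"
proof (rule ccontr)
  assume "\<not> ?thesis"
  then have "real_of_int (x i) * ln (real (a + i)) = 0" using rel[OF assms] by simp
  then have "x i = 0" using a by auto
  then show False using nontrivial[OF assms] \<open>\<not> (y i \<noteq> 0 \<or> z i \<noteq> 0)\<close> by simp
qed

lemma H_ge_1: "H \<ge> 1"
  using row[of 0] H(2)[of 0] H(3)[of 0] by auto

lemma dependent_bc: assumes "i < 3" "x i = 0" shows "dependent_pair (b + i) (c + i)"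
  using rel[OF assms(1)] row[OF assms(1)] assms(2) b bc
  by (intro log_relation_dependent_pair[of _ _ "y i" "z i"]) auto

lemma no_two_x_zero: assumes "i < j" "j < 3" shows "x i \<noteq> 0 \<or> x j \<noteq> 0"
proof (rule ccontr)
  assume "\<not> ?thesis"
  then have d: "dependent_pair (b + i) (c + i)" "dependent_pair (b + j) (c + j)"
    using dependent_bc assms by auto
  consider "i = 0" "j = 1" | "i = 0" "j = 2" | "i = 1" "j = 2" using assms by linarith
  then show False
  proof cases
    case 1
    then show False using dependent_successor_pairs[of b c] d b bc c by auto
  next
    case 2
    then show False using no_dependent_pairs_gap_two[of b c] d b bc by auto
  next
    case 3
    then show False using dependent_successor_pairs[of "b + 1" "c + 1"] d b bc by (auto simp: numeral_2_eq_2)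
  qed
qed

lemma dependent_ab: assumes "i < 3" "z i = 0" shows "dependent_pair (a + i) (b + i)"
  using rel[OF assms(1)] row[OF assms(1)] assms(2) a b
  by (intro log_relation_dependent_pair[of _ _ "x i" "y i"]) auto

lemma no_two_z_zero: assumes "i < j" "j < 3" shows "z i \<noteq> 0 \<or> z j \<noteq> 0"
proof (rule ccontr)
  assume "\<not> ?thesis"
  then have d: "dependent_pair (a + i) (b + i)" "dependent_pair (a + j) (b + j)"
    using dependent_ab assms by auto
  have *: False if d: "dependent_pair (u + i) (v + i)" "dependent_pair (u + j) (v + j)" and uv: "u < v" "u \<ge> 2"
    and no28: "\<not> (u = 2 \<and> v = 8)" for u v
  proof -
    consider "i = 0" "j = 1" | "i = 0" "j = 2" | "i = 1" "j = 2" using assms by linarith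
    then show False
    proof cases
      case 1
      then show False using dependent_successor_pairs[of u v] d uv no28 by auto
    next
      case 2
      then show False using no_dependent_pairs_gap_two[of u v] d uv by auto
    next
      case 3
      then show False using dependent_successor_pairs[of "u + 1" "v + 1"] d uv by (auto simp: numeral_2_eq_2)
    qed
  qed
  show False
  proof (cases "a < b")
    case True
    then show False using *[of a b] d a by auto
  next
    case False
    then show False using *[of b a] d a b dependent_pair_commute by auto
  qed
qed

lemma b_bound:
  assumes C: "lower_bound_constant 3 C" and X: "X \<ge> 1" "ln (real (a + 2)) \<le> real X" "4 * real H ^ 3 \<le> exp (real X)"
  shows "real b \<le> 24 * real H ^ 3 * exp (real ((C * X) ^ C))"
proof -
  obtain t0 t1 t2 where t: "t0 * y 0 + t1 * y 1 + t2 * y 2 = 0" "t0 * z 0 + t1 * z 1 + t2 * z 2 = 0"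
    "t0 * x 0 \<noteq> 0 \<or> t1 * x 1 \<noteq> 0 \<or> t2 * x 2 \<noteq> 0"
    "\<bar>t0\<bar> \<le> 2 * (int H)\<^sup>2" "\<bar>t1\<bar> \<le> 2 * (int H)\<^sup>2" "\<bar>t2\<bar> \<le> 2 * (int H)\<^sup>2"
    using elimination_vector[of y z x "int H"] row no_two_x_zero H H_ge_1 by auto
  define \<alpha> where "\<alpha> i = a + i" for i
  define \<beta> where "\<beta> i = (if i = 0 then t0 * x 0 else if i = 1 then t1 * x 1 else t2 * x 2)" for i :: nat
  define \<Lambda> where "\<Lambda> = (\<Sum>i\<in>{0,1,2}. real_of_int (\<beta> i) * ln (real (\<alpha> i)))"
  have \<Lambda>: "\<Lambda> = real_of_int (t0 * x 0) * ln (real a) + real_of_int (t1 * x 1) * ln (real (a + 1))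
      + real_of_int (t2 * x 2) * ln (real (a + 2))"
    unfolding \<Lambda>_def \<alpha>_def \<beta>_def by (simp add: add_ac)
  have "\<Lambda> \<noteq> 0" using consecutive_independent[OF a(1)] t(3) unfolding \<Lambda> by blast
  have low: "exp (- real ((C * X) ^ C)) \<le> \<bar>\<Lambda>\<bar>"
    unfolding \<Lambda>_def
  proof (rule lower_bound_constantD[OF C])
    show "\<alpha> i \<ge> 2" for i unfolding \<alpha>_def using a by simp
    show "ln (real (\<alpha> i)) \<le> real X" if "i \<in> {0,1,2}" for i
    proof -
      have "ln (real (\<alpha> i)) \<le> ln (real (a + 2))" using that a unfolding \<alpha>_def by auto
      then show ?thesis using X(2) by simp
    qed
    show "2 * \<bar>real_of_int (\<beta> i)\<bar> \<le> exp (real X)" if "i \<in> {0,1,2}" for i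
    proof -
      have *: "\<bar>t * x i\<bar> \<le> 2 * int H ^ 3" if "\<bar>t\<bar> \<le> 2 * (int H)\<^sup>2" "i < 3" for t i
      proof -
        have "\<bar>t * x i\<bar> \<le> (2 * (int H)\<^sup>2) * int H"
          unfolding abs_mult using that H(1)[of i] by (intro mult_mono) auto
        then show ?thesis by (simp add: power2_eq_square power3_eq_cube)
      qed
      have "\<bar>\<beta> i\<bar> \<le> 2 * int H ^ 3"
        using *[OF t(4), of 0] *[OF t(5), of 1] *[OF t(6), of 2] that unfolding \<beta>_def by auto
      then have "real_of_int \<bar>\<beta> i\<bar> \<le> real_of_int (2 * int H ^ 3)" by (simp only: of_int_le_iff)
      then show ?thesis using X(3) by simp
    qed
    show "(\<Sum>i\<in>{0,1,2}. real_of_int (\<beta> i) * ln (real (\<alpha> i))) \<noteq> 0" using \<open>\<Lambda> \<noteq> 0\<close> unfolding \<Lambda>_def .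
  qed (use X in auto)
  define v w where "v i = ln (real (b + i)) - ln (real b)" and "w i = ln (real (c + i)) - ln (real c)" for i
  have \<Lambda>': "\<Lambda> = - (t0 * (y 0 * v 0 + z 0 * w 0) + t1 * (y 1 * v 1 + z 1 * w 1) + t2 * (y 2 * v 2 + z 2 * w 2))"
  proof -
    have e: "real_of_int (x i) * ln (real (a + i)) = - (y i * (v i + ln (real b)) + z i * (w i + ln (real c)))"
      if "i < 3" for i using rel[OF that] unfolding v_def w_def by simp
    have t': "real_of_int t0 * y 0 + real_of_int t1 * y 1 + real_of_int t2 * y 2 = 0"
      "real_of_int t0 * z 0 + real_of_int t1 * z 1 + real_of_int t2 * z 2 = 0"
      using arg_cong[OF t(1), of real_of_int] arg_cong[OF t(2), of real_of_int] by simp_all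
    have "\<Lambda> = t0 * (x 0 * ln (real (a + 0))) + t1 * (x 1 * ln (real (a + 1))) + t2 * (x 2 * ln (real (a + 2)))"
      unfolding \<Lambda> by simp
    also have "\<dots> = - (t0 * (y 0 * v 0 + z 0 * w 0) + t1 * (y 1 * v 1 + z 1 * w 1) + t2 * (y 2 * v 2 + z 2 * w 2))
       - (real_of_int t0 * y 0 + real_of_int t1 * y 1 + real_of_int t2 * y 2) * ln (real b)
       - (real_of_int t0 * z 0 + real_of_int t1 * z 1 + real_of_int t2 * z 2) * ln (real c)"
      by (subst (1 2 3) e) (simp_all add: algebra_simps)
    finally show ?thesis using t' by simp
  qed
  \<comment> \<open>The factor \<open>t\<close> contributes \<open>2 * H\<^sup>2\<close>, and the
    two products at most \<open>2 * H / b\<close> each. The three summands make up the constant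
    24.\<close>
  have summand: "\<bar>t * (y i * v i + z i * w i)\<bar> \<le> 8 * real H ^ 3 / real b"
    if "\<bar>t\<bar> \<le> 2 * (int H)\<^sup>2" "i < 3" for t i
  proof -
    have v: "\<bar>v i\<bar> \<le> 2 / real b" using ln_add_bounds[of b i] b that unfolding v_def by auto
    have "\<bar>w i\<bar> \<le> 2 / real c" using ln_add_bounds[of c i] c that unfolding w_def by auto
    also have "\<dots> \<le> 2 / real b" using b bc by (simp add: frac_le)
    finally have w: "\<bar>w i\<bar> \<le> 2 / real b" .
    have yz: "\<bar>real_of_int (y i)\<bar> \<le> real H" "\<bar>real_of_int (z i)\<bar> \<le> real H"
      using H(2,3)[OF that(2)] by linarith+
    have "\<bar>y i * v i + z i * w i\<bar> \<le> \<bar>y i * v i\<bar> + \<bar>z i * w i\<bar>" by (rule abs_triangle_ineq)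
    also have "\<dots> \<le> real H * (2 / real b) + real H * (2 / real b)"
      unfolding abs_mult using yz v w by (intro add_mono mult_mono) auto
    finally have s: "\<bar>y i * v i + z i * w i\<bar> \<le> 4 * real H / real b" by simp
    have "real_of_int \<bar>t\<bar> \<le> real_of_int (2 * (int H)\<^sup>2)" using that(1) by (simp only: of_int_le_iff)
    then have "\<bar>real_of_int t\<bar> \<le> 2 * (real H)\<^sup>2" by simp
    then have "\<bar>t * (y i * v i + z i * w i)\<bar> \<le> (2 * (real H)\<^sup>2) * (4 * real H / real b)"
      unfolding abs_mult[of "real_of_int t"] using s by (intro mult_mono) auto
    then show ?thesis by (simp add: power2_eq_square power3_eq_cube)
  qed
  have "\<bar>\<Lambda>\<bar> \<le> 8 * real H ^ 3 / real b + 8 * real H ^ 3 / real b + 8 * real H ^ 3 / real b"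
    unfolding \<Lambda>' using summand[OF t(4), of 0] summand[OF t(5), of 1] summand[OF t(6), of 2] by linarith
  then have "exp (- real ((C * X) ^ C)) \<le> 24 * real H ^ 3 / real b" using low by simp
  then have "exp (- real ((C * X) ^ C)) * real b \<le> 24 * real H ^ 3" using b by (simp add: field_simps)
  then have "exp (real ((C * X) ^ C)) * (exp (- real ((C * X) ^ C)) * real b) \<le> exp (real ((C * X) ^ C)) * (24 * real H ^ 3)"
    by (intro mult_left_mono) auto
  then show ?thesis unfolding mult.assoc[symmetric] exp_minus_inverse by (simp add: mult_ac)
qed

text \<open>The eliminated form is exactly \<open>z i * z j\<close> times the gap between
  \<open>ln (c + j)\<close> and \<open>ln (c + i)\<close>, hence visibly nonzero. Its four
  logarithms may be dependent or coincide, for instance when \<open>a + j = b + i\<close>, so the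
  general lower bound is required.\<close>

lemma c_bound:
  assumes C: "lower_bound_constant 4 C" and X: "X \<ge> 1" "ln (real (a + 2)) \<le> real X" "ln (real (b + 2)) \<le> real X"
    "2 * real H ^ 2 \<le> exp (real X)"
  shows "real c \<le> 2 * real H ^ 2 * exp (real ((C * X) ^ C))"
proof -
  obtain i j where ij: "i < j" "j < 3" "z i \<noteq> 0" "z j \<noteq> 0"
  proof (cases "z 0 = 0")
    case True
    then have "z 1 \<noteq> 0" "z 2 \<noteq> 0" using no_two_z_zero[of 0 1] no_two_z_zero[of 0 2] by auto
    then show thesis using that[of 1 2] by simp
  next
    case False
    show thesis
    proof (cases "z 1 = 0")
      case True
      then have "z 2 \<noteq> 0" using no_two_z_zero[of 1 2] by auto
      then show thesis using that[of 0 2] \<open>z 0 \<noteq> 0\<close> by simp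
    next
      case False
      then show thesis using that[of 0 1] \<open>z 0 \<noteq> 0\<close> by simp
    qed
  qed
  define \<alpha> where "\<alpha> k = (if k = 0 then a + i else if k = 1 then a + j else if k = 2 then b + i else b + j)" for k :: nat
  define \<beta> where "\<beta> k = (if k = 0 then z j * x i else if k = 1 then - (z i * x j)
      else if k = 2 then z j * y i else - (z i * y j))" for k :: nat
  define \<Lambda> where "\<Lambda> = (\<Sum>k\<in>{0,1,2,3}. real_of_int (\<beta> k) * ln (real (\<alpha> k)))"
  define d where "d = ln (real (c + j)) - ln (real (c + i))"
  have \<Lambda>: "\<Lambda> = real_of_int (z i) * real_of_int (z j) * d"
  proof -
    have "\<Lambda> = z j * (x i * ln (real (a + i)) + y i * ln (real (b + i)))
      - z i * (x j * ln (real (a + j)) + y j * ln (real (b + j)))"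
      unfolding \<Lambda>_def \<alpha>_def \<beta>_def by (simp add: algebra_simps)
    also have "x i * ln (real (a + i)) + y i * ln (real (b + i)) = - (z i * ln (real (c + i)))"
      using rel[of i] ij by simp
    also have "x j * ln (real (a + j)) + y j * ln (real (b + j)) = - (z j * ln (real (c + j)))"
      using rel[of j] ij by simp
    finally show ?thesis unfolding d_def by (simp add: algebra_simps)
  qed
  have d: "d > 0" unfolding d_def using ij c by simp
  have "d \<le> 2 / real c"
  proof -
    have "d \<le> ln (real (c + j)) - ln (real c)" unfolding d_def using c by simp
    also have "\<dots> \<le> 2 / real c" using ln_add_bounds[of c j] c ij by simp
    finally show ?thesis .
  qed
  have HH: "\<bar>real_of_int (m * n)\<bar> \<le> real H ^ 2" if "\<bar>m\<bar> \<le> int H" "\<bar>n\<bar> \<le> int H" for m n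
  proof -
    have "\<bar>real_of_int m\<bar> \<le> real H" "\<bar>real_of_int n\<bar> \<le> real H" using that by linarith+
    then show ?thesis unfolding of_int_mult abs_mult power2_eq_square by (intro mult_mono) auto
  qed
  have ij3: "i < 3" "j < 3" using ij by auto
  have low: "exp (- real ((C * X) ^ C)) \<le> \<bar>\<Lambda>\<bar>"
    unfolding \<Lambda>_def
  proof (rule lower_bound_constantD[OF C])
    show "\<alpha> k \<ge> 2" for k unfolding \<alpha>_def using a b by auto
    show "ln (real (\<alpha> k)) \<le> real X" for k
    proof -
      have "ln (real (\<alpha> k)) \<le> ln (real (a + 2)) \<or> ln (real (\<alpha> k)) \<le> ln (real (b + 2))"
        using ij a b unfolding \<alpha>_def by auto
      then show ?thesis using X(2,3) by linarith
    qed
    show "2 * \<bar>real_of_int (\<beta> k)\<bar> \<le> exp (real X)" for k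
    proof -
      have "\<bar>real_of_int (\<beta> k)\<bar> \<le> real H ^ 2"
        using HH[OF H(3)[OF ij3(2)] H(1)[OF ij3(1)]] HH[OF H(3)[OF ij3(1)] H(1)[OF ij3(2)]]
          HH[OF H(3)[OF ij3(2)] H(2)[OF ij3(1)]] HH[OF H(3)[OF ij3(1)] H(2)[OF ij3(2)]]
        unfolding \<beta>_def by auto
      then show ?thesis using X(4) by simp
    qed
    show "(\<Sum>k\<in>{0,1,2,3}. real_of_int (\<beta> k) * ln (real (\<alpha> k))) \<noteq> 0"
      unfolding \<Lambda>_def[symmetric] \<Lambda> using ij d by simp
  qed (use X in auto)
  have "\<bar>\<Lambda>\<bar> \<le> real H ^ 2 * (2 / real c)"
    using HH[OF H(3)[OF ij3(1)] H(3)[OF ij3(2)]] d \<open>d \<le> 2 / real c\<close>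
    unfolding \<Lambda> abs_mult[of _ d] of_int_mult by (intro mult_mono) auto
  then have "exp (- real ((C * X) ^ C)) \<le> 2 * real H ^ 2 / real c" using low by (simp add: mult.commute)
  then have "exp (- real ((C * X) ^ C)) * real c \<le> 2 * real H ^ 2" using c by (simp add: field_simps)
  then have "exp (real ((C * X) ^ C)) * (exp (- real ((C * X) ^ C)) * real c) \<le> exp (real ((C * X) ^ C)) * (2 * real H ^ 2)"
    by (intro mult_left_mono) auto
  then show ?thesis unfolding mult.assoc[symmetric] exp_minus_inverse by (simp add: mult_ac)
qed

end

section \<open>Computability of an iterated exponential\<close>

lemma effectively_computable_comp:
  assumes "effectively_computable F" "effectively_computable G"
  shows "effectively_computable (\<lambda>n. F (G n))"
proof -
  obtain f g where f: "general_recursive 1 f" "\<And>n. F n = f [n]" and g: "general_recursive 1 g" "\<And>n. G n = g [n]"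
    using assms unfolding effectively_computable_def by blast
  have "general_recursive 1 (\<lambda>xs. f (map (\<lambda>g. g xs) [g]))"
    by (rule general_recursive.comp) (use f g in auto)
  then show ?thesis using f g unfolding effectively_computable_def by auto
qed

lemma effectively_computable_add: "effectively_computable (\<lambda>n. n + k)"
proof (induction k)
  case 0
  have "general_recursive 1 (\<lambda>xs. xs ! 0)" by (rule general_recursive.proj) simp
  then show ?case unfolding effectively_computable_def by (intro exI[of _ "\<lambda>xs. xs ! 0"]) auto
next
  case (Suc k)
  have "effectively_computable Suc"
    unfolding effectively_computable_def using general_recursive.succ by (intro exI[of _ "\<lambda>xs. Suc (xs ! 0)"]) auto
  from effectively_computable_comp[OF this Suc] show ?case by simp
qed

lemma effectively_computable_power2: "effectively_computable (\<lambda>n. 2 ^ n)"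
proof -
  \<comment> \<open>The successor of a projection, spelled out in the shape that the composition
    rule produces, because \<open>general_recursive\<close> speaks about functions on all
    lists.\<close>
  define s where "s = (\<lambda>xs :: nat list. Suc (map (\<lambda>g. g xs) [\<lambda>xs. xs ! 1] ! 0))"
  have "general_recursive 3 s"
    unfolding s_def
    by (rule general_recursive.comp[of "[\<lambda>xs. xs ! 1]" "\<lambda>xs. Suc (xs ! 0)"])
       (auto simp: general_recursive.succ[unfolded One_nat_def] intro: general_recursive.proj[of 1 3, simplified])
  moreover define plus where "plus = (\<lambda>xs :: nat list. rec_nat (tl xs ! 0) (\<lambda>m r. s (m # r # tl xs)) (hd xs))"
  ultimately have "general_recursive (1 + 1) plus"
    unfolding plus_def using general_recursive.proj[of 0 1]
    by (intro general_recursive.prim_rec) (auto simp: numeral_3_eq_3)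
  moreover have plus: "plus [x, y] = x + y" for x y
    unfolding plus_def s_def by (induction x) auto
  moreover define dbl where "dbl = (\<lambda>xs :: nat list. plus (map (\<lambda>g. g xs) [\<lambda>xs. xs ! 1, \<lambda>xs. xs ! 1]))"
  ultimately have "general_recursive 2 dbl"
    unfolding dbl_def
    by (intro general_recursive.comp) (auto intro!: general_recursive.proj simp: numeral_2_eq_2)
  moreover define one where "one = (\<lambda>xs :: nat list. Suc (map (\<lambda>g. g xs) [\<lambda>xs. 0] ! 0))"
  have "general_recursive 0 one"
    unfolding one_def
    by (rule general_recursive.comp[of "[\<lambda>xs. 0]" "\<lambda>xs. Suc (xs ! 0)"])
       (auto simp: general_recursive.succ[unfolded One_nat_def] intro: general_recursive.zero)
  ultimately have "general_recursive (0 + 1) (\<lambda>xs. rec_nat (one (tl xs)) (\<lambda>m r. dbl (m # r # tl xs)) (hd xs))"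
    by (intro general_recursive.prim_rec) (auto simp: numeral_2_eq_2)
  moreover have "2 ^ n = rec_nat (one (tl [n])) (\<lambda>m r. dbl (m # r # tl [n])) (hd [n])" for n :: nat
    by (induction n) (auto simp: one_def dbl_def plus)
  ultimately show ?thesis unfolding effectively_computable_def by auto
qed

text \<open>The growth to be dominated is only doubly exponential. A third exponential absorbs
  constant factors into the shift \<open>k\<close>, so that addition of a constant and powers of 2
  suffice.\<close>

lemma effectively_computable_tower: "effectively_computable (\<lambda>n. 2 ^ 2 ^ 2 ^ (n + k))"
  by (intro effectively_computable_comp[OF effectively_computable_power2]
        effectively_computable_comp[OF effectively_computable_power2, of "\<lambda>n. n + k"] effectively_computable_add)

section \<open>The bound\<close>

text \<open>The bound for \<open>b\<close> enters the size parameter in the bound for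
  \<open>c\<close>; the composite is again of the form \<open>(D * X) ^ D\<close>.\<close>

lemma polynomial_composition_bound:
  fixes C1 C2 :: nat
  shows "\<exists>D\<ge>1. \<forall>X\<ge>1. 2 + X + (C2 * (2 * X + 2 + (C1 * X) ^ C1)) ^ C2 \<le> (D * X) ^ D"
proof -
  define E where "E = (C2 * (4 + C1 ^ C1)) ^ C2"
  define D where "D = 3 + E + (C1 + 1) * C2 + 1"
  have "2 + X + (C2 * (2 * X + 2 + (C1 * X) ^ C1)) ^ C2 \<le> (D * X) ^ D" if X: "X \<ge> 1" for X
  proof -
    have p: "X \<le> X ^ (C1 + 1)" "1 \<le> X ^ (C1 + 1)" "X ^ C1 \<le> X ^ (C1 + 1)"
      using X power_increasing[of 1 "C1 + 1" X] power_increasing[of C1 "C1 + 1" X] by (auto simp: one_le_power)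
    have "(C1 * X) ^ C1 \<le> C1 ^ C1 * X ^ (C1 + 1)"
      unfolding power_mult_distrib using p(3) by (rule mult_le_mono2)
    then have "2 * X + 2 + (C1 * X) ^ C1 \<le> 2 * X ^ (C1 + 1) + 2 * X ^ (C1 + 1) + C1 ^ C1 * X ^ (C1 + 1)"
      using p by linarith
    then have "C2 * (2 * X + 2 + (C1 * X) ^ C1) \<le> C2 * ((4 + C1 ^ C1) * X ^ (C1 + 1))"
      by (intro mult_le_mono2) (simp add: algebra_simps)
    then have "(C2 * (2 * X + 2 + (C1 * X) ^ C1)) ^ C2 \<le> (C2 * ((4 + C1 ^ C1) * X ^ (C1 + 1))) ^ C2"
      by (rule power_mono) simp
    also have "\<dots> = E * X ^ ((C1 + 1) * C2)"
      unfolding E_def mult.assoc[symmetric] by (subst power_mult_distrib) (simp only: power_mult)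
    also have "\<dots> \<le> E * X ^ ((C1 + 1) * C2 + 1)"
      using X by (intro mult_le_mono2 power_increasing) auto
    finally have 1: "(C2 * (2 * X + 2 + (C1 * X) ^ C1)) ^ C2 \<le> E * X ^ ((C1 + 1) * C2 + 1)" .
    have "X ^ 1 \<le> X ^ ((C1 + 1) * C2 + 1)" using X by (intro power_increasing) auto
    then have 2: "2 + X \<le> 3 * X ^ ((C1 + 1) * C2 + 1)" using X by (simp del: power_Suc)
    have "2 + X + (C2 * (2 * X + 2 + (C1 * X) ^ C1)) ^ C2 \<le> (3 + E) * X ^ ((C1 + 1) * C2 + 1)"
      using add_mono[OF 2 1] by (simp only: distrib_right[of 3 E])
    also have "\<dots> \<le> D ^ D * X ^ D"
    proof (rule mult_le_mono)
      have "3 + E \<le> D ^ 1" unfolding D_def by simp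
      also have "\<dots> \<le> D ^ D" by (intro power_increasing) (auto simp: D_def)
      finally show "3 + E \<le> D ^ D" .
      show "X ^ ((C1 + 1) * C2 + 1) \<le> X ^ D" using X by (intro power_increasing) (auto simp: D_def)
    qed
    finally show ?thesis by (simp add: power_mult_distrib)
  qed
  moreover have "D \<ge> 1" unfolding D_def by simp
  ultimately show ?thesis by blast
qed

lemma ln_le_two_sqrt: "x > 0 \<Longrightarrow> ln x \<le> 2 * sqrt (x :: real)"
proof -
  assume x: "x > 0"
  have "ln x = 2 * ln (sqrt x)" using x by (simp add: ln_sqrt)
  also have "\<dots> \<le> 2 * sqrt x" using ln_bound[of "sqrt x"] x by simp
  finally show ?thesis .
qed

text \<open>If \<open>s = ln X\<close> exceeded the bound, it would dominate \<open>A + 920\<close>,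
  so \<open>X \<le> (82 * D * s) ^ D\<close>, and taking logarithms
  \<open>s \<le> 84 * D\<^sup>2 * sqrt s\<close>. The constant does not depend on \<open>A\<close>,
  so \<open>a\<close> will enter the result only additively.\<close>

lemma self_bounded_logarithm:
  fixes A X :: real and D :: nat
  assumes D: "D \<ge> 1" and A: "A \<ge> 0" and X: "X \<ge> 1" and le: "X \<le> (real D * (A + 920 + 81 * ln X)) ^ D"
  shows "ln X \<le> A + (920 + (84 * (real D)\<^sup>2)\<^sup>2)"
proof (rule ccontr)
  define s d where "s = ln X" and "d = real D"
  assume "\<not> ?thesis"
  then have s: "s > A + (920 + (84 * d\<^sup>2)\<^sup>2)" unfolding s_def d_def by simp
  have d: "d \<ge> 1" unfolding d_def using D by simp
  have sq: "0 \<le> (84 * d\<^sup>2)\<^sup>2" by simp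
  have s1: "s \<ge> 1" "A + 920 \<le> s" using s A sq by linarith+
  have "X \<le> (d * (82 * s)) ^ D"
  proof -
    have "d * (A + 920 + 81 * s) \<le> d * (82 * s)" using s1 d by (intro mult_left_mono) auto
    then have "(d * (A + 920 + 81 * s)) ^ D \<le> (d * (82 * s)) ^ D"
      using d A s1 by (intro power_mono) auto
    then show ?thesis using le unfolding s_def d_def by linarith
  qed
  then have "s \<le> ln ((d * (82 * s)) ^ D)" unfolding s_def using X by simp
  also have "\<dots> = d * ln (d * (82 * s))" using d s1 unfolding d_def by (subst ln_realpow) auto
  also have "ln (d * (82 * s)) = ln (82 * d) + ln s"
    using d s1 ln_mult[of "82 * d" s] by (simp add: mult_ac)
  also have "d * (ln (82 * d) + ln s) \<le> d * (82 * d * sqrt s + 2 * d * sqrt s)"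
  proof (intro mult_left_mono add_mono)
    have "ln (82 * d) \<le> 82 * d" using d ln_bound[of "82 * d"] by simp
    also have "\<dots> * 1 \<le> 82 * d * sqrt s" using d s1 by (intro mult_left_mono) auto
    finally show "ln (82 * d) \<le> 82 * d * sqrt s" by simp
    have "ln s \<le> 2 * sqrt s" using s1 by (intro ln_le_two_sqrt) auto
    also have "\<dots> \<le> 2 * d * sqrt s" using d s1 by (intro mult_right_mono) auto
    finally show "ln s \<le> 2 * d * sqrt s" .
  qed (use d in auto)
  also have "\<dots> = 84 * d\<^sup>2 * sqrt s" by (simp add: algebra_simps power2_eq_square)
  finally have "sqrt s * sqrt s \<le> 84 * d\<^sup>2 * sqrt s" using s1 by simp
  then have "sqrt s \<le> 84 * d\<^sup>2" by (rule mult_right_le_imp_le) (use s1 in simp)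
  then have "(sqrt s)\<^sup>2 \<le> (84 * d\<^sup>2)\<^sup>2" using s1 by (intro power_mono) auto
  then show False using s A s1 by simp
qed

lemma uniform_bound:
  "\<exists>K. \<forall>(a :: nat) (b :: nat) (c :: nat) (x :: nat \<Rightarrow> int) y z. 3 \<le> a \<longrightarrow> a \<noteq> 8 \<longrightarrow> 2 \<le> b \<longrightarrow> b \<noteq> a \<longrightarrow> b < c \<longrightarrow> 9 \<le> c \<longrightarrow> a \<le> c \<longrightarrow>
    (\<forall>i<3. x i \<noteq> 0 \<or> y i \<noteq> 0 \<or> z i \<noteq> 0) \<longrightarrow>
    (\<forall>i<3. real_of_int (x i) * ln (real (a + i)) + real_of_int (y i) * ln (real (b + i))
        + real_of_int (z i) * ln (real (c + i)) = 0) \<longrightarrow>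
    real c + 2 \<le> exp (exp (real (a + K)))"
proof -
  obtain C1 C2 where C: "lower_bound_constant 3 C1" "lower_bound_constant 4 C2"
    using linear_form_lower_bound_dependent by blast
  obtain D where D: "D \<ge> 1" "\<And>X. X \<ge> 1 \<Longrightarrow> 2 + X + (C2 * (2 * X + 2 + (C1 * X) ^ C1)) ^ C2 \<le> (D * X) ^ D"
    using polynomial_composition_bound[of C2 C1] by blast
  define K where "K = 920 + (84 * D\<^sup>2)\<^sup>2"
  have "real c + 2 \<le> exp (exp (real (a + K)))"
    if a: "3 \<le> a" "a \<noteq> 8" and b: "2 \<le> b" "b \<noteq> a" and bc: "b < c" and c: "9 \<le> c" "a \<le> c"
      and nontriv: "\<And>i. i < 3 \<Longrightarrow> x i \<noteq> 0 \<or> y i \<noteq> 0 \<or> z i \<noteq> 0"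
      and rel: "\<And>i. i < 3 \<Longrightarrow> real_of_int (x i) * ln (real (a + i)) + real_of_int (y i) * ln (real (b + i))
        + real_of_int (z i) * ln (real (c + i)) = 0"
    for a b c and x y z :: "nat \<Rightarrow> int"
  proof -
    define X where "X = nat \<lceil>ln (real (c + 2))\<rceil>"
    have lnc: "ln (real (c + 2)) > 0" by simp
    have X: "ln (real (c + 2)) \<le> real X" "real X \<le> ln (real (c + 2)) + 1"
      unfolding X_def using lnc by linarith+
    have X1: "X \<ge> 1" using X(1) lnc by (cases X) auto
    \<comment> \<open>The numbers are \<open>4 * 3\<close> and \<open>3 ^ 3\<close>, from the bound
      on relations between three logarithms.\<close>
    define H where "H = (12 * X) ^ 27"
    define \<alpha> where "\<alpha> i k = (if k = 0 then a + i else if k = 1 then b + i else c + i)" for i k :: nat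
    have ex: "\<exists>k. (\<exists>j\<in>{0,1,2}. k j \<noteq> 0) \<and> (\<forall>j\<in>{0,1,2}. \<bar>k j\<bar> \<le> int H) \<and>
      (\<Sum>j\<in>{0,1,2}. real_of_int (k j) * ln (real (\<alpha> i j))) = 0" if i: "i < 3" for i
    proof -
      define k where "k j = (if j = 0 then x i else if j = 1 then y i else z i)" for j :: nat
      have k: "\<exists>j\<in>{0,1,2}. k j \<noteq> 0" unfolding k_def using nontriv[OF i] by auto
      have s: "(\<Sum>j\<in>{0,1,2}. real_of_int (k j) * ln (real (\<alpha> i j))) = 0"
        unfolding k_def \<alpha>_def using rel[OF i] by (simp add: add.assoc)
      have \<alpha>1: "\<alpha> i j \<ge> 1" for j unfolding \<alpha>_def using a b bc by auto
      have \<alpha>X: "ln (real (\<alpha> i j)) \<le> real X" for j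
      proof -
        have "\<alpha> i j \<le> c + 2" unfolding \<alpha>_def using i bc c by auto
        then have "ln (real (\<alpha> i j)) \<le> ln (real (c + 2))" using \<alpha>1[of j] by (subst ln_le_cancel_iff) auto
        then show ?thesis using X(1) by simp
      qed
      have H_eq: "(4 * 3 * X) ^ (3 ^ 3) = H" unfolding H_def by simp
      show ?thesis
        using bounded_log_relation[of "{0,1,2}" 3 "\<alpha> i" X k, OF _ _ \<alpha>1 \<alpha>X X1 k s] unfolding H_eq by simp
    qed
    then have "\<forall>i. \<exists>k. i < 3 \<longrightarrow> (\<exists>j\<in>{0,1,2}. k j \<noteq> 0) \<and> (\<forall>j\<in>{0,1,2}. \<bar>k j\<bar> \<le> int H) \<and>
      (\<Sum>j\<in>{0,1,2}. real_of_int (k j) * ln (real (\<alpha> i j))) = 0" by blast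
    from choice[OF this] obtain k where k: "\<forall>i. i < 3 \<longrightarrow> (\<exists>j\<in>{0,1,2}. k i j \<noteq> 0) \<and> (\<forall>j\<in>{0,1,2}. \<bar>k i j\<bar> \<le> int H) \<and>
      (\<Sum>j\<in>{0,1,2}. real_of_int (k i j) * ln (real (\<alpha> i j))) = 0" ..
    interpret dependent_triples a b c "\<lambda>i. k i 0" "\<lambda>i. k i 1" "\<lambda>i. k i 2" H
    proof
      fix i :: nat assume i: "i < 3"
      note ki = k[rule_format, OF i]
      show "k i 0 \<noteq> 0 \<or> k i 1 \<noteq> 0 \<or> k i 2 \<noteq> 0" using ki by auto
      show "real_of_int (k i 0) * ln (real (a + i)) + real_of_int (k i 1) * ln (real (b + i))
        + real_of_int (k i 2) * ln (real (c + i)) = 0"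
        using ki unfolding \<alpha>_def by (simp add: add.assoc)
      show "\<bar>k i 0\<bar> \<le> int H" "\<bar>k i 1\<bar> \<le> int H" "\<bar>k i 2\<bar> \<le> int H" using ki by auto
    qed (use a b bc c in auto)
    have H1: "real H \<ge> 1" using H_ge_1 by simp
    \<comment> \<open>\<open>Lg\<close> has the order of \<open>ln ln c\<close> and covers the
      constant factors in the bounds for \<open>b\<close> and for \<open>c\<close>.\<close>
    define Lg where "Lg = nat \<lceil>ln (24 * real H ^ 3)\<rceil>"
    have H3: "1 \<le> real H ^ 3" using H1 by (rule one_le_power)
    have lnH: "ln (24 * real H ^ 3) > 0" using H3 by (intro ln_gt_zero) linarith
    have Lg: "ln (24 * real H ^ 3) \<le> real Lg" "real Lg \<le> ln (24 * real H ^ 3) + 1"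
      unfolding Lg_def using lnH by linarith+
    have expLg: "24 * real H ^ 3 \<le> exp (real Lg)"
    proof -
      have "24 * real H ^ 3 > 0" using H3 by linarith
      then have "24 * real H ^ 3 = exp (ln (24 * real H ^ 3))" by (rule exp_ln[symmetric])
      then show ?thesis using Lg(1) by (metis exp_le_cancel_iff)
    qed
    define Y where "Y = a + 2 + Lg"
    have Y1: "Y \<ge> 1" unfolding Y_def by simp
    have lna: "ln (real (a + 2)) \<le> real (a + 2)" by (rule ln_bound) simp
    have exp_mono': "24 * real H ^ 3 \<le> exp (real u)" if "Lg \<le> u" for u
      using expLg that by (smt (verit) exp_le_cancel_iff of_nat_le_iff)
    define M1 where "M1 = (C1 * Y) ^ C1"
    have "real b \<le> 24 * real H ^ 3 * exp (real M1)"
      unfolding M1_def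
    proof (rule b_bound[OF C(1) Y1])
      show "ln (real (a + 2)) \<le> real Y" using lna unfolding Y_def by simp
      show "4 * real H ^ 3 \<le> exp (real Y)" using exp_mono'[of Y] H3 unfolding Y_def by simp
    qed
    also have "\<dots> \<le> exp (real Lg) * exp (real M1)" using expLg by (intro mult_right_mono) auto
    finally have "real (b + 2) \<le> exp 1 * (exp (real Lg) * exp (real M1))"
    proof -
      have "2 \<le> exp (1::real)" using exp_ge_add_one_self[of 1] by simp
      moreover assume "real b \<le> exp (real Lg) * exp (real M1)"
      ultimately have "2 * real b \<le> exp 1 * (exp (real Lg) * exp (real M1))" by (intro mult_mono) auto
      then show ?thesis using b(1) by simp
    qed
    then have "real (b + 2) \<le> exp (1 + real Lg + real M1)" by (simp add: exp_add mult.assoc)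
    then have "ln (real (b + 2)) \<le> ln (exp (1 + real Lg + real M1))" by (subst ln_le_cancel_iff) auto
    then have lnb: "ln (real (b + 2)) \<le> 1 + real Lg + real M1" by simp
    \<comment> \<open>The size parameter of the second form must exceed
      \<open>ln (b + 2) \<le> 1 + Lg + M1\<close>.\<close>
    define U where "U = 2 * Y + 2 + M1"
    define M2 where "M2 = (C2 * U) ^ C2"
    have "real c \<le> 2 * real H ^ 2 * exp (real M2)"
      unfolding M2_def
    proof (rule c_bound[OF C(2)])
      show "U \<ge> 1" unfolding U_def by simp
      show "ln (real (a + 2)) \<le> real U" using lna unfolding U_def Y_def by simp
      show "ln (real (b + 2)) \<le> real U" using lnb unfolding U_def Y_def by simp
      have "real H ^ 2 \<le> real H ^ 3" using H1 by (intro power_increasing) auto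
      moreover have "24 * real H ^ 3 \<le> exp (real U)" by (rule exp_mono') (simp add: U_def Y_def)
      ultimately show "2 * real H ^ 2 \<le> exp (real U)" using H3 by linarith
    qed
    also have "\<dots> \<le> exp (real Lg) * exp (real M2)"
    proof (rule mult_right_mono)
      have "real H ^ 2 \<le> real H ^ 3" using H1 by (intro power_increasing) auto
      then show "2 * real H ^ 2 \<le> exp (real Lg)" using expLg H3 by linarith
    qed simp
    finally have "real (c + 2) \<le> exp 1 * (exp (real Lg) * exp (real M2))"
    proof -
      have "2 \<le> exp (1::real)" using exp_ge_add_one_self[of 1] by simp
      moreover assume "real c \<le> exp (real Lg) * exp (real M2)"
      ultimately have "2 * real c \<le> exp 1 * (exp (real Lg) * exp (real M2))" by (intro mult_mono) auto
      then show ?thesis using c(1) by simp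
    qed
    then have "real (c + 2) \<le> exp (1 + real Lg + real M2)" by (simp add: exp_add mult.assoc)
    then have "ln (real (c + 2)) \<le> ln (exp (1 + real Lg + real M2))" by (subst ln_le_cancel_iff) auto
    then have lnc': "ln (real (c + 2)) \<le> 1 + real Lg + real M2" by simp
    have "real X \<le> real (2 + Y + M2)" using lnc' X(2) unfolding Y_def by simp
    also have "\<dots> \<le> real ((D * Y) ^ D)"
      using D(2)[OF Y1] unfolding M2_def U_def M1_def by (simp only: of_nat_le_iff)
    also have "\<dots> \<le> (real D * (real a + 920 + 81 * ln (real X))) ^ D"
    proof -
      \<comment> \<open>Here \<open>H ^ 3 = (12 * X) ^ 81\<close>. With the crude values below, the
        constant terms of \<open>Y\<close> amount to \<open>2 + 1 + 23 + 81 * 11 = 917\<close>,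
        which is rounded up to 920.\<close>
      have "ln (24 * real H ^ 3) = ln 24 + 81 * (ln 12 + ln (real X))"
      proof -
        define u where "u = 12 * real X"
        have u: "u > 0" unfolding u_def using X1 by simp
        have "real H = u ^ 27" unfolding H_def u_def by (simp only: of_nat_power of_nat_mult of_nat_numeral)
        then have "real H ^ 3 = u ^ 81" by (simp add: power_mult[symmetric])
        then have "ln (24 * real H ^ 3) = ln 24 + 81 * ln u" using u by (simp add: ln_mult ln_realpow)
        also have "ln u = ln 12 + ln (real X)" unfolding u_def using X1 by (simp add: ln_mult)
        finally show ?thesis .
      qed
      moreover have "ln (24::real) \<le> 23" "ln (12::real) \<le> 11"
        using ln_le_minus_one[of "24::real"] ln_le_minus_one[of "12::real"] by auto
      ultimately have "real Y \<le> real a + 920 + 81 * ln (real X)" using Lg(2) unfolding Y_def by simp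
      then have "real D * real Y \<le> real D * (real a + 920 + 81 * ln (real X))" by (intro mult_left_mono) auto
      then show ?thesis unfolding of_nat_power of_nat_mult by (intro power_mono) auto
    qed
    finally have "ln (real X) \<le> real a + (920 + (84 * (real D)\<^sup>2)\<^sup>2)"
      using X1 D(1) by (intro self_bounded_logarithm) auto
    then have "ln (real X) \<le> real (a + K)" unfolding K_def by simp
    then have "real X \<le> exp (real (a + K))" using X1 by (metis exp_le_cancel_iff exp_ln of_nat_0_less_iff less_le_trans zero_less_one)
    then have "ln (real (c + 2)) \<le> exp (real (a + K))" using X(1) by linarith
    then have "exp (ln (real (c + 2))) \<le> exp (exp (real (a + K)))" by (simp only: exp_le_cancel_iff)
    then show ?thesis by simp
  qed
  then show ?thesis by (intro exI[of _ K]) blast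
qed

lemma exp_exp_le_tower:
  fixes a j k :: nat
  assumes "k \<ge> 2 * j + 2"
  shows "exp (exp (real (a + j))) \<le> real (2 ^ 2 ^ 2 ^ (a + k))"
proof -
  have e4: "exp (real n) \<le> real (2 ^ (2 * n))" for n
  proof -
    have "exp (real n) = exp 1 ^ n" by (simp add: exp_of_nat_mult[symmetric])
    also have "\<dots> \<le> 4 ^ n" using exp_le by (intro power_mono) auto
    finally show ?thesis by (simp add: power_mult)
  qed
  have "exp (exp (real (a + j))) \<le> exp (real (2 ^ (2 * (a + j))))"
    using e4[of "a + j"] by (simp only: exp_le_cancel_iff)
  also have "\<dots> \<le> real (2 ^ (2 * 2 ^ (2 * (a + j))))" by (rule e4)
  also have "\<dots> = real (2 ^ 2 ^ (2 * (a + j) + 1))" by simp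
  also have "\<dots> \<le> real (2 ^ 2 ^ 2 ^ (a + k))"
  proof -
    have "(a + 1) * (k + 1) \<le> 2 ^ a * 2 ^ k"
      by (intro mult_le_mono) (simp_all add: Suc_leI)
    moreover have "2 * (a + j) + 1 \<le> (a + 1) * (k + 1)"
    proof -
      have "a \<le> a * k" using assms by simp
      then obtain e where e: "a * k = a + e" by (metis le_iff_add)
      have "2 * (a + j) + 1 \<le> a * k + a + k + 1" unfolding e using assms by simp
      then show ?thesis by (simp add: algebra_simps)
    qed
    ultimately have "2 * (a + j) + 1 \<le> 2 ^ (a + k)" by (simp add: power_add)
    then show ?thesis unfolding of_nat_le_iff by (intro power_increasing) auto
  qed
  finally show ?thesis .
qed

lemma multiplicatively_dependent_log_relation:
  fixes a b c :: int
  assumes "a \<ge> 1" "b \<ge> 1" "c \<ge> 1" "multiplicatively_dependent [of_int a, of_int b, of_int c]"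
  shows "\<exists>x y z :: int. (x \<noteq> 0 \<or> y \<noteq> 0 \<or> z \<noteq> 0) \<and>
    real_of_int x * ln (real (nat a)) + real_of_int y * ln (real (nat b)) + real_of_int z * ln (real (nat c)) = 0"
proof -
  define zs where "zs = [of_int a, of_int b, of_int c :: complex]"
  obtain ks :: "int list" where ks: "length ks = length zs" "\<exists>k\<in>set ks. k \<noteq> 0"
    "(\<Prod>i<length zs. (zs ! i) powi (ks ! i)) = 1"
    using assms(4) unfolding multiplicatively_dependent_def zs_def[symmetric] by blast
  obtain x y z where xyz: "ks = [x, y, z]"
    using ks(1) unfolding zs_def by (auto simp: length_Suc_conv)
  have "(of_int a powi x * of_int b powi y * of_int c powi z :: complex) = 1"
    using ks(3) unfolding xyz zs_def by (simp add: lessThan_Suc mult_ac)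
  then have "complex_of_real (real_of_int a powi x * real_of_int b powi y * real_of_int c powi z) = complex_of_real 1"
    by simp
  then have 1: "real_of_int a powi x * real_of_int b powi y * real_of_int c powi z = 1"
    by (simp only: of_real_eq_iff)
  have ln_powi: "ln (r powi k) = real_of_int k * ln r" if "r > 0" for r :: real and k
    using that by (simp add: powr_real_of_int'[symmetric] ln_powr)
  have "ln (real_of_int a powi x * real_of_int b powi y * real_of_int c powi z) =
     real_of_int x * ln (real_of_int a) + real_of_int y * ln (real_of_int b) + real_of_int z * ln (real_of_int c)"
    using assms(1-3) by (simp add: ln_mult ln_powi zero_less_power_int)
  then have "real_of_int x * ln (real_of_int a) + real_of_int y * ln (real_of_int b) + real_of_int z * ln (real_of_int c) = 0"
    unfolding 1 by simp
  moreover have "x \<noteq> 0 \<or> y \<noteq> 0 \<or> z \<noteq> 0" using ks(2) unfolding xyz by auto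
  ultimately show ?thesis using assms(1-3) by (intro exI[of _ x] exI[of _ y] exI[of _ z]) simp
qed

theorem theorem3p4:
  shows "\<exists>C :: nat \<Rightarrow> nat. effectively_computable C \<and>
    (\<forall>a :: int. a > 1 \<and> a \<notin> {2, 8} \<longrightarrow>
      (\<forall>b c :: int. b > 1 \<and> c > 1 \<and> b \<noteq> c \<and> b \<noteq> a \<and> c \<noteq> a \<and>
        multiplicatively_dependent [of_int a, of_int b, of_int c] \<and>
        multiplicatively_dependent [of_int (a + 1), of_int (b + 1), of_int (c + 1)] \<and>
        multiplicatively_dependent [of_int (a + 2), of_int (b + 2), of_int (c + 2)]
        \<longrightarrow> Max {a, b, c} < int (C (nat a))))"
proof -
  from uniform_bound obtain K where K: "\<forall>(a :: nat) (b :: nat) (c :: nat) (x :: nat \<Rightarrow> int) y z. 3 \<le> a \<longrightarrow> a \<noteq> 8 \<longrightarrow> 2 \<le> b \<longrightarrow>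
    b \<noteq> a \<longrightarrow> b < c \<longrightarrow> 9 \<le> c \<longrightarrow> a \<le> c \<longrightarrow> (\<forall>i<3. x i \<noteq> 0 \<or> y i \<noteq> 0 \<or> z i \<noteq> 0) \<longrightarrow>
    (\<forall>i<3. real_of_int (x i) * ln (real (a + i)) + real_of_int (y i) * ln (real (b + i))
        + real_of_int (z i) * ln (real (c + i)) = 0) \<longrightarrow>
    real c + 2 \<le> exp (exp (real (a + K)))" by (rule exE)
  \<comment> \<open>The factor 2 comes from \<open>exp n \<le> 4 ^ n\<close>. The summand 10 gives
    \<open>n + 10 < C n\<close>, which settles \<open>c < 9\<close> and
    \<open>c < a\<close>.\<close>
  define k where "k = 2 * K + 10"
  define C where "C n = (2 :: nat) ^ 2 ^ 2 ^ (n + k)" for n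
  have C_large: "n + 10 < C n" for n
  proof -
    have "n + 10 \<le> n + k" unfolding k_def by simp
    also have "\<dots> < 2 ^ (n + k)" by simp
    also have "\<dots> < 2 ^ 2 ^ (n + k)" by simp
    also have "\<dots> < C n" unfolding C_def by simp
    finally show ?thesis .
  qed
  \<comment> \<open>Formulated with relations between logarithms, so that exchanging
    \<open>b\<close> and \<open>c\<close> merely permutes the coefficients.\<close>
  have ordered: "b < int (C (nat a)) \<and> c < int (C (nat a))"
    if a: "a > 1" "a \<notin> {2, 8}" and bc: "b > 1" "c > 1" "b < c" "b \<noteq> a"
      and dep: "\<And>i. i \<in> {0, 1, 2} \<Longrightarrow> \<exists>x y z :: int. (x \<noteq> 0 \<or> y \<noteq> 0 \<or> z \<noteq> 0) \<and>
        real_of_int x * ln (real (nat (a + i))) + real_of_int y * ln (real (nat (b + i)))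
        + real_of_int z * ln (real (nat (c + i))) = 0"
    for a b c :: int
  proof (cases "9 \<le> c \<and> a \<le> c")
    case False
    then have "c < a + 10" using a by auto
    then show ?thesis using C_large[of "nat a"] bc(3) a(1) by linarith
  next
    case True
    define P where "P i x y z \<longleftrightarrow> (x \<noteq> 0 \<or> y \<noteq> 0 \<or> z \<noteq> 0) \<and>
        real_of_int x * ln (real (nat a + i)) + real_of_int y * ln (real (nat b + i))
        + real_of_int z * ln (real (nat c + i)) = 0" for i :: nat and x y z :: int
    have "\<exists>x y z. P i x y z" if "i < 3" for i
    proof -
      have "int i \<in> {0, 1, 2}" using that by auto
      moreover have "nat (a + int i) = nat a + i" "nat (b + int i) = nat b + i" "nat (c + int i) = nat c + i"
        using a bc by (auto simp: nat_add_distrib)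
      ultimately show ?thesis using dep[of "int i"] unfolding P_def by simp
    qed
    then obtain x y z where xyz: "\<And>i. i < 3 \<Longrightarrow> P i (x i) (y i) (z i)" by metis
    have "real (nat c) + 2 \<le> exp (exp (real (nat a + K)))"
      by (rule K[rule_format, where b = "nat b" and x = x and y = y and z = z])
         (use a bc True xyz[unfolded P_def] in auto)
    also have "\<dots> \<le> real (C (nat a))" unfolding C_def by (rule exp_exp_le_tower) (simp add: k_def)
    finally have "c < int (C (nat a))" using bc by linarith
    then show ?thesis using bc by simp
  qed
  have "Max {a, b, c} < int (C (nat a))"
    if a: "a > 1" "a \<notin> {2, 8}" and bc: "b > 1" "c > 1" "b \<noteq> c" "b \<noteq> a" "c \<noteq> a"
      and dep: "multiplicatively_dependent [of_int a, of_int b, of_int c]"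
        "multiplicatively_dependent [of_int (a + 1), of_int (b + 1), of_int (c + 1)]"
        "multiplicatively_dependent [of_int (a + 2), of_int (b + 2), of_int (c + 2)]"
    for a b c :: int
  proof -
    have rel: "\<exists>x y z :: int. (x \<noteq> 0 \<or> y \<noteq> 0 \<or> z \<noteq> 0) \<and>
        real_of_int x * ln (real (nat (a + i))) + real_of_int y * ln (real (nat (b + i)))
        + real_of_int z * ln (real (nat (c + i))) = 0" if i: "i \<in> {0, 1, 2}" for i
    proof -
      consider "i = 0" | "i = 1" | "i = 2" using i by auto
      then have "multiplicatively_dependent [of_int (a + i), of_int (b + i), of_int (c + i)]"
        using dep by cases simp_all
      then show ?thesis
        by (rule multiplicatively_dependent_log_relation[rotated 3]) (use i a(1) bc(1,2) in auto)
    qed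
    have "b < int (C (nat a)) \<and> c < int (C (nat a))"
    proof (cases "b < c")
      case True
      then show ?thesis using ordered[OF a bc(1,2) True bc(4) rel] by blast
    next
      case False
      then have "c < b" using bc(3) by simp
      have "\<exists>x y z :: int. (x \<noteq> 0 \<or> y \<noteq> 0 \<or> z \<noteq> 0) \<and>
        real_of_int x * ln (real (nat (a + i))) + real_of_int y * ln (real (nat (c + i)))
        + real_of_int z * ln (real (nat (b + i))) = 0" if i: "i \<in> {0, 1, 2}" for i
      proof -
        obtain x y z :: int where xyz: "x \<noteq> 0 \<or> y \<noteq> 0 \<or> z \<noteq> 0"
          "real_of_int x * ln (real (nat (a + i))) + real_of_int y * ln (real (nat (b + i)))
            + real_of_int z * ln (real (nat (c + i))) = 0" using rel[OF i] by blast
        then show ?thesis by (intro exI[of _ x] exI[of _ z] exI[of _ y]) auto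
      qed
      from ordered[OF a bc(2,1) \<open>c < b\<close> bc(5) this] show ?thesis by blast
    qed
    moreover have "a < int (C (nat a))" using C_large[of "nat a"] a(1) by linarith
    ultimately show ?thesis by simp
  qed
  moreover have "effectively_computable C"
    unfolding C_def by (rule effectively_computable_tower)
  ultimately show ?thesis by blast
qed

end
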